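(* Let $\Omega\subseteq\mathbb{C}$ be an open set, let $\zeta_0\in\overline{\Omega}$, and let $\mathcal{F}\subseteq\mathbb{N}\times\mathbb{N}$ contain a sequence $(\tilde p_n,\tilde q_n)\in\mathcal{F}$, $n=1,2,\dots$, with $\tilde p_n\to+\infty$ and $\tilde q_n\to+\infty$ as $n\to+\infty$. Then there exist a function $f\in A^\infty(\Omega)$ and a sequence $(p_n,q_n)\in\mathcal{F}$, $n=1,2,\dots$, such that for every compact set $K\subseteq\overline{\Omega}$ the following hold: $f\in\mathcal{D}_{p_n,q_n}(\zeta_0)$ for all $n=1,2,\dots$, and $\sup_{z\in K}\big|[p_n/q_n]^{(\ell)}_{f,\zeta_0}(z)-f^{(\ell)}(z)\big|\to 0$ as $n\to+\infty$, for every $\ell=0,1,2,\dots$. Moreover, the set of such functions $f\in X^\infty$ (those for which such a sequence $(p_n,q_n)$ exists) is $G_\delta$ and dense in $X^\infty$.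
   Context: $\overline{\Omega}$ is the closure of $\Omega$ in $\mathbb{C}$. $A^\infty(\Omega)$ is the set of $f$ holomorphic in $\Omega$ such that every derivative $f^{(\ell)}$, $\ell=0,1,2,\dots$, extends continuously to $\overline{\Omega}$ (the extension is still denoted $f^{(\ell)}$); it is a Fréchet space with the topology in which $f_m\to f$ iff $f_m^{(\ell)}\to f^{(\ell)}$ uniformly on each compact subset of $\overline{\Omega}$ for every $\ell$. $H(\overline{\Omega})$ is the set of functions holomorphic on some (varying) open set containing $\overline{\Omega}$, and $X^\infty$ is the closure of $H(\overline{\Omega})$ in $A^\infty(\Omega)$, with the induced topology. Padé approximants. Degrees $p,q$ range over $\mathbb{N}=\{0,1,2,\dots\}$. For $f\in A^\infty(\Omega)$ and $\zeta\in\overline{\Omega}$ put $a_v=f^{(v)}(\zeta)/v!$ (for $\zeta\in\partial\Omega$ defined by continuous extension), and consider the formal series $\sum_{v\ge0}a_v(z-\zeta)^v$. A Padé approximant $[p/q]_{f,\zeta}$ is a rational function of the form $P/Q$, $P(z)=\sum_{v=0}^p n_v(z-\zeta)^v$, $Q(z)=\sum_{v=0}^q d_v(z-\zeta)^v$ with $d_0=1$, whose Taylor coefficients $b_v$ at $\zeta$ satisfy $b_v=a_v$ for $v=0,\dots,p+q$. We write $f\in\mathcal{D}_{p,q}(\zeta)$ if the Hankel determinant $\det\big(a_{p-q+i+j-1}\big)_{i,j=1}^q$ is nonzero, with $a_i=0$ for $i<0$ (for $q=0$ the condition is always satisfied). In that case $[p/q]_{f,\zeta}$ exists and is unique. $[p/q]^{(\ell)}_{f,\zeta}$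 denotes its $\ell$-th derivative in $z$. The value of a rational function at a pole is taken to be $\infty$, so a finite supremum over $K$ means that there are no poles in $K$. *)

theory Defs
  imports "HOL-Complex_Analysis.Complex_Analysis" "Jordan_Normal_Form.Determinant"
begin

text \<open>
  The continuous extension of the \<open>l\<close>-th derivative of \<open>f\<close> from \<open>\<Omega>\<close> to its closure. For open \<open>\<Omega>\<close>
  it agrees with the \<open>l\<close>-th derivative on \<open>\<Omega>\<close> itself.
\<close>

definition ext_deriv :: "complex set \<Rightarrow> nat \<Rightarrow> (complex \<Rightarrow> complex) \<Rightarrow> complex \<Rightarrow> complex" where
  "ext_deriv \<Omega> l f z = Lim (at z within \<Omega>) ((deriv ^^ l) f)"

text \<open>
  A function on \<open>\<Omega>\<close> is represented by an extensional total function, so that elements of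
  \<open>A_inf \<Omega>\<close> are equal iff they agree on \<open>\<Omega>\<close>.
\<close>

definition A_inf :: "complex set \<Rightarrow> (complex \<Rightarrow> complex) set" where
  "A_inf \<Omega> = {f \<in> extensional \<Omega>. f holomorphic_on \<Omega> \<and>
     (\<forall>l. \<exists>g. continuous_on (closure \<Omega>) g \<and> (\<forall>z\<in>\<Omega>. g z = (deriv ^^ l) f z))}"

definition A_inf_nhd ::
  "complex set \<Rightarrow> (complex \<Rightarrow> complex) \<Rightarrow> complex set \<Rightarrow> nat \<Rightarrow> real \<Rightarrow> (complex \<Rightarrow> complex) set" where
  "A_inf_nhd \<Omega> f K m e =
     {g \<in> A_inf \<Omega>. \<forall>l\<le>m. \<forall>z\<in>K. dist (ext_deriv \<Omega> l g z) (ext_deriv \<Omega> l f z) < e}"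

definition A_inf_topology :: "complex set \<Rightarrow> (complex \<Rightarrow> complex) topology" where
  "A_inf_topology \<Omega> = topology (\<lambda>U. U \<subseteq> A_inf \<Omega> \<and>
     (\<forall>f\<in>U. \<exists>K m e. compact K \<and> K \<subseteq> closure \<Omega> \<and> 0 < e \<and> A_inf_nhd \<Omega> f K m e \<subseteq> U))"

definition hol_closure :: "complex set \<Rightarrow> (complex \<Rightarrow> complex) set" where
  "hol_closure \<Omega> = {restrict h \<Omega> | h U. open U \<and> closure \<Omega> \<subseteq> U \<and> h holomorphic_on U}"

definition X_inf :: "complex set \<Rightarrow> (complex \<Rightarrow> complex) set" where
  "X_inf \<Omega> = Abstract_Topology.closure_of (A_inf_topology \<Omega>) (hol_closure \<Omega>)"

definition X_inf_topology :: "complex set \<Rightarrow> (complex \<Rightarrow> complex) topology" where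
  "X_inf_topology \<Omega> = subtopology (A_inf_topology \<Omega>) (X_inf \<Omega>)"

definition taylor_coeff :: "complex set \<Rightarrow> (complex \<Rightarrow> complex) \<Rightarrow> complex \<Rightarrow> nat \<Rightarrow> complex" where
  "taylor_coeff \<Omega> f \<zeta> v = ext_deriv \<Omega> v f \<zeta> / fact v"

text \<open>
  Matrix indices start at 0 here, whence \<open>+ 1\<close> in place of \<open>- 1\<close> in the subscript of the Hankel
  determinant. For \<open>q = 0\<close> the determinant is that of the empty matrix, which is 1.
\<close>

definition hankel_det :: "(nat \<Rightarrow> complex) \<Rightarrow> nat \<Rightarrow> nat \<Rightarrow> complex" where
  "hankel_det a p q = Determinant.det (Matrix.mat q q (\<lambda>(i, j).
     let k = int p - int q + int i + int j + 1 in if k < 0 then 0 else a (nat k)))"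

definition pade_D :: "complex set \<Rightarrow> nat \<Rightarrow> nat \<Rightarrow> complex \<Rightarrow> (complex \<Rightarrow> complex) set" where
  "pade_D \<Omega> p q \<zeta> = {f \<in> A_inf \<Omega>. hankel_det (taylor_coeff \<Omega> f \<zeta>) p q \<noteq> 0}"

text \<open>
  A rational function is represented by the total function obtained from \<open>P / Q\<close> by removing all
  removable singularities; its poles (where the total function takes the dummy value 0) are
  recovered by \<open>is_pole\<close>.
\<close>

definition is_pade ::
  "(nat \<Rightarrow> complex) \<Rightarrow> complex \<Rightarrow> nat \<Rightarrow> nat \<Rightarrow> (complex \<Rightarrow> complex) \<Rightarrow> bool" where
  "is_pade a \<zeta> p q R \<longleftrightarrow>
     (\<exists>P Q. degree P \<le> p \<and> degree Q \<le> q \<and> Polynomial.coeff Q 0 = 1 \<and>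
        R = remove_sings (\<lambda>z. poly P (z - \<zeta>) / poly Q (z - \<zeta>)) \<and>
        (\<forall>v\<le>p + q. (deriv ^^ v) R \<zeta> / fact v = a v))"

definition pade :: "complex set \<Rightarrow> (complex \<Rightarrow> complex) \<Rightarrow> complex \<Rightarrow> nat \<Rightarrow> nat \<Rightarrow> complex \<Rightarrow> complex" where
  "pade \<Omega> f \<zeta> p q = (THE R. is_pade (taylor_coeff \<Omega> f \<zeta>) \<zeta> p q R)"

definition pade_error ::
  "complex set \<Rightarrow> (complex \<Rightarrow> complex) \<Rightarrow> complex \<Rightarrow> nat \<Rightarrow> nat \<Rightarrow> nat \<Rightarrow> complex \<Rightarrow> ennreal" where
  "pade_error \<Omega> f \<zeta> p q l z =
     (if is_pole (pade \<Omega> f \<zeta> p q) z then \<infinity>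
      else ennreal (norm ((deriv ^^ l) (pade \<Omega> f \<zeta> p q) z - ext_deriv \<Omega> l f z)))"

definition pade_approximable ::
  "complex set \<Rightarrow> complex \<Rightarrow> (nat \<times> nat) set \<Rightarrow> (complex \<Rightarrow> complex) \<Rightarrow> bool" where
  "pade_approximable \<Omega> \<zeta> F f \<longleftrightarrow>
     (\<exists>p q. (\<forall>n. (p n, q n) \<in> F) \<and>
        (\<forall>K. compact K \<and> K \<subseteq> closure \<Omega> \<longrightarrow>
           (\<forall>n. f \<in> pade_D \<Omega> (p n) (q n) \<zeta>) \<and>
           (\<forall>l. (\<lambda>n. SUP z\<in>K. pade_error \<Omega> f \<zeta> (p n) (q n) l z) \<longlonglongrightarrow> 0)))"

lemma A_inf_nhd_mono:
  assumes "K \<subseteq> K'" "m \<le> m'" "e' \<le> e"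
  shows "A_inf_nhd \<Omega> f K' m' e' \<subseteq> A_inf_nhd \<Omega> f K m e"
proof
  fix g assume g: "g \<in> A_inf_nhd \<Omega> f K' m' e'"
  have "dist (ext_deriv \<Omega> l g z) (ext_deriv \<Omega> l f z) < e" if "l \<le> m" "z \<in> K" for l z
  proof -
    have "dist (ext_deriv \<Omega> l g z) (ext_deriv \<Omega> l f z) < e'"
      using g that assms by (auto simp: A_inf_nhd_def)
    with assms(3) show ?thesis by linarith
  qed
  with g show "g \<in> A_inf_nhd \<Omega> f K m e" by (simp add: A_inf_nhd_def)
qed

lemma openin_A_inf:
  "openin (A_inf_topology \<Omega>) U \<longleftrightarrow> U \<subseteq> A_inf \<Omega> \<and>
     (\<forall>f\<in>U. \<exists>K m e. compact K \<and> K \<subseteq> closure \<Omega> \<and> 0 < e \<and> A_inf_nhd \<Omega> f K m e \<subseteq> U)"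
proof -
  let ?P = "\<lambda>f U K m e. compact K \<and> K \<subseteq> closure \<Omega> \<and> (0::real) < e \<and> A_inf_nhd \<Omega> f K m e \<subseteq> U"
  have "istopology (\<lambda>U. U \<subseteq> A_inf \<Omega> \<and> (\<forall>f\<in>U. \<exists>K m e. ?P f U K m e))"
    unfolding istopology_def
  proof (intro conjI allI impI)
    fix S T
    assume S: "S \<subseteq> A_inf \<Omega> \<and> (\<forall>f\<in>S. \<exists>K m e. ?P f S K m e)"
      and T: "T \<subseteq> A_inf \<Omega> \<and> (\<forall>f\<in>T. \<exists>K m e. ?P f T K m e)"
    show "S \<inter> T \<subseteq> A_inf \<Omega>" using S by blast
    show "\<forall>f\<in>S \<inter> T. \<exists>K m e. ?P f (S \<inter> T) K m e"
    proof
      fix f assume f: "f \<in> S \<inter> T"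
      obtain K m e where 1: "?P f S K m e" using S f by blast
      obtain K' m' e' where 2: "?P f T K' m' e'" using T f by blast
      have "?P f (S \<inter> T) (K \<union> K') (max m m') (min e e')"
        using 1 2 A_inf_nhd_mono[of K "K \<union> K'" m "max m m'" "min e e'" e \<Omega> f]
          A_inf_nhd_mono[of K' "K \<union> K'" m' "max m m'" "min e e'" e' \<Omega> f]
        by (auto simp: compact_Un)
      then show "\<exists>K m e. ?P f (S \<inter> T) K m e" by blast
    qed
  next
    fix \<U>
    assume U: "\<forall>S\<in>\<U>. S \<subseteq> A_inf \<Omega> \<and> (\<forall>f\<in>S. \<exists>K m e. ?P f S K m e)"
    show "\<Union>\<U> \<subseteq> A_inf \<Omega>" using U by blast
    show "\<forall>f\<in>\<Union>\<U>. \<exists>K m e. ?P f (\<Union>\<U>) K m e"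
    proof
      fix f assume "f \<in> \<Union>\<U>"
      then obtain S where S: "S \<in> \<U>" "f \<in> S" by (rule UnionE)
      have "\<exists>K m e. ?P f S K m e" using bspec[OF U S(1)] S(2) by simp
      then obtain K m e where K: "?P f S K m e" by (elim exE)
      have "?P f (\<Union>\<U>) K m e" using K Union_upper[OF S(1)] by (meson order_trans)
      then show "\<exists>K m e. ?P f (\<Union>\<U>) K m e" by blast
    qed
  qed
  then show ?thesis
    by (simp add: A_inf_topology_def)
qed

lemma topspace_A_inf [simp]: "topspace (A_inf_topology \<Omega>) = A_inf \<Omega>"
proof
  show "topspace (A_inf_topology \<Omega>) \<subseteq> A_inf \<Omega>"
    using openin_A_inf openin_topspace by blast
  have "A_inf_nhd \<Omega> f {} 0 1 \<subseteq> A_inf \<Omega>" for f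
    by (auto simp: A_inf_nhd_def)
  then have "openin (A_inf_topology \<Omega>) (A_inf \<Omega>)"
    unfolding openin_A_inf by (intro conjI ballI exI[of _ "{}"] exI[of _ 0] exI[of _ 1]) auto
  then show "A_inf \<Omega> \<subseteq> topspace (A_inf_topology \<Omega>)"
    by (rule openin_subset)
qed

lemma topspace_X_inf [simp]: "topspace (X_inf_topology \<Omega>) = X_inf \<Omega>"
  using closure_of_subset_topspace[of "A_inf_topology \<Omega>" "hol_closure \<Omega>"]
  by (auto simp: X_inf_topology_def X_inf_def)

lemma ext_deriv_eqI:
  assumes "open \<Omega>" "z \<in> closure \<Omega>" "continuous_on (closure \<Omega>) g"
    and "\<And>z. z \<in> \<Omega> \<Longrightarrow> g z = (deriv ^^ l) f z"
  shows "ext_deriv \<Omega> l f z = g z"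
proof -
  have "z islimpt \<Omega>"
    using assms(1,2) interior_limit_point[of z \<Omega>] by (auto simp: closure_def interior_open)
  then have nt: "at z within \<Omega> \<noteq> bot"
    by (simp add: trivial_limit_within)
  have "(g \<longlongrightarrow> g z) (at z within \<Omega>)"
    using assms(2,3) closure_subset by (auto simp: continuous_on_def intro: tendsto_within_subset)
  then have "((deriv ^^ l) f \<longlongrightarrow> g z) (at z within \<Omega>)"
    by (rule Lim_transform_eventually) (auto simp: eventually_at_filter assms(4))
  then show ?thesis
    unfolding ext_deriv_def using nt by (rule tendsto_Lim[rotated])
qed

lemma ext_deriv_eq:
  assumes "open \<Omega>" "f \<in> A_inf \<Omega>" "z \<in> \<Omega>"
  shows "ext_deriv \<Omega> l f z = (deriv ^^ l) f z"
proof -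
  obtain g where g: "continuous_on (closure \<Omega>) g" "\<And>z. z \<in> \<Omega> \<Longrightarrow> g z = (deriv ^^ l) f z"
    using assms(2) unfolding A_inf_def by blast
  show ?thesis
    using ext_deriv_eqI[OF assms(1) _ g, of z] g(2) assms(3) closure_subset by fastforce
qed

lemma continuous_on_ext_deriv:
  assumes "open \<Omega>" "f \<in> A_inf \<Omega>"
  shows "continuous_on (closure \<Omega>) (ext_deriv \<Omega> l f)"
proof -
  obtain g where g: "continuous_on (closure \<Omega>) g" "\<And>z. z \<in> \<Omega> \<Longrightarrow> g z = (deriv ^^ l) f z"
    using assms(2) unfolding A_inf_def by blast
  have "ext_deriv \<Omega> l f z = g z" if "z \<in> closure \<Omega>" for z
    by (rule ext_deriv_eqI[OF assms(1) that g])
  with g(1) show ?thesis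
    by (simp cong: continuous_on_cong)
qed

lemma openin_A_inf_nhd:
  assumes "open \<Omega>" "f \<in> A_inf \<Omega>" "compact K" "K \<subseteq> closure \<Omega>" "0 < e"
  shows "openin (A_inf_topology \<Omega>) (A_inf_nhd \<Omega> f K m e)"
  unfolding openin_A_inf
proof (intro conjI ballI)
  show "A_inf_nhd \<Omega> f K m e \<subseteq> A_inf \<Omega>" by (auto simp: A_inf_nhd_def)
  fix g assume g: "g \<in> A_inf_nhd \<Omega> f K m e"
  then have gA: "g \<in> A_inf \<Omega>" by (simp add: A_inf_nhd_def)
  let ?d = "\<lambda>l z. dist (ext_deriv \<Omega> l g z) (ext_deriv \<Omega> l f z)"
  have "\<exists>c<e. \<forall>z\<in>K. ?d l z \<le> c" if "l \<le> m" for l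
  proof (cases "K = {}")
    case False
    have "continuous_on K (?d l)"
      using continuous_on_ext_deriv[OF assms(1)] assms(2,4) gA
      by (intro continuous_on_dist) (auto intro: continuous_on_subset)
    then obtain w where "w \<in> K" "\<forall>z\<in>K. ?d l z \<le> ?d l w"
      using continuous_attains_sup[OF assms(3) False] by blast
    then show ?thesis
      using g that unfolding A_inf_nhd_def by blast
  qed (auto intro: exI[of _ "e - 1"])
  then obtain c where c: "\<And>l. l \<le> m \<Longrightarrow> c l < e"
      "\<And>l z. l \<le> m \<Longrightarrow> z \<in> K \<Longrightarrow> ?d l z \<le> c l"
    by metis
  define C where "C = Max (c ` {..m})"
  have C: "C < e" "\<And>l. l \<le> m \<Longrightarrow> c l \<le> C"
    using c(1) by (auto simp: C_def)
  have "A_inf_nhd \<Omega> g K m (e - C) \<subseteq> A_inf_nhd \<Omega> f K m e"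
  proof
    fix h assume h: "h \<in> A_inf_nhd \<Omega> g K m (e - C)"
    have "dist (ext_deriv \<Omega> l h z) (ext_deriv \<Omega> l f z) < e" if "l \<le> m" "z \<in> K" for l z
    proof -
      have "dist (ext_deriv \<Omega> l h z) (ext_deriv \<Omega> l g z) < e - C"
        using h that by (auto simp: A_inf_nhd_def)
      moreover have "?d l z \<le> C"
        using c(2) C(2) that by fastforce
      ultimately show ?thesis
        using dist_triangle[of "ext_deriv \<Omega> l h z" "ext_deriv \<Omega> l f z" "ext_deriv \<Omega> l g z"]
        by linarith
    qed
    then show "h \<in> A_inf_nhd \<Omega> f K m e"
      using h by (auto simp: A_inf_nhd_def)
  qed
  then show "\<exists>K' m' e'. compact K' \<and> K' \<subseteq> closure \<Omega> \<and> 0 < e' \<and>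
      A_inf_nhd \<Omega> g K' m' e' \<subseteq> A_inf_nhd \<Omega> f K m e"
    using assms(3,4) C(1) by (metis diff_gt_0_iff_gt)
qed

text \<open>
  Sanity check: \<open>A_inf_topology\<close> has the intended convergent sequences.
\<close>

lemma limitin_A_inf:
  assumes "open \<Omega>" "f \<in> A_inf \<Omega>" "\<And>n. g n \<in> A_inf \<Omega>"
  shows "limitin (A_inf_topology \<Omega>) g f sequentially \<longleftrightarrow>
    (\<forall>l K. compact K \<and> K \<subseteq> closure \<Omega> \<longrightarrow>
       uniform_limit K (\<lambda>n. ext_deriv \<Omega> l (g n)) (ext_deriv \<Omega> l f) sequentially)"
    (is "?L \<longleftrightarrow> ?R")
proof
  assume L: ?L
  show ?R
  proof (intro allI impI uniform_limitI)
    fix l K and e :: real assume K: "compact K \<and> K \<subseteq> closure \<Omega>" and e: "0 < e"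
    have "openin (A_inf_topology \<Omega>) (A_inf_nhd \<Omega> f K l e)"
      using openin_A_inf_nhd assms(1,2) K e by blast
    moreover have "f \<in> A_inf_nhd \<Omega> f K l e"
      using assms(2) e by (simp add: A_inf_nhd_def)
    ultimately have "eventually (\<lambda>n. g n \<in> A_inf_nhd \<Omega> f K l e) sequentially"
      using L by (simp add: limitin_def)
    then show "eventually (\<lambda>n. \<forall>z\<in>K. dist (ext_deriv \<Omega> l (g n) z) (ext_deriv \<Omega> l f z) < e) sequentially"
      by eventually_elim (auto simp: A_inf_nhd_def)
  qed
next
  assume R: ?R
  show ?L
    unfolding limitin_def
  proof (intro conjI allI impI)
    show "f \<in> topspace (A_inf_topology \<Omega>)" using assms(2) by simp
    fix U assume "openin (A_inf_topology \<Omega>) U \<and> f \<in> U"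
    then obtain K m e where K: "compact K" "K \<subseteq> closure \<Omega>" "0 < e" "A_inf_nhd \<Omega> f K m e \<subseteq> U"
      unfolding openin_A_inf by blast
    have "eventually (\<lambda>n. \<forall>z\<in>K. dist (ext_deriv \<Omega> l (g n) z) (ext_deriv \<Omega> l f z) < e) sequentially" for l
      using R K(1-3) by (intro uniform_limitD) auto
    then have "eventually (\<lambda>n. \<forall>l\<in>{..m}. \<forall>z\<in>K.
        dist (ext_deriv \<Omega> l (g n) z) (ext_deriv \<Omega> l f z) < e) sequentially"
      by (intro eventually_ball_finite) auto
    then show "eventually (\<lambda>n. g n \<in> U) sequentially"
      by eventually_elim (use K(4) assms(3) in \<open>auto simp: A_inf_nhd_def subset_iff\<close>)
  qed
qed

lemma hol_closure_subset_A_inf: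
  assumes "open \<Omega>"
  shows "hol_closure \<Omega> \<subseteq> A_inf \<Omega>"
proof
  fix f assume "f \<in> hol_closure \<Omega>"
  then obtain h U where h: "f = restrict h \<Omega>" "open U" "closure \<Omega> \<subseteq> U" "h holomorphic_on U"
    unfolding hol_closure_def by blast
  have sub: "\<Omega> \<subseteq> U" using h(3) closure_subset by blast
  have "f holomorphic_on \<Omega>"
    using holomorphic_on_subset[OF h(4) sub] by (simp add: h(1) cong: holomorphic_cong)
  moreover have "continuous_on (closure \<Omega>) ((deriv ^^ l) h)" for l
    using holomorphic_higher_deriv[OF h(4,2)] h(3)
    by (meson holomorphic_on_imp_continuous_on continuous_on_subset)
  moreover have "(deriv ^^ l) h z = (deriv ^^ l) f z" if "z \<in> \<Omega>" for l z
  proof (rule higher_deriv_cong_ev)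
    show "eventually (\<lambda>w. h w = f w) (nhds z)"
      using eventually_nhds_in_open[OF assms that] by eventually_elim (simp add: h(1))
  qed simp
  ultimately show "f \<in> A_inf \<Omega>"
    unfolding A_inf_def by (auto simp: h(1))
qed

end

theory Submission
  imports Defs "HOL-Computational_Algebra.Fundamental_Theorem_Algebra"
begin

text \<open>
  The set in question is the intersection over \<open>k\<close> of the sets of those \<open>f\<close> for which some
  \<open>(p, q) \<in> F\<close> gives a nonzero Hankel determinant and an error below \<open>1 / (k + 1)\<close> for the derivatives up
  to order \<open>k\<close> on \<open>closure \<Omega> \<inter> cball 0 k\<close>. Each of these sets is open, because the coefficients of
  the Pade approximant depend continuously on finitely many Taylor coefficients at \<open>\<zeta>\<close> and because
  numerator and denominator have no common zero when the Hankel determinant does not vanish. Each of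
  them is dense: by a version of Runge's theorem, a function holomorphic near \<open>closure \<Omega>\<close> is
  approximated by a rational function \<open>A / B\<close> without poles on \<open>closure \<Omega>\<close>; adding
  \<open>\<eta> (z - \<zeta>)\<^sup>p / B\<close> with a small generic \<open>\<eta>\<close>, for \<open>(p, q) \<in> F\<close> with \<open>p > degree A\<close> and \<open>q \<ge> degree B\<close>, gives a
  function with nonzero Hankel determinant that coincides with its own Pade approximant. Baire's
  argument in the complete space \<open>X_inf \<Omega>\<close> does the rest.
\<close>

section \<open>Hankel systems and Pade forms\<close>

text \<open>The generic perturbation is there because Hankel determinants of rational functions
  vanish easily: for \<open>A / B\<close> with degrees below \<open>p\<close> and below
  \<open>q\<close>, the pair \<open>z A\<close>, \<open>z B\<close> (in the variable centred at
  \<zeta>) solves the same Pade equations with a denominator vanishing at the centre. Raising the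
  numerator to degree exactly \<open>p\<close> excludes such multiples, even when \<open>B\<close>
  has degree below \<open>q\<close>. Neither degree of a Runge approximant is under control, so
  \<open>p\<close> and \<open>q\<close> have to become large simultaneously along \<open>F\<close>.
  Common zeros matter for openness: a cancelled pole could split under an arbitrarily small change
  of the function into a pole and a nearby zero, and the error would jump to \<infinity>. A third
  obstacle is that \<open>closure \<Omega>\<close> may be unbounded. Approximation is demanded on
  compact parts only, but the approximants must belong to \<open>hol_closure \<Omega>\<close> and
  hence be free of poles on all of \<open>closure \<Omega>\<close>.\<close>

definition pade_form :: "(nat \<Rightarrow> complex) \<Rightarrow> nat \<Rightarrow> nat \<Rightarrow> complex poly \<Rightarrow> complex poly \<Rightarrow> bool" where
  "pade_form a p q P Q \<longleftrightarrow> degree P \<le> p \<and> degree Q \<le> q \<and>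
     (\<forall>v\<le>p + q. poly.coeff P v = (\<Sum>i\<le>v. poly.coeff Q i * a (v - i)))"

text \<open>The integer subscript of \<open>hankel_det\<close> in natural numbers. The guard catches
  negative subscripts, for which truncated subtraction would yield \<open>a 0\<close> instead of
  0.\<close>

definition hankel_entry :: "(nat \<Rightarrow> complex) \<Rightarrow> nat \<Rightarrow> nat \<Rightarrow> nat \<Rightarrow> nat \<Rightarrow> complex" where
  "hankel_entry a p q i j = (if p + i + j + 1 < q then 0 else a (p + i + j + 1 - q))"

abbreviation hankel_mat :: "(nat \<Rightarrow> complex) \<Rightarrow> nat \<Rightarrow> nat \<Rightarrow> complex mat" where
  "hankel_mat a p q \<equiv> Matrix.mat q q (\<lambda>(i, j). hankel_entry a p q i j)"

lemma hankel_det_eq: "hankel_det a p q = Determinant.det (hankel_mat a p q)"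
proof -
  have "(let k = int p - int q + int i + int j + 1 in if k < 0 then 0 else a (nat k))
      = hankel_entry a p q i j" for i j
  proof (cases "p + i + j + 1 < q")
    case True
    then have "int p - int q + int i + int j + 1 < 0" by linarith
    then show ?thesis using True by (simp add: hankel_entry_def Let_def)
  next
    case False
    then have "nat (int p - int q + int i + int j + 1) = p + i + j + 1 - q"
      and "\<not> int p - int q + int i + int j + 1 < 0" by linarith+
    then show ?thesis using False by (simp only: hankel_entry_def Let_def if_False)
  qed
  then show ?thesis by (simp add: hankel_det_def)
qed

text \<open>Cramer's rule: as adjugate over determinant, the entries of the inverse are visibly
  continuous in \<open>a\<close> wherever the determinant does not vanish.\<close>

definition hankel_inv :: "(nat \<Rightarrow> complex) \<Rightarrow> nat \<Rightarrow> nat \<Rightarrow> nat \<Rightarrow> nat \<Rightarrow> complex" where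
  "hankel_inv a p q i j = adj_mat (hankel_mat a p q) $$ (i, j) / hankel_det a p q"

lemma hankel_inv:
  assumes "hankel_det a p q \<noteq> 0" "i < q" "j < q"
  shows "(\<Sum>k<q. hankel_entry a p q i k * hankel_inv a p q k j) = (if i = j then 1 else 0)"
    and "(\<Sum>k<q. hankel_inv a p q i k * hankel_entry a p q k j) = (if i = j then 1 else 0)"
proof -
  let ?H = "hankel_mat a p q"
  note adj = adj_mat[of ?H q, simplified]
  have "(?H * adj_mat ?H) $$ (i, j) = (\<Sum>k<q. hankel_entry a p q i k * adj_mat ?H $$ (k, j))"
    using assms(2,3) adj(1) by (auto simp: scalar_prod_def atLeast0LessThan)
  moreover have "(?H * adj_mat ?H) $$ (i, j) = (if i = j then hankel_det a p q else 0)"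
    unfolding adj(2) using assms(2,3) by (simp add: hankel_det_eq)
  ultimately show "(\<Sum>k<q. hankel_entry a p q i k * hankel_inv a p q k j) = (if i = j then 1 else 0)"
    using assms(1) by (cases "i = j") (auto simp: hankel_inv_def simp flip: sum_divide_distrib)
  have "(adj_mat ?H * ?H) $$ (i, j) = (\<Sum>k<q. adj_mat ?H $$ (i, k) * hankel_entry a p q k j)"
    using assms(2,3) adj(1) by (auto simp: scalar_prod_def atLeast0LessThan)
  moreover have "(adj_mat ?H * ?H) $$ (i, j) = (if i = j then hankel_det a p q else 0)"
    unfolding adj(3) using assms(2,3) by (simp add: hankel_det_eq)
  ultimately show "(\<Sum>k<q. hankel_inv a p q i k * hankel_entry a p q k j) = (if i = j then 1 else 0)"
    using assms(1) by (cases "i = j") (auto simp: hankel_inv_def simp flip: sum_divide_distrib)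
qed

text \<open>Multiplication by the left inverse gives uniqueness, the right inverse gives
  existence.\<close>

lemma hankel_system_iff:
  assumes "hankel_det a p q \<noteq> 0"
  shows "(\<forall>r<q. (\<Sum>c<q. hankel_entry a p q r c * d c) = b r) \<longleftrightarrow>
    (\<forall>c<q. d c = (\<Sum>r<q. hankel_inv a p q c r * b r))"
proof (intro iffI allI impI)
  fix c assume b: "\<forall>r<q. (\<Sum>c<q. hankel_entry a p q r c * d c) = b r" and c: "c < q"
  have "(\<Sum>r<q. hankel_inv a p q c r * b r) =
      (\<Sum>r<q. \<Sum>k<q. hankel_inv a p q c r * hankel_entry a p q r k * d k)"
  proof (rule sum.cong[OF refl])
    fix r assume "r \<in> {..<q}"
    then have "b r = (\<Sum>k<q. hankel_entry a p q r k * d k)" using b by simp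
    then show "hankel_inv a p q c r * b r = (\<Sum>k<q. hankel_inv a p q c r * hankel_entry a p q r k * d k)"
      by (simp add: sum_distrib_left mult.assoc)
  qed
  also have "\<dots> = (\<Sum>k<q. (\<Sum>r<q. hankel_inv a p q c r * hankel_entry a p q r k) * d k)"
    by (subst sum.swap) (simp add: sum_distrib_right)
  also have "\<dots> = (\<Sum>k<q. (if c = k then 1 else 0) * d k)"
    using hankel_inv(2)[OF assms c] by (intro sum.cong) auto
  also have "\<dots> = (\<Sum>k<q. if c = k then d k else 0)"
    by (intro sum.cong) auto
  finally show "d c = (\<Sum>r<q. hankel_inv a p q c r * b r)"
    using c by simp
next
  fix r assume d: "\<forall>c<q. d c = (\<Sum>r<q. hankel_inv a p q c r * b r)" and r: "r < q"
  have "(\<Sum>c<q. hankel_entry a p q r c * d c) =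
      (\<Sum>c<q. \<Sum>k<q. hankel_entry a p q r c * hankel_inv a p q c k * b k)"
  proof (rule sum.cong[OF refl])
    fix c assume "c \<in> {..<q}"
    then have "d c = (\<Sum>k<q. hankel_inv a p q c k * b k)" using d by simp
    then show "hankel_entry a p q r c * d c = (\<Sum>k<q. hankel_entry a p q r c * hankel_inv a p q c k * b k)"
      by (simp add: sum_distrib_left mult.assoc)
  qed
  also have "\<dots> = (\<Sum>k<q. (\<Sum>c<q. hankel_entry a p q r c * hankel_inv a p q c k) * b k)"
    by (subst sum.swap) (simp add: sum_distrib_right)
  also have "\<dots> = (\<Sum>k<q. (if r = k then 1 else 0) * b k)"
    using hankel_inv(1)[OF assms r] by (intro sum.cong) auto
  also have "\<dots> = (\<Sum>k<q. if r = k then b k else 0)"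
    by (intro sum.cong) auto
  finally show "(\<Sum>c<q. hankel_entry a p q r c * d c) = b r"
    using r by simp
qed

lemma hankel_singular:
  assumes "hankel_det a p q = 0"
  obtains c d where "c < q" "d c \<noteq> 0" "\<forall>r<q. (\<Sum>c<q. hankel_entry a p q r c * d c) = 0"
proof -
  let ?H = "hankel_mat a p q"
  obtain v where v: "v \<in> carrier_vec q" "v \<noteq> 0\<^sub>v q" "?H *\<^sub>v v = 0\<^sub>v q"
    using det_0_iff_vec_prod_zero[of ?H q] assms by (auto simp: hankel_det_eq)
  obtain c where "c < q" "vec_index v c \<noteq> 0"
    using v(1,2) by (metis carrier_vecD eq_vecI index_zero_vec)
  moreover have "(\<Sum>c<q. hankel_entry a p q r c * vec_index v c) = 0" if "r < q" for r
  proof -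
    have "(\<Sum>c<q. hankel_entry a p q r c * vec_index v c) = vec_index (?H *\<^sub>v v) r"
      using that v(1) by (auto simp: scalar_prod_def atLeast0LessThan)
    then show ?thesis using v(3) that by simp
  qed
  ultimately show ?thesis using that by blast
qed

text \<open>The equations of order at most \<open>p\<close> merely define \<open>P\<close>. Those of
  order \<open>p + 1 + r\<close> with \<open>r < q\<close> have left side 0 by the degree bound on
  \<open>P\<close> and involve only \<open>Q\<close>. Column \<open>c\<close> belongs to the
  coefficient of index \<open>q - c\<close>; this reversal turns the convolution into a Hankel
  matrix.\<close>

lemma pade_form_iff:
  "pade_form a p q P Q \<longleftrightarrow> degree P \<le> p \<and> degree Q \<le> q \<and>
     (\<forall>v\<le>p. poly.coeff P v = (\<Sum>i\<le>v. poly.coeff Q i * a (v - i))) \<and>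
     (\<forall>r<q. (\<Sum>c<q. hankel_entry a p q r c * poly.coeff Q (q - c)) = - poly.coeff Q 0 * a (p + 1 + r))"
proof -
  have *: "(\<Sum>i\<le>p + 1 + r. poly.coeff Q i * a (p + 1 + r - i)) = poly.coeff Q 0 * a (p + 1 + r) +
      (\<Sum>c<q. hankel_entry a p q r c * poly.coeff Q (q - c))" if "degree Q \<le> q" for r
  proof -
    let ?v = "p + 1 + r"
    let ?g = "\<lambda>i. if i \<le> ?v then poly.coeff Q i * a (?v - i) else 0"
    \<comment> \<open>Either of \<open>?v\<close> and \<open>q\<close> may be the larger one, so
      both ranges are compared within \<open>{..max ?v q}\<close>: \<open>?g\<close> is 0 beyond
      \<open>?v\<close> by definition and beyond \<open>q\<close> by the degree of
      \<open>Q\<close>.\<close>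
    have "(\<Sum>i\<le>?v. poly.coeff Q i * a (?v - i)) = (\<Sum>i\<in>{..max ?v q}. ?g i)"
      by (rule sum.mono_neutral_cong_left) auto
    also have "\<dots> = (\<Sum>i\<in>{..q}. ?g i)"
      by (rule sum.mono_neutral_right) (use that in \<open>auto simp: coeff_eq_0\<close>)
    also have "{..q} = insert 0 {1..q}" by auto
    also have "(\<Sum>i\<in>insert 0 {1..q}. ?g i) = poly.coeff Q 0 * a ?v + (\<Sum>i\<in>{1..q}. ?g i)"
      by simp
    also have "(\<Sum>i\<in>{1..q}. ?g i) = (\<Sum>c<q. ?g (q - c))"
      by (rule sum.reindex_bij_witness[of _ "\<lambda>c. q - c" "\<lambda>c. q - c"]) auto
    also have "\<dots> = (\<Sum>c<q. hankel_entry a p q r c * poly.coeff Q (q - c))"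
    proof (rule sum.cong[OF refl])
      fix c assume "c \<in> {..<q}"
      then have c: "c < q" by simp
      show "?g (q - c) = hankel_entry a p q r c * poly.coeff Q (q - c)"
      proof (cases "p + r + c + 1 < q")
        case True
        with c have "\<not> q - c \<le> p + 1 + r" by arith
        with True show ?thesis by (simp only: hankel_entry_def if_True if_False mult_zero_left)
      next
        case False
        with c have le: "q - c \<le> p + 1 + r" by arith
        with c have "p + r + c + 1 - q = p + 1 + r - (q - c)" by arith
        with le False show ?thesis by (simp only: hankel_entry_def if_True if_False mult.commute)
      qed
    qed
    finally show ?thesis .
  qed
  have split: "(\<forall>v\<le>p + q. R v) \<longleftrightarrow> (\<forall>v\<le>p. R v) \<and> (\<forall>r<q. R (p + 1 + r))" for R
  proof (intro iffI conjI allI impI)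
    fix v assume R: "(\<forall>v\<le>p. R v) \<and> (\<forall>r<q. R (p + 1 + r))" and "v \<le> p + q"
    then show "R v"
      by (cases "v \<le> p") (use R spec[OF conjunct2[OF R], of "v - p - 1"] in auto)
  qed auto
  have "poly.coeff P (p + 1 + r) = 0" if "degree P \<le> p" for r
    using that by (simp add: coeff_eq_0)
  then show ?thesis
    unfolding pade_form_def split using *
    by (auto simp: eq_neg_iff_add_eq_0 add.commute)
qed

lemma degree_Poly_map_upt: "degree (Poly (map f [0..<Suc n])) \<le> n"
  by (rule degree_le) (simp add: nth_default_def)

definition pade_den :: "(nat \<Rightarrow> complex) \<Rightarrow> nat \<Rightarrow> nat \<Rightarrow> complex poly" where
  "pade_den a p q = Poly (map (\<lambda>i. if i = 0 then 1
     else \<Sum>r<q. hankel_inv a p q (q - i) r * - a (p + 1 + r)) [0..<Suc q])"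

definition pade_num :: "(nat \<Rightarrow> complex) \<Rightarrow> nat \<Rightarrow> nat \<Rightarrow> complex poly" where
  "pade_num a p q = Poly (map (\<lambda>v. \<Sum>i\<le>v. poly.coeff (pade_den a p q) i * a (v - i)) [0..<Suc p])"

lemma coeff_pade_den_0 [simp]: "poly.coeff (pade_den a p q) 0 = 1"
  by (simp add: pade_den_def nth_default_def del: upt_Suc)

lemma degree_pade_den: "degree (pade_den a p q) \<le> q"
  unfolding pade_den_def by (rule degree_Poly_map_upt)

lemma degree_pade_num: "degree (pade_num a p q) \<le> p"
  unfolding pade_num_def by (rule degree_Poly_map_upt)

text \<open>With constant coefficient 1 the equations for the denominator become a regular Hankel
  system with right-hand side \<open>- a (p + 1 + r)\<close>, which determines the other
  coefficients; the numerator is then read off from the equations of order at most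
  \<open>p\<close>.\<close>

lemma pade_form_eq_iff:
  assumes "hankel_det a p q \<noteq> 0" "poly.coeff Q 0 = 1"
  shows "pade_form a p q P Q \<longleftrightarrow> P = pade_num a p q \<and> Q = pade_den a p q"
proof -
  have den: "Q = pade_den a p q \<longleftrightarrow> degree Q \<le> q \<and>
    (\<forall>r<q. (\<Sum>c<q. hankel_entry a p q r c * poly.coeff Q (q - c)) = - a (p + 1 + r))" if "poly.coeff Q 0 = 1" for Q
  proof -
    have "Q = pade_den a p q \<longleftrightarrow> degree Q \<le> q \<and> (\<forall>i\<le>q. poly.coeff Q i = poly.coeff (pade_den a p q) i)"
      using degree_pade_den[of a p q]
      by (auto intro!: poly_eqI) (metis coeff_eq_0 le_degree le_trans not_le)
    also have "\<dots> \<longleftrightarrow> degree Q \<le> q \<and>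
        (\<forall>c<q. poly.coeff Q (q - c) = (\<Sum>r<q. hankel_inv a p q c r * - a (p + 1 + r)))"
    proof (intro conj_cong refl iffI allI impI)
      fix c assume "\<forall>i\<le>q. poly.coeff Q i = poly.coeff (pade_den a p q) i" "c < q"
      then show "poly.coeff Q (q - c) = (\<Sum>r<q. hankel_inv a p q c r * - a (p + 1 + r))"
        by (simp add: pade_den_def nth_default_def del: upt_Suc)
    next
      fix i assume *: "\<forall>c<q. poly.coeff Q (q - c) = (\<Sum>r<q. hankel_inv a p q c r * - a (p + 1 + r))"
        and "i \<le> q"
      then show "poly.coeff Q i = poly.coeff (pade_den a p q) i"
        using spec[OF *, of "q - i"] that
        by (cases "i = 0") (auto simp: pade_den_def nth_default_def simp del: upt_Suc)
    qed
    also have "\<dots> \<longleftrightarrow> degree Q \<le> q \<and>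
      (\<forall>r<q. (\<Sum>c<q. hankel_entry a p q r c * poly.coeff Q (q - c)) = - a (p + 1 + r))"
      by (subst hankel_system_iff[OF assms(1)]) (rule refl)
    finally show ?thesis .
  qed
  have num: "P = pade_num a p q \<longleftrightarrow> degree P \<le> p \<and>
      (\<forall>v\<le>p. poly.coeff P v = (\<Sum>i\<le>v. poly.coeff (pade_den a p q) i * a (v - i)))" for P
  proof
    assume "P = pade_num a p q"
    then show "degree P \<le> p \<and>
      (\<forall>v\<le>p. poly.coeff P v = (\<Sum>i\<le>v. poly.coeff (pade_den a p q) i * a (v - i)))"
      using degree_pade_num by (auto simp: pade_num_def nth_default_def simp del: upt_Suc)
  next
    assume P: "degree P \<le> p \<and>
      (\<forall>v\<le>p. poly.coeff P v = (\<Sum>i\<le>v. poly.coeff (pade_den a p q) i * a (v - i)))"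
    show "P = pade_num a p q"
    proof (rule poly_eqI)
      fix v show "poly.coeff P v = poly.coeff (pade_num a p q) v"
        by (cases "v \<le> p")
          (use P in \<open>auto simp: pade_num_def nth_default_def coeff_eq_0 simp del: upt_Suc\<close>)
    qed
  qed
  show ?thesis
    unfolding pade_form_iff using den[OF assms(2)] num assms(2) by auto
qed

text \<open>A kernel vector of the Hankel matrix, padded with constant coefficient 0, solves the
  homogeneous equations. This is the solution that \<open>hankel_det_rational\<close>
  refutes.\<close>

lemma pade_form_singular:
  assumes "hankel_det a p q = 0"
  obtains N D where "pade_form a p q N D" "D \<noteq> 0" "poly.coeff D 0 = 0"
proof -
  obtain c d where d: "c < q" "d c \<noteq> 0" "\<forall>r<q. (\<Sum>c<q. hankel_entry a p q r c * d c) = 0"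
    by (rule hankel_singular[OF assms])
  define D where "D = Poly (map (\<lambda>i. if i = 0 then 0 else d (q - i)) [0..<Suc q])"
  define N where "N = Poly (map (\<lambda>v. \<Sum>i\<le>v. poly.coeff D i * a (v - i)) [0..<Suc p])"
  have D: "poly.coeff D i = (if i = 0 \<or> i > q then 0 else d (q - i))" for i
    by (auto simp: D_def nth_default_def simp del: upt_Suc)
  have "poly.coeff D (q - c) = d c" using d(1) by (simp add: D)
  then have "D \<noteq> 0" using d(2) by auto
  moreover have "poly.coeff D 0 = 0" by (simp add: D)
  moreover have "pade_form a p q N D"
    unfolding pade_form_iff
  proof (intro conjI allI impI)
    show "degree N \<le> p" "degree D \<le> q" unfolding N_def D_def by (rule degree_Poly_map_upt)+
    show "poly.coeff N v = (\<Sum>i\<le>v. poly.coeff D i * a (v - i))" if "v \<le> p" for v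
      using that by (simp add: N_def nth_default_def del: upt_Suc)
    show "(\<Sum>c<q. hankel_entry a p q r c * poly.coeff D (q - c)) = - poly.coeff D 0 * a (p + 1 + r)"
      if "r < q" for r
      proof -
      have "(\<Sum>c<q. hankel_entry a p q r c * poly.coeff D (q - c)) = (\<Sum>c<q. hankel_entry a p q r c * d c)"
        by (intro sum.cong) (auto simp: D)
      then show ?thesis using d(3) that by (simp add: D)
    qed
  qed
  ultimately show ?thesis using that by blast
qed

section \<open>Continuity of Pade forms and of derivatives\<close>

lemma tendsto_det:
  fixes f :: "'a \<Rightarrow> nat \<Rightarrow> nat \<Rightarrow> 'b :: real_normed_field"
  assumes "\<And>i j. i < q \<Longrightarrow> j < q \<Longrightarrow> ((\<lambda>n. f n i j) \<longlongrightarrow> g i j) F"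
  shows "((\<lambda>n. Determinant.det (Matrix.mat q q (\<lambda>(i, j). f n i j))) \<longlongrightarrow>
    Determinant.det (Matrix.mat q q (\<lambda>(i, j). g i j))) F"
proof -
  have *: "Determinant.det (Matrix.mat q q (\<lambda>(i, j). h i j)) =
      (\<Sum>\<pi> | \<pi> permutes {0..<q}. signof \<pi> * (\<Prod>i = 0..<q. h i (\<pi> i)))" for h :: "nat \<Rightarrow> nat \<Rightarrow> 'b"
    by (subst det_def', rule mat_carrier, intro sum.cong refl arg_cong2[where f = "(*)"] prod.cong)
      (auto simp: permutes_in_image)
  show ?thesis
    unfolding * by (intro tendsto_intros assms) (auto simp: permutes_in_image)
qed

lemma tendsto_hankel_entry:
  assumes "\<And>v. ((\<lambda>n. A n v) \<longlongrightarrow> a v) F"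
  shows "((\<lambda>n. hankel_entry (A n) p q i j) \<longlongrightarrow> hankel_entry a p q i j) F"
  using assms by (simp add: hankel_entry_def)

lemma tendsto_hankel_det:
  assumes "\<And>v. ((\<lambda>n. A n v) \<longlongrightarrow> a v) F"
  shows "((\<lambda>n. hankel_det (A n) p q) \<longlongrightarrow> hankel_det a p q) F"
  unfolding hankel_det_eq by (intro tendsto_det tendsto_hankel_entry assms)

lemma tendsto_hankel_inv:
  assumes "\<And>v. ((\<lambda>n. A n v) \<longlongrightarrow> a v) F" "hankel_det a p q \<noteq> 0" "i < q" "j < q"
  shows "((\<lambda>n. hankel_inv (A n) p q i j) \<longlongrightarrow> hankel_inv a p q i j) F"
proof -
  \<comment> \<open>\<open>?s k\<close> enumerates the indices other than \<open>k\<close>; it gives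
    the minors entrywise, the form that \<open>tendsto_det\<close> needs.\<close>
  let ?s = "\<lambda>k l. if l < k then l else Suc l"
  have *: "adj_mat (hankel_mat b p q) $$ (i, j) = (- 1) ^ (j + i) *
      Determinant.det (Matrix.mat (q - 1) (q - 1) (\<lambda>(k, l). hankel_entry b p q (?s j k) (?s i l)))" for b
  proof -
    have "mat_delete (hankel_mat b p q) j i =
        Matrix.mat (q - 1) (q - 1) (\<lambda>(k, l). hankel_entry b p q (?s j k) (?s i l))"
      by (rule eq_matI) (auto simp: mat_delete_def)
    then show ?thesis using assms(3,4) by (simp add: adj_mat_def cofactor_def)
  qed
  show ?thesis
    unfolding hankel_inv_def *
    by (intro tendsto_intros tendsto_det tendsto_hankel_entry tendsto_hankel_det assms)
qed

lemma tendsto_pade_den: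
  assumes "\<And>v. ((\<lambda>n. A n v) \<longlongrightarrow> a v) F" "hankel_det a p q \<noteq> 0"
  shows "((\<lambda>n. poly.coeff (pade_den (A n) p q) i) \<longlongrightarrow> poly.coeff (pade_den a p q) i) F"
proof (cases "i = 0 \<or> i > q")
  case False
  then have "poly.coeff (pade_den b p q) i = (\<Sum>r<q. hankel_inv b p q (q - i) r * - b (p + 1 + r))" for b
    by (simp add: pade_den_def nth_default_def del: upt_Suc)
  then show ?thesis
    by (simp only:) (use False in \<open>intro tendsto_intros tendsto_hankel_inv assms; simp\<close>)
qed (auto simp: pade_den_def nth_default_def simp del: upt_Suc)

lemma tendsto_pade_num:
  assumes "\<And>v. ((\<lambda>n. A n v) \<longlongrightarrow> a v) F" "hankel_det a p q \<noteq> 0"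
  shows "((\<lambda>n. poly.coeff (pade_num (A n) p q) v) \<longlongrightarrow> poly.coeff (pade_num a p q) v) F"
proof (cases "v \<le> p")
  case True
  then have "poly.coeff (pade_num b p q) v = (\<Sum>i\<le>v. poly.coeff (pade_den b p q) i * b (v - i))" for b
    by (simp add: pade_num_def nth_default_def del: upt_Suc)
  then show ?thesis
    by (simp only:) (intro tendsto_intros tendsto_pade_den assms)
qed (auto simp: pade_num_def nth_default_def simp del: upt_Suc)

text \<open>Cauchy's inequality on discs of one common radius \<open>r\<close> controls every
  derivative at the centres, at the price of demanding convergence on the larger set
  \<open>L\<close>.\<close>

lemma uniform_limit_higher_deriv:
  fixes f :: "'a \<Rightarrow> complex \<Rightarrow> complex"
  assumes "0 < r" and sub: "\<And>z. z \<in> K \<Longrightarrow> cball z r \<subseteq> L"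
    and lim: "uniform_limit L f g F"
    and f: "\<forall>\<^sub>F n in F. f n analytic_on L" and g: "g analytic_on L"
  shows "uniform_limit K (\<lambda>n. (deriv ^^ l) (f n)) ((deriv ^^ l) g) F"
proof (rule uniform_limitI)
  fix e :: real assume "0 < e"
  \<comment> \<open>Chosen so that Cauchy's bound \<open>fact l * B / r ^ l\<close> equals
    \<open>e / 2\<close>.\<close>
  define B where "B = e / 2 * r ^ l / fact l"
  have "0 < B" using \<open>0 < e\<close> \<open>0 < r\<close> by (simp add: B_def)
  from uniform_limitD[OF lim this] f
  show "\<forall>\<^sub>F n in F. \<forall>z\<in>K. dist ((deriv ^^ l) (f n) z) ((deriv ^^ l) g z) < e"
  proof eventually_elim
    case (elim n)
    show ?case
    proof
      fix z assume z: "z \<in> K"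
      have an: "(\<lambda>z. f n z - g z) analytic_on L"
        using elim(2) g by (intro analytic_on_diff)
      have hol: "(\<lambda>z. f n z - g z) holomorphic_on cball z r"
        using an sub[OF z] analytic_imp_holomorphic analytic_on_subset by blast
      have "norm ((deriv ^^ l) (\<lambda>z. f n z - g z) z) \<le> fact l * B / r ^ l"
      proof (rule Cauchy_inequality)
        show "(\<lambda>z. f n z - g z) holomorphic_on ball z r"
          using hol by (rule holomorphic_on_subset) auto
        show "continuous_on (cball z r) (\<lambda>z. f n z - g z)"
          using hol by (rule holomorphic_on_imp_continuous_on)
        fix x assume "norm (z - x) = r"
        then have "x \<in> L" using sub[OF z] by (auto simp: dist_norm)
        then show "norm (f n x - g x) \<le> B"
          using elim(1) by (simp add: dist_norm less_imp_le)
      qed (fact \<open>0 < r\<close>)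
      also have "\<dots> = e / 2" using \<open>0 < r\<close> by (simp add: B_def)
      also have "(deriv ^^ l) (\<lambda>z. f n z - g z) z = (deriv ^^ l) (f n) z - (deriv ^^ l) g z"
        using elim(2) g sub[OF z] \<open>0 < r\<close>
        by (intro higher_deriv_diff_at) (auto elim!: analytic_on_subset)
      finally show "dist ((deriv ^^ l) (f n) z) ((deriv ^^ l) g z) < e"
        using \<open>0 < e\<close> by (simp add: dist_norm)
    qed
  qed
qed

lemma uniform_limit_poly:
  fixes P :: "'a \<Rightarrow> complex poly"
  assumes deg: "\<And>n. degree (P n) \<le> p" "degree P' \<le> p"
    and lim: "\<And>i. ((\<lambda>n. poly.coeff (P n) i) \<longlongrightarrow> poly.coeff P' i) F"
    and "bounded S"
  shows "uniform_limit S (\<lambda>n z. poly (P n) (z - \<zeta>)) (\<lambda>z. poly P' (z - \<zeta>)) F"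
proof -
  have poly: "poly R z = (\<Sum>i\<le>p. poly.coeff R i * z ^ i)" if "degree R \<le> p" for R :: "complex poly" and z
    unfolding poly_altdef by (rule sum.mono_neutral_left) (use that in \<open>auto simp: coeff_eq_0\<close>)
  have "bounded ((\<lambda>z. z - \<zeta>) ` S)"
    using \<open>bounded S\<close> by (rule bounded_translation_minus)
  then obtain M where M: "0 < M" "\<And>z. z \<in> S \<Longrightarrow> norm (z - \<zeta>) \<le> M"
    by (auto simp: bounded_pos)
  have "((\<lambda>n. \<Sum>i\<le>p. norm (poly.coeff (P n) i - poly.coeff P' i) * M ^ i) \<longlongrightarrow>
      (\<Sum>i\<le>p. norm (poly.coeff P' i - poly.coeff P' i) * M ^ i)) F"
    by (intro tendsto_intros lim)
  then have lim0: "((\<lambda>n. \<Sum>i\<le>p. norm (poly.coeff (P n) i - poly.coeff P' i) * M ^ i) \<longlongrightarrow> 0) F"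
    by simp
  show ?thesis
  proof (rule uniform_limitI)
    fix e :: real assume "0 < e"
    with lim0 have "\<forall>\<^sub>F n in F. (\<Sum>i\<le>p. norm (poly.coeff (P n) i - poly.coeff P' i) * M ^ i) < e"
      by (rule order_tendstoD)
    then show "\<forall>\<^sub>F n in F. \<forall>z\<in>S. dist (poly (P n) (z - \<zeta>)) (poly P' (z - \<zeta>)) < e"
    proof eventually_elim
      case (elim n)
      show ?case
      proof
        fix z assume z: "z \<in> S"
        have "dist (poly (P n) (z - \<zeta>)) (poly P' (z - \<zeta>)) =
            norm (\<Sum>i\<le>p. (poly.coeff (P n) i - poly.coeff P' i) * (z - \<zeta>) ^ i)"
          by (simp add: poly deg dist_norm sum_subtractf left_diff_distrib)
        also have "\<dots> \<le> (\<Sum>i\<le>p. norm (poly.coeff (P n) i - poly.coeff P' i) * M ^ i)"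
          by (intro sum_norm_le) (auto simp: norm_mult norm_power intro!: mult_left_mono power_mono M z)
        finally show "dist (poly (P n) (z - \<zeta>)) (poly P' (z - \<zeta>)) < e" using elim by simp
      qed
    qed
  qed
qed

section \<open>Pade approximants as rational functions\<close>

lemma pade_form_fps_iff:
  "pade_form a p q P Q \<longleftrightarrow> degree P \<le> p \<and> degree Q \<le> q \<and>
     (\<forall>v\<le>p + q. fps_nth (fps_of_poly P - fps_of_poly Q * Abs_fps a) v = 0)"
  by (simp add: pade_form_def fps_mult_nth atLeast0AtMost)

text \<open>Series vanishing up to order \<open>n\<close> form an ideal. Hence truncated identities
  may be multiplied by any series, in particular by the inverse of a denominator.\<close>

lemma fps_mult_nth_eq_0:
  assumes "\<And>i. i \<le> n \<Longrightarrow> fps_nth G i = 0" "v \<le> n"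
  shows "fps_nth (H * G) v = (0 :: 'a :: comm_ring_1)"
  using assms by (simp add: fps_mult_nth)

lemma taylor_rational:
  fixes P Q :: "complex poly"
  assumes "poly.coeff Q 0 \<noteq> 0"
  shows "(deriv ^^ v) (\<lambda>z. poly P (z - \<zeta>) / poly Q (z - \<zeta>)) \<zeta> / fact v =
    fps_nth (fps_of_poly P / fps_of_poly Q) v"
proof -
  have 1: "poly R has_fps_expansion fps_of_poly R" for R :: "complex poly"
    using eval_fps_has_fps_expansion[of "fps_of_poly R"] by (simp add: eval_fps_of_poly[abs_def])
  have "(\<lambda>z. poly P z / poly Q z) has_fps_expansion fps_of_poly P / fps_of_poly Q"
    using assms by (intro has_fps_expansion_divide' 1) simp
  then have "fps_nth (fps_of_poly P / fps_of_poly Q) v = (deriv ^^ v) (\<lambda>z. poly P z / poly Q z) 0 / fact v"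
    by (rule fps_nth_fps_expansion)
  also have "(deriv ^^ v) (\<lambda>z. poly P z / poly Q z) 0 =
      (deriv ^^ v) (\<lambda>z. poly P (z - \<zeta>) / poly Q (z - \<zeta>)) \<zeta>"
    by (subst (2) higher_deriv_shift_0) (simp add: o_def)
  finally show ?thesis by simp
qed

lemma rational_analytic:
  fixes P Q :: "complex poly"
  assumes "\<And>z. z \<in> S \<Longrightarrow> poly Q (z - \<zeta>) \<noteq> 0"
  shows "(\<lambda>z. poly P (z - \<zeta>) / poly Q (z - \<zeta>)) analytic_on S"
proof -
  have "(\<lambda>z. poly R (z - \<zeta>)) analytic_on S" for R
  proof -
    have "(\<lambda>z. poly R (z - \<zeta>)) holomorphic_on UNIV" by (intro holomorphic_intros)
    then show ?thesis using analytic_on_open analytic_on_subset by blast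
  qed
  then show ?thesis using assms by (intro analytic_on_divide)
qed

lemma remove_sings_rational:
  fixes P Q :: "complex poly"
  assumes "poly Q (z - \<zeta>) \<noteq> 0"
  defines "R \<equiv> \<lambda>z. poly P (z - \<zeta>) / poly Q (z - \<zeta>)"
  shows "(deriv ^^ l) (remove_sings R) z = (deriv ^^ l) R z"
    and "\<not> is_pole (remove_sings R) z"
proof -
  have an: "R analytic_on {z}"
    unfolding R_def using assms(1) by (intro rational_analytic) simp
  show "(deriv ^^ l) (remove_sings R) z = (deriv ^^ l) R z"
    by (rule higher_deriv_cong_ev[OF eventually_remove_sings_eq_nhds[OF an] refl])
  show "\<not> is_pole (remove_sings R) z"
    using remove_sings_analytic_on[OF an] analytic_at_imp_no_pole by blast
qed

lemma eventually_at_notin_finite: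
  fixes a :: "'a :: t1_space"
  assumes "finite A"
  shows "\<forall>\<^sub>F x in at a. x \<notin> A"
proof -
  have "open (- (A - {a}))" using assms by (intro open_Compl finite_imp_closed) simp
  then have "\<forall>\<^sub>F x in nhds a. x \<in> - (A - {a})" by (rule eventually_nhds_in_open) simp
  then show ?thesis by (auto simp: eventually_at_filter elim: eventually_mono)
qed

text \<open>A nonzero numerator makes the singularity a genuine pole, which
  \<open>remove_sings\<close> leaves in place.\<close>

lemma is_pole_remove_sings_rational:
  fixes P Q :: "complex poly"
  assumes "Q \<noteq> 0" "poly Q (z - \<zeta>) = 0" "poly P (z - \<zeta>) \<noteq> 0"
  defines "R \<equiv> \<lambda>z. poly P (z - \<zeta>) / poly Q (z - \<zeta>)"
  shows "is_pole (remove_sings R) z"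
proof -
  have "finite ((\<lambda>w. w - \<zeta>) -` {x. poly Q x = 0})"
    using assms(1) by (intro finite_vimageI poly_roots_finite) (auto simp: inj_def)
  then have ev: "\<forall>\<^sub>F w in at z. poly Q (w - \<zeta>) \<noteq> 0"
    by (auto dest!: eventually_at_notin_finite[of _ z] elim: eventually_mono)
  have "is_pole R z"
    unfolding R_def
  proof (rule is_pole_divide)
    have "((\<lambda>w. poly Q (w - \<zeta>)) \<longlongrightarrow> poly Q (z - \<zeta>)) (at z)"
      by (intro tendsto_intros)
    then show "filterlim (\<lambda>w. poly Q (w - \<zeta>)) (at 0) (at z)"
      using ev assms(2) by (simp add: filterlim_at)
  qed (use assms(3) in \<open>auto intro!: continuous_intros\<close>)
  moreover have "isolated_singularity_at R z"
    unfolding isolated_singularity_at_altdef R_def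
    using ev by eventually_elim (auto intro!: rational_analytic)
  ultimately show ?thesis
    using is_pole_cong[OF eventually_remove_sings_eq_at refl] by blast
qed

text \<open>The normalisation of \<open>Q\<close> has two effects: the quotient is analytic at
  \<zeta>, so \<open>remove_sings\<close> does not change its derivatives there, and the series of
  \<open>Q\<close> is a unit, so that clearing the denominator is reversible up to order
  \<open>p + q\<close>.\<close>

lemma is_pade_iff:
  "is_pade a \<zeta> p q R \<longleftrightarrow> (\<exists>P Q. pade_form a p q P Q \<and> poly.coeff Q 0 = 1 \<and>
     R = remove_sings (\<lambda>z. poly P (z - \<zeta>) / poly Q (z - \<zeta>)))"
proof -
  have *: "(\<forall>v\<le>p + q. (deriv ^^ v) (remove_sings (\<lambda>z. poly P (z - \<zeta>) / poly Q (z - \<zeta>))) \<zeta> / fact v = a v) \<longleftrightarrow>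
      (\<forall>v\<le>p + q. fps_nth (fps_of_poly P - fps_of_poly Q * Abs_fps a) v = 0)"
    if Q: "poly.coeff Q 0 = 1" for P Q
  proof -
    have Q': "fps_nth (fps_of_poly Q) 0 \<noteq> 0" using Q by simp
    let ?G = "fps_of_poly P / fps_of_poly Q"
    have "(\<forall>v\<le>p + q. (deriv ^^ v) (remove_sings (\<lambda>z. poly P (z - \<zeta>) / poly Q (z - \<zeta>))) \<zeta> / fact v = a v) \<longleftrightarrow>
        (\<forall>v\<le>p + q. fps_nth (?G - Abs_fps a) v = 0)"
      using Q by (subst remove_sings_rational) (auto simp: taylor_rational poly_0_coeff_0)
    also have "\<dots> \<longleftrightarrow> (\<forall>v\<le>p + q. fps_nth (fps_of_poly Q * (?G - Abs_fps a)) v = 0)"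
    proof (intro iffI allI impI)
      fix v assume *: "\<forall>v\<le>p + q. fps_nth (fps_of_poly Q * (?G - Abs_fps a)) v = 0" and v: "v \<le> p + q"
      have "fps_nth (inverse (fps_of_poly Q) * (fps_of_poly Q * (?G - Abs_fps a))) v = 0"
        by (rule fps_mult_nth_eq_0[OF _ v]) (use * in blast)
      then show "fps_nth (?G - Abs_fps a) v = 0"
        by (simp only: mult.assoc[symmetric] inverse_mult_eq_1[OF Q'] mult_1_left)
    next
      fix v assume *: "\<forall>v\<le>p + q. fps_nth (?G - Abs_fps a) v = 0" and v: "v \<le> p + q"
      show "fps_nth (fps_of_poly Q * (?G - Abs_fps a)) v = 0"
        by (rule fps_mult_nth_eq_0[OF _ v]) (use * in blast)
    qed
    also have "fps_of_poly Q * ?G = fps_of_poly P"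
    proof -
      have "fps_of_poly Q * ?G = fps_of_poly P * (inverse (fps_of_poly Q) * fps_of_poly Q)"
        by (simp only: fps_divide_unit[OF Q'] mult_ac)
      then show ?thesis by (simp only: inverse_mult_eq_1[OF Q'] mult_1_right)
    qed
    then have "fps_of_poly Q * (?G - Abs_fps a) = fps_of_poly P - fps_of_poly Q * Abs_fps a"
      by (simp only: right_diff_distrib)
    finally show ?thesis .
  qed
  show ?thesis
    unfolding is_pade_def pade_form_fps_iff
    by (intro ex_cong1) (use * in auto)
qed

lemma is_pade_unique:
  assumes "hankel_det a p q \<noteq> 0"
  shows "is_pade a \<zeta> p q R \<longleftrightarrow>
    R = remove_sings (\<lambda>z. poly (pade_num a p q) (z - \<zeta>) / poly (pade_den a p q) (z - \<zeta>))"
  unfolding is_pade_iff using pade_form_eq_iff[OF assms] coeff_pade_den_0[of a p q] by metis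

lemma pade_eq:
  assumes "f \<in> pade_D \<Omega> p q \<zeta>"
  defines "a \<equiv> taylor_coeff \<Omega> f \<zeta>"
  shows "pade \<Omega> f \<zeta> p q =
    remove_sings (\<lambda>z. poly (pade_num a p q) (z - \<zeta>) / poly (pade_den a p q) (z - \<zeta>))"
  unfolding pade_def a_def[symmetric]
  using assms by (intro the_equality) (auto simp: is_pade_unique pade_D_def)

text \<open>
  A common zero \<open>w\<close> could be cancelled, and the constant \<open>- w\<close> in place of the factor \<open>z - w\<close>
  would give a second solution.
\<close>

lemma pade_num_den_no_common_zero:
  assumes hankel: "hankel_det a p q \<noteq> 0" and den: "poly (pade_den a p q) w = 0"
  shows "poly (pade_num a p q) w \<noteq> 0"
proof
  assume "poly (pade_num a p q) w = 0"
  then obtain P where P: "pade_num a p q = [:- w, 1:] * P"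
    by (auto simp: poly_eq_0_iff_dvd)
  obtain Q where Q: "pade_den a p q = [:- w, 1:] * Q"
    using den by (auto simp: poly_eq_0_iff_dvd)
  have "w \<noteq> 0" using den coeff_pade_den_0[of a p q] by (auto simp: poly_0_coeff_0)
  have "Q \<noteq> 0" using Q coeff_pade_den_0[of a p q] by auto
  have form: "pade_form a p q (pade_num a p q) (pade_den a p q)"
    using pade_form_eq_iff[OF hankel] by simp
  let ?E = "fps_of_poly P - fps_of_poly Q * Abs_fps a"
  have E: "fps_of_poly (pade_num a p q) - fps_of_poly (pade_den a p q) * Abs_fps a =
      ?E * fps_X - fps_const w * ?E"
  proof -
    have "fps_of_poly ([:- w, 1:] * R) = fps_of_poly R * fps_X - fps_const w * fps_of_poly R" for R
      by (simp add: fps_of_poly_mult fps_of_poly_pCons algebra_simps del: mult_pCons_left flip: fps_const_neg)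
    then show ?thesis by (simp only: P Q) (simp add: algebra_simps)
  qed
  \<comment> \<open>\<open>z - w\<close> is a unit among power series because
    \<open>w \<noteq> 0\<close>. If e_v are the coefficients of \<open>?E\<close>, those of the
    product are - w e_0 and e_v - w e_(v+1), and their vanishing propagates to all e_v up to order
    \<open>p + q\<close>.\<close>
  have "fps_nth ?E v = 0" if "v \<le> p + q" for v
    using that
  proof (induction v)
    case 0
    have "fps_nth (?E * fps_X - fps_const w * ?E) 0 = 0"
      using form unfolding pade_form_fps_iff E by blast
    then show ?case using \<open>w \<noteq> 0\<close> by simp
  next
    case (Suc v)
    have "fps_nth (?E * fps_X - fps_const w * ?E) (Suc v) = 0"
      using form Suc.prems unfolding pade_form_fps_iff E by blast
    moreover have "fps_nth (?E * fps_X) (Suc v) = fps_nth ?E v" by simp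
    moreover have "fps_nth (fps_const w * ?E) (Suc v) = w * fps_nth ?E (Suc v)" by simp
    ultimately show ?case using Suc \<open>w \<noteq> 0\<close>
      by (metis Suc_leD diff_0 fps_sub_nth mult_eq_0_iff neg_equal_0_iff_equal)
  qed
  moreover have "degree P \<le> p"
    using degree_pade_num[of a p q] by (cases "P = 0") (auto simp: P degree_mult_eq simp del: mult_pCons_left)
  moreover have degQ: "degree (pade_den a p q) = Suc (degree Q)"
    using \<open>Q \<noteq> 0\<close> by (simp add: Q degree_mult_eq del: mult_pCons_left)
  then have "degree Q \<le> q" using degree_pade_den[of a p q] by simp
  moreover have "fps_of_poly (Polynomial.smult (- w) P) - fps_of_poly (Polynomial.smult (- w) Q) * Abs_fps a =
      fps_const (- w) * ?E"
    by (simp only: fps_of_poly_smult right_diff_distrib mult.assoc)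
  ultimately have "pade_form a p q (Polynomial.smult (- w) P) (Polynomial.smult (- w) Q)"
    by (simp only: pade_form_fps_iff degree_smult_eq) (use \<open>w \<noteq> 0\<close> in auto)
  moreover have "poly.coeff (Polynomial.smult (- w) Q) 0 = 1"
    using coeff_pade_den_0[of a p q] by (simp add: Q)
  ultimately have "Polynomial.smult (- w) Q = pade_den a p q"
    using pade_form_eq_iff[OF hankel] by blast
  with degQ \<open>w \<noteq> 0\<close> show False by (metis degree_smult_eq n_not_Suc_n neg_equal_0_iff_equal)
qed

section \<open>Rational functions in lowest terms and their Hankel determinants\<close>

text \<open>Euclid's lemma with coprimality expressed by zeros: linear factors of \<open>B\<close>
  are peeled off one at a time, and each divides \<open>D\<close> because \<open>A\<close> does not
  vanish at its zero.\<close>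

lemma dvd_cancel_no_common_zero:
  fixes A B D :: "complex poly"
  assumes "B dvd D * A" "B \<noteq> 0" "\<And>w. poly B w = 0 \<Longrightarrow> poly A w \<noteq> 0"
  shows "B dvd D"
  using assms
proof (induction "degree B" arbitrary: B D)
  case 0
  then have "is_unit B" by (simp add: is_unit_iff_degree)
  then show ?case by (rule unit_imp_dvd)
next
  case (Suc n)
  then obtain w where w: "poly B w = 0"
    using alg_closed_imp_poly_has_root[of B] by auto
  then obtain B' where B': "B = [:- w, 1:] * B'" by (auto simp: poly_eq_0_iff_dvd)
  obtain k where "D * A = B * k" using Suc.prems(1) by (rule dvdE)
  from arg_cong[OF this, of "\<lambda>p. poly p w"] have "poly D w = 0"
    using w Suc.prems(3)[OF w] by simp
  then obtain D' where D': "D = [:- w, 1:] * D'" by (auto simp: poly_eq_0_iff_dvd)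
  have "[:- w, 1:] * B' dvd [:- w, 1:] * (D' * A)"
    using Suc.prems(1) unfolding B' D' mult.assoc .
  then have "B' dvd D' * A"
    by (simp only: dvd_mult_cancel_left) simp
  moreover have "B' \<noteq> 0" using Suc.prems(2) B' by auto
  moreover from this have "n = degree B'"
    using Suc.hyps(2) by (simp add: B' degree_mult_eq del: mult_pCons_left)
  moreover have "poly A v \<noteq> 0" if "poly B' v = 0" for v
    using Suc.prems(3)[of v] that by (simp add: B')
  ultimately have "B' dvd D'" using Suc.hyps(1) by blast
  then show ?case unfolding B' D' by (rule mult_dvd_mono[OF dvd_refl])
qed

text \<open>A singular determinant would give \<open>N\<close> and \<open>D \<noteq> 0\<close> with
  \<open>D\<close> vanishing at 0. Then \<open>B * N - D * A\<close> has degree at most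
  \<open>p + q\<close> and vanishes up to that order, so it is 0. As \<open>B\<close> and
  \<open>A\<close> have no common zero, \<open>D = B * C\<close> and \<open>N = C * A\<close>; since
  \<open>A\<close> has the full degree \<open>p\<close>, the factor \<open>C\<close> is constant,
  and its value at 0 is 0.\<close>

lemma hankel_det_rational:
  fixes A B :: "complex poly"
  assumes "degree A = p" "A \<noteq> 0" "degree B \<le> q" "poly.coeff B 0 \<noteq> 0" "\<And>w. poly B w = 0 \<Longrightarrow> poly A w \<noteq> 0"
    and a: "\<And>v. v \<le> p + q \<Longrightarrow> fps_nth (fps_of_poly B * Abs_fps a - fps_of_poly A) v = 0"
  shows "hankel_det a p q \<noteq> 0"
proof
  assume "hankel_det a p q = 0"
  then obtain N D where ND: "pade_form a p q N D" "D \<noteq> 0" "poly.coeff D 0 = 0"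
    by (rule pade_form_singular)
  have "B * N - D * A = 0"
  proof (rule poly_eqI)
    fix v
    \<comment> \<open>The multiples of \<open>Abs_fps a\<close> cancel, which leaves two products
      with a factor vanishing up to order \<open>p + q\<close>.\<close>
    have eq: "fps_of_poly (B * N - D * A) = fps_of_poly B * (fps_of_poly N - fps_of_poly D * Abs_fps a) +
        fps_of_poly D * (fps_of_poly B * Abs_fps a - fps_of_poly A)"
      by (simp add: fps_of_poly_mult fps_of_poly_diff algebra_simps)
    show "poly.coeff (B * N - D * A) v = poly.coeff 0 v"
    proof (cases "v \<le> p + q")
      case True
      have "fps_nth (fps_of_poly B * (fps_of_poly N - fps_of_poly D * Abs_fps a)) v = 0"
        by (rule fps_mult_nth_eq_0[OF _ True]) (use ND(1) in \<open>simp only: pade_form_fps_iff\<close>)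
      moreover have "fps_nth (fps_of_poly D * (fps_of_poly B * Abs_fps a - fps_of_poly A)) v = 0"
        by (rule fps_mult_nth_eq_0[OF a True])
      ultimately have "fps_nth (fps_of_poly (B * N - D * A)) v = 0"
        by (simp only: eq fps_add_nth add_0)
      then show ?thesis by simp
    next
      case False
      have "degree (B * N) \<le> p + q" "degree (D * A) \<le> p + q"
        using degree_mult_le[of B N] degree_mult_le[of D A] assms(1,3) ND(1)
        by (auto simp: pade_form_def)
      then have "degree (B * N - D * A) \<le> p + q" by (rule degree_diff_le)
      then have "degree (B * N - D * A) < v" using False by simp
      then show ?thesis by (simp only: coeff_eq_0 coeff_0)
    qed
  qed
  then have eq: "B * N = D * A" by simp
  then have "B dvd D * A" by (metis dvd_triv_left)
  moreover have "B \<noteq> 0" using assms(4) by auto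
  ultimately have "B dvd D" using assms(5) by (rule dvd_cancel_no_common_zero)
  then obtain C where C: "D = B * C" by auto
  have "B \<noteq> 0" "C \<noteq> 0" using assms(4) ND(2) C by auto
  then have "N = C * A" using eq C by auto
  then have "degree N = degree C + p" using \<open>C \<noteq> 0\<close> assms(1,2) by (simp add: degree_mult_eq)
  then have "degree C = 0" using ND(1) by (simp add: pade_form_def)
  moreover have "poly.coeff C 0 = 0" using ND(3) assms(4) by (simp add: C coeff_mult)
  ultimately show False using \<open>C \<noteq> 0\<close> by (metis leading_coeff_0_iff)
qed

section \<open>Uniform approximation of Cauchy integrals\<close>

text \<open>The space of approximants stays abstract: the argument with Cauchy integrals only needs
  a linear space by which the kernels can be approximated.\<close>

definition fun_subspace :: "('a \<Rightarrow> complex) set \<Rightarrow> bool" where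
  "fun_subspace R \<longleftrightarrow> (\<lambda>_. 0) \<in> R \<and> (\<forall>r\<in>R. \<forall>s\<in>R. (\<lambda>z. r z + s z) \<in> R) \<and>
     (\<forall>c. \<forall>r\<in>R. (\<lambda>z. c * r z) \<in> R)"

text \<open>Membership in the uniform closure of \<open>R\<close> on \<open>K\<close>. The
  non-strict bound survives limits of points, which later serves to cross the grid lines.\<close>

definition unif_approx :: "('a \<Rightarrow> complex) set \<Rightarrow> 'a set \<Rightarrow> ('a \<Rightarrow> complex) \<Rightarrow> bool" where
  "unif_approx R K g \<longleftrightarrow> (\<forall>e>0. \<exists>r\<in>R. \<forall>z\<in>K. norm (g z - r z) \<le> e)"

lemma unif_approxD:
  assumes "unif_approx R K g" "0 < e"
  obtains r where "r \<in> R" "\<And>z. z \<in> K \<Longrightarrow> norm (g z - r z) \<le> e"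
  using assms unfolding unif_approx_def by blast

lemma unif_approx_add:
  assumes R: "fun_subspace R" and f: "unif_approx R K f" and g: "unif_approx R K g"
  shows "unif_approx R K (\<lambda>z. f z + g z)"
  unfolding unif_approx_def
proof (intro allI impI)
  fix e :: real assume "0 < e"
  then have e2: "0 < e / 2" by simp
  obtain r where r: "r \<in> R" "\<And>z. z \<in> K \<Longrightarrow> norm (f z - r z) \<le> e / 2"
    using unif_approxD[OF f e2] by blast
  obtain s where s: "s \<in> R" "\<And>z. z \<in> K \<Longrightarrow> norm (g z - s z) \<le> e / 2"
    using unif_approxD[OF g e2] by blast
  show "\<exists>r\<in>R. \<forall>z\<in>K. norm (f z + g z - r z) \<le> e"
  proof (intro bexI ballI)
    fix z assume "z \<in> K"
    with r(2) s(2) have "norm (f z - r z) \<le> e / 2" "norm (g z - s z) \<le> e / 2" by auto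
    then show "norm (f z + g z - (r z + s z)) \<le> e"
      using norm_triangle_ineq[of "f z - r z" "g z - s z"] by (simp add: algebra_simps)
  qed (use R r(1) s(1) in \<open>simp add: fun_subspace_def\<close>)
qed

lemma unif_approx_cmult:
  assumes R: "fun_subspace R" and f: "unif_approx R K f"
  shows "unif_approx R K (\<lambda>z. c * f z)"
  unfolding unif_approx_def
proof (intro allI impI)
  fix e :: real assume "0 < e"
  then have e2: "0 < e / (norm c + 1)" by (simp add: add_nonneg_pos)
  obtain r where r: "r \<in> R" "\<And>z. z \<in> K \<Longrightarrow> norm (f z - r z) \<le> e / (norm c + 1)"
    using unif_approxD[OF f e2] by blast
  show "\<exists>r\<in>R. \<forall>z\<in>K. norm (c * f z - r z) \<le> e"
  proof (intro bexI ballI)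
    fix z assume "z \<in> K"
    have "norm (c * f z - c * r z) = norm c * norm (f z - r z)"
      by (simp add: norm_mult flip: right_diff_distrib)
    also have "\<dots> \<le> (norm c + 1) * (e / (norm c + 1))"
      using r(2)[OF \<open>z \<in> K\<close>] by (intro mult_mono) auto
    also have "\<dots> = e" by (simp add: add_nonneg_pos order_less_imp_not_eq2)
    finally show "norm (c * f z - c * r z) \<le> e" .
  qed (use R r(1) in \<open>simp add: fun_subspace_def\<close>)
qed

lemma unif_approx_sum:
  assumes R: "fun_subspace R" and "\<And>x. x \<in> A \<Longrightarrow> unif_approx R K (f x)"
  shows "unif_approx R K (\<lambda>z. \<Sum>x\<in>A. f x z)"
proof -
  have zero: "unif_approx R K (\<lambda>_. 0)"
    using R unfolding unif_approx_def fun_subspace_def by (auto intro!: bexI[of _ "\<lambda>_. 0"])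
  show ?thesis
  proof (cases "finite A")
    case True
    then show ?thesis
      using assms(2) by (induction A rule: finite_induct) (auto intro: zero unif_approx_add[OF R])
  qed (simp add: zero)
qed

text \<open>
  The approximation error on \<open>[s, t]\<close> is kept below \<open>e (t - s)\<close>; such bounds are additive, so that it
  suffices to treat short intervals.
\<close>

lemma unif_approx_integral:
  fixes F :: "real \<Rightarrow> 'a :: metric_space \<Rightarrow> complex"
  assumes R: "fun_subspace R" and "compact K" and cont: "continuous_on ({0..1} \<times> K) (\<lambda>(t, z). F t z)"
    and F: "\<And>t. t \<in> {0..1} \<Longrightarrow> unif_approx R K (F t)"
  shows "unif_approx R K (\<lambda>z. integral {0..1} (\<lambda>t. F t z))"
  unfolding unif_approx_def
proof (intro allI impI)
  fix e :: real assume "0 < e"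
  \<comment> \<open>\<open>Bolzano\<close> also tests intervals around \<open>x\<close> that stick
    out of \<open>[0, 1]\<close>; the guard makes \<open>P\<close> vacuous for them.\<close>
  define P where "P s t \<longleftrightarrow> (0 \<le> s \<and> t \<le> 1 \<longrightarrow>
    (\<exists>r\<in>R. \<forall>z\<in>K. norm (integral {s..t} (\<lambda>u. F u z) - r z) \<le> e * (t - s)))" for s t
  have cont1: "continuous_on {s..t} (\<lambda>u. F u z)" if "z \<in> K" "0 \<le> s" "t \<le> 1" for s t z
  proof -
    have "continuous_on {s..t} (\<lambda>u. (\<lambda>(t, z). F t z) (u, z))"
      by (rule continuous_on_compose2[OF cont]) (use that in \<open>auto intro!: continuous_intros\<close>)
    then show ?thesis by simp
  qed
  have "uniformly_continuous_on ({0..1} \<times> K) (\<lambda>(t, z). F t z)"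
    using cont \<open>compact K\<close> by (intro compact_uniformly_continuous compact_Times) auto
  then obtain d where d: "0 < d" "\<And>x y. x \<in> {0..1} \<times> K \<Longrightarrow> y \<in> {0..1} \<times> K \<Longrightarrow> dist y x < d \<Longrightarrow>
      dist ((\<lambda>(t, z). F t z) y) ((\<lambda>(t, z). F t z) x) < e / 2"
    using \<open>0 < e\<close> unfolding uniformly_continuous_on_def by (metis half_gt_zero)
  have "P 0 1"
  proof (rule Bolzano[where P = P, OF zero_le_one])
    fix s t u assume trans: "P s t" "P t u" "s \<le> t" "t \<le> u"
    show "P s u"
      unfolding P_def
    proof
      assume su: "0 \<le> s \<and> u \<le> 1"
      obtain r where r: "r \<in> R" "\<And>z. z \<in> K \<Longrightarrow> norm (integral {s..t} (\<lambda>u. F u z) - r z) \<le> e * (t - s)"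
        using trans su unfolding P_def by fastforce
      obtain r' where r': "r' \<in> R" "\<And>z. z \<in> K \<Longrightarrow> norm (integral {t..u} (\<lambda>u. F u z) - r' z) \<le> e * (u - t)"
        using trans su unfolding P_def by fastforce
      show "\<exists>r\<in>R. \<forall>z\<in>K. norm (integral {s..u} (\<lambda>u. F u z) - r z) \<le> e * (u - s)"
      proof (intro bexI ballI)
        fix z assume z: "z \<in> K"
        have "integral {s..t} (\<lambda>u. F u z) + integral {t..u} (\<lambda>u. F u z) = integral {s..u} (\<lambda>u. F u z)"
          using trans su z
          by (intro Henstock_Kurzweil_Integration.integral_combine integrable_continuous_real cont1) auto
        then have "norm (integral {s..u} (\<lambda>u. F u z) - (r z + r' z)) \<le>
            norm (integral {s..t} (\<lambda>u. F u z) - r z) + norm (integral {t..u} (\<lambda>u. F u z) - r' z)"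
          by (metis add_diff_add norm_triangle_ineq)
        also have "\<dots> \<le> e * (t - s) + e * (u - t)" using r(2)[OF z] r'(2)[OF z] by simp
        also have "\<dots> = e * (u - s)" by (simp add: algebra_simps)
        finally show "norm (integral {s..u} (\<lambda>u. F u z) - (r z + r' z)) \<le> e * (u - s)" .
      qed (use R r(1) r'(1) in \<open>simp add: fun_subspace_def\<close>)
    qed
  next
    fix x :: real assume local: "0 \<le> x" "x \<le> 1"
    have "P s t" if st: "s \<le> x" "x \<le> t" "t - s < d" for s t
      unfolding P_def
    proof
      assume 01: "0 \<le> s \<and> t \<le> 1"
      \<comment> \<open>One approximant at \<open>x\<close> serves the whole short interval: half of
        \<open>e\<close> covers the variation of \<open>F\<close>, half the approximation.
        Integration multiplies \<open>r\<close> by the length, which stays in the subspace.\<close>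
      obtain r where r: "r \<in> R" "\<And>z. z \<in> K \<Longrightarrow> norm (F x z - r z) \<le> e / 2"
        using unif_approxD[OF F[of x], of "e / 2"] local \<open>0 < e\<close> by auto
      show "\<exists>r\<in>R. \<forall>z\<in>K. norm (integral {s..t} (\<lambda>u. F u z) - r z) \<le> e * (t - s)"
      proof (intro bexI ballI)
        fix z assume z: "z \<in> K"
        have "integral {s..t} (\<lambda>u. F u z - r z) = integral {s..t} (\<lambda>u. F u z) - integral {s..t} (\<lambda>u. r z)"
          using 01 z by (intro Henstock_Kurzweil_Integration.integral_diff integrable_continuous_real cont1) auto
        then have eq: "integral {s..t} (\<lambda>u. F u z) - of_real (t - s) * r z = integral {s..t} (\<lambda>u. F u z - r z)"
          using st by (simp add: scaleR_conv_of_real)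
        have "norm (integral {s..t} (\<lambda>u. F u z - r z)) \<le> e * (t - s)"
        proof (rule integral_bound)
          show "continuous_on {s..t} (\<lambda>u. F u z - r z)"
            using 01 z by (intro continuous_intros cont1) auto
          fix u assume u: "u \<in> {s..t}"
          have "dist ((\<lambda>(t, z). F t z) (u, z)) ((\<lambda>(t, z). F t z) (x, z)) < e / 2"
            by (rule d(2)) (use u st 01 z local in \<open>auto simp: dist_Pair_Pair dist_real_def\<close>)
          then have "norm (F u z - F x z) < e / 2" by (simp add: dist_norm)
          then show "norm (F u z - r z) \<le> e"
            using r(2)[OF z] norm_triangle_ineq[of "F u z - F x z" "F x z - r z"] by simp
        qed (use st in simp)
        then show "norm (integral {s..t} (\<lambda>u. F u z) - of_real (t - s) * r z) \<le> e * (t - s)"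
          by (simp only: eq)
      qed (use R r(1) in \<open>simp add: fun_subspace_def\<close>)
    qed
    then show "\<exists>d>0. \<forall>s t. s \<le> x \<and> x \<le> t \<and> t - s < d \<longrightarrow> P s t" using d(1) by blast
  qed
  then show "\<exists>r\<in>R. \<forall>z\<in>K. norm (integral {0..1} (\<lambda>t. F t z) - r z) \<le> e"
    by (simp add: P_def)
qed

lemma unif_approx_linepath:
  assumes R: "fun_subspace R" and K: "compact K" "closed_segment a b \<inter> K = {}"
    and h: "continuous_on (closed_segment a b) h"
    and w: "\<And>w. w \<in> closed_segment a b \<Longrightarrow> unif_approx R K (\<lambda>z. 1 / (w - z))"
  shows "unif_approx R K (\<lambda>z. contour_integral (linepath a b) (\<lambda>w. h w / (w - z)))"
proof -
  let ?F = "\<lambda>t z. h (linepath a b t) * (b - a) * (1 / (linepath a b t - z))"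
  have lp: "linepath a b t \<in> closed_segment a b" if "t \<in> {0..1}" for t
    using linepath_in_path that by auto
  have "continuous_on {0..1} (\<lambda>t. h (linepath a b t))"
    by (rule continuous_on_compose2[OF h]) (use lp in \<open>auto intro!: continuous_intros\<close>)
  then have c: "continuous_on ({0..1} \<times> K) (\<lambda>x. h (linepath a b (fst x)))"
    by (rule continuous_on_compose2) (auto intro!: continuous_intros)
  have "linepath a b t - z \<noteq> 0" if "t \<in> {0..1}" "z \<in> K" for t z
    using lp[OF that(1)] that(2) K(2) by auto
  then have "continuous_on ({0..1} \<times> K) (\<lambda>x. ?F (fst x) (snd x))"
    unfolding linepath_def by (intro continuous_intros c[unfolded linepath_def]) auto
  then have "unif_approx R K (\<lambda>z. integral {0..1} (\<lambda>t. ?F t z))"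
    using lp by (intro unif_approx_integral[OF R K(1)] unif_approx_cmult[OF R] w)
      (auto simp: case_prod_unfold)
  also have "(\<lambda>z. integral {0..1} (\<lambda>t. ?F t z)) = (\<lambda>z. contour_integral (linepath a b) (\<lambda>w. h w / (w - z)))"
    by (simp add: contour_integral_integral mult.commute)
  finally show ?thesis .
qed

text \<open>The boundary integral is rearranged so that all horizontal edges run to the right and
  all vertical ones upwards. A common edge of two adjacent squares then contributes the same
  integral with opposite signs.\<close>

lemma rectangle_integral:
  assumes "open V" "h holomorphic_on V" "cbox a c \<subseteq> V" "Re a < Re c" "Im a < Im c"
    and z: "z \<notin> path_image (rectpath a c)"
  defines "b \<equiv> Complex (Re c) (Im a)" and "d \<equiv> Complex (Re a) (Im c)" and "k \<equiv> \<lambda>w. h w / (w - z)"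
  shows "contour_integral (linepath a b) k + contour_integral (linepath b c) k
    - contour_integral (linepath d c) k - contour_integral (linepath a d) k =
    (if z \<in> box a c then 2 * pi * \<i> * h z else 0)"
proof -
  have sub: "path_image (rectpath a c) \<subseteq> cbox a c"
    using assms(4,5) by (intro path_image_rectpath_subset_cbox) auto
  have hol: "h holomorphic_on cbox a c" using assms(2,3) by (rule holomorphic_on_subset)
  have img: "path_image (rectpath a c) = closed_segment a b \<union> closed_segment b c \<union> closed_segment c d \<union> closed_segment d a"
    by (simp add: rectpath_def Let_def path_image_join b_def d_def Un_assoc)
  have cont: "continuous_on (path_image (rectpath a c)) k"
    unfolding k_def using z sub hol
    by (intro continuous_intros holomorphic_on_imp_continuous_on) (auto intro: holomorphic_on_subset)
  have c: "continuous_on (closed_segment a b) k" "continuous_on (closed_segment b c) k"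
    "continuous_on (closed_segment c d) k" "continuous_on (closed_segment d a) k"
    by (auto intro: continuous_on_subset[OF cont] simp: img)
  then have ci: "k contour_integrable_on linepath a b" "k contour_integrable_on linepath b c"
    "k contour_integrable_on linepath c d" "k contour_integrable_on linepath d a"
    by (auto intro: contour_integrable_continuous_linepath)
  have "contour_integral (rectpath a c) k = contour_integral (linepath a b) k + contour_integral (linepath b c) k
    + contour_integral (linepath c d) k + contour_integral (linepath d a) k"
    using ci by (simp add: rectpath_def Let_def b_def[symmetric] d_def[symmetric] contour_integrable_joinI)
  also have "contour_integral (linepath c d) k = - contour_integral (linepath d c) k"
    using c by (intro contour_integral_reverse_linepath)
  also have "contour_integral (linepath d a) k = - contour_integral (linepath a d) k"
    using c by (intro contour_integral_reverse_linepath)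
  finally have eq: "contour_integral (linepath a b) k + contour_integral (linepath b c) k
    - contour_integral (linepath d c) k - contour_integral (linepath a d) k = contour_integral (rectpath a c) k"
    by simp
  have "(k has_contour_integral (if z \<in> box a c then 2 * pi * \<i> * h z else 0)) (rectpath a c)"
  proof (cases "z \<in> box a c")
    case True
    have "(k has_contour_integral (2 * pi * \<i> * winding_number (rectpath a c) z * h z)) (rectpath a c)"
      unfolding k_def using True z sub
      by (intro Cauchy_integral_formula_convex_simple[OF _ hol]) (auto simp: convex_box)
    then show ?thesis using True by (simp add: winding_number_rectpath)
  next
    case False
    have "z \<notin> cbox a c"
      using False z assms(4,5) by (simp add: path_image_rectpath_cbox_minus_box)
    then have "k holomorphic_on cbox a c"
      unfolding k_def using hol by (intro holomorphic_intros) auto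
    then show ?thesis
      using False sub by (auto intro: Cauchy_theorem_convex_simple simp: convex_box)
  qed
  then show ?thesis unfolding eq by (rule contour_integral_unique)
qed

lemma sum_diff_sum:
  fixes f :: "'a \<Rightarrow> 'b :: ab_group_add"
  assumes "finite A" "finite B"
  shows "sum f A - sum f B = sum f (A - B) - sum f (B - A)"
  using sum.Int_Diff[OF assms(1), of f B] sum.Int_Diff[OF assms(2), of f A] by (simp add: Int_commute)

text \<open>
  Cauchy's formula for a fine grid of squares; edges that meet \<open>L\<close> are shared by two squares of the
  sum and cancel.
\<close>

lemma unif_approx_off_grid:
  fixes h :: "complex \<Rightarrow> complex"
  assumes R: "fun_subspace R" and L: "compact L" "L \<subseteq> V" and V: "open V" "h holomorphic_on V"
    and K: "compact K" "K \<subseteq> L" and w: "\<And>w. w \<in> V - L \<Longrightarrow> unif_approx R K (\<lambda>z. 1 / (w - z))"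
  obtains \<delta> where "0 < \<delta>" "unif_approx R {z \<in> K. \<forall>i::int. Re z \<noteq> \<delta> * i \<and> Im z \<noteq> \<delta> * i} h"
proof -
  obtain \<epsilon> where \<epsilon>: "0 < \<epsilon>" "(\<Union>x\<in>L. cball x \<epsilon>) \<subseteq> V"
    using compact_subset_open_imp_cball_epsilon_subset[OF L(1) V(1) L(2)] by blast
  \<comment> \<open>Within a cell of side \<delta> each coordinate varies by at most \<delta>, so
    distances are at most \<open>2 * \<delta> = \<epsilon>\<close>, and a cell that meets
    \<open>L\<close> lies in \<open>V\<close>.\<close>
  define \<delta> where "\<delta> = \<epsilon> / 2"
  have "0 < \<delta>" using \<epsilon>(1) by (simp add: \<delta>_def)
  define c where "c i j = Complex (\<delta> * of_int i) (\<delta> * of_int j)" for i j :: int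
  define Q where "Q i j = cbox (c i j) (c (i + 1) (j + 1))" for i j
  define G where "G = {(i, j). Q i j \<inter> L \<noteq> {}}"
  define S where "S = {z \<in> K. \<forall>i::int. Re z \<noteq> \<delta> * i \<and> Im z \<noteq> \<delta> * i}"
  have Q: "w \<in> Q i j \<longleftrightarrow> \<delta> * i \<le> Re w \<and> Re w \<le> \<delta> * i + \<delta> \<and> \<delta> * j \<le> Im w \<and> Im w \<le> \<delta> * j + \<delta>" for w i j
    by (auto simp: Q_def c_def in_cbox_complex_iff algebra_simps)
  have QV: "Q i j \<subseteq> V" if "(i, j) \<in> G" for i j
  proof
    fix w assume "w \<in> Q i j"
    from that obtain x where "x \<in> Q i j" "x \<in> L" by (auto simp: G_def)
    have "norm (x - w) \<le> \<bar>Re (x - w)\<bar> + \<bar>Im (x - w)\<bar>" by (rule cmod_le)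
    also have "\<dots> \<le> \<epsilon>" using \<open>w \<in> Q i j\<close> \<open>x \<in> Q i j\<close> by (auto simp: Q \<delta>_def)
    finally show "w \<in> V" using \<open>x \<in> L\<close> \<epsilon>(2) by (force simp: dist_norm)
  qed
  have "finite G"
  proof -
    obtain M where M: "\<And>x. x \<in> L \<Longrightarrow> norm x \<le> M"
      using compact_imp_bounded[OF L(1)] by (auto simp: bounded_iff)
    define m where "m = \<lceil>M / \<delta>\<rceil> + 1"
    have "i \<in> {-m..m} \<and> j \<in> {-m..m}" if "(i, j) \<in> G" for i j
    proof -
      from that obtain x where x: "x \<in> Q i j" "norm x \<le> M" using M by (auto simp: G_def)
      have "M / \<delta> \<le> of_int m - 1" by (simp add: m_def)
      then have "M \<le> \<delta> * of_int m - \<delta>" using \<open>0 < \<delta>\<close> by (simp add: field_simps)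
      moreover have "\<bar>Re x\<bar> \<le> M" "\<bar>Im x\<bar> \<le> M"
        using x(2) abs_Re_le_cmod[of x] abs_Im_le_cmod[of x] by linarith+
      ultimately have "\<delta> * of_int i \<le> \<delta> * of_int m" "- (\<delta> * of_int m) \<le> \<delta> * of_int i"
        "\<delta> * of_int j \<le> \<delta> * of_int m" "- (\<delta> * of_int m) \<le> \<delta> * of_int j"
        using x(1)[unfolded Q] \<open>0 < \<delta>\<close> by linarith+
      then have "\<delta> * of_int i \<le> \<delta> * of_int m" "\<delta> * of_int (- m) \<le> \<delta> * of_int i"
        "\<delta> * of_int j \<le> \<delta> * of_int m" "\<delta> * of_int (- m) \<le> \<delta> * of_int j"
        by simp_all
      then show ?thesis using \<open>0 < \<delta>\<close> by (simp only: mult_le_cancel_left_pos) auto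
    qed
    then have "G \<subseteq> {-m..m} \<times> {-m..m}" by auto
    then show ?thesis by (rule finite_subset) auto
  qed
  define hor where "hor x z = contour_integral (linepath (c (fst x) (snd x)) (c (fst x + 1) (snd x)))
    (\<lambda>w. h w / (w - z))" for x z
  define ver where "ver x z = contour_integral (linepath (c (fst x) (snd x)) (c (fst x) (snd x + 1)))
    (\<lambda>w. h w / (w - z))" for x z
  \<comment> \<open>The top edge of a cell is the bottom edge of its image under \<open>up\<close>,
    its right edge the left edge of its image under \<open>right\<close>; thus \<open>hor\<close>
    and \<open>ver\<close> cover all four edges.\<close>
  define up where "up = (\<lambda>(i::int, j::int). (i, j + 1))"
  define right where "right = (\<lambda>(i::int, j::int). (i + 1, j))"
  have inj: "inj_on up G" "inj_on right G" by (auto simp: inj_on_def up_def right_def)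
  have square: "(\<Sum>x\<in>G. hor x z + ver (right x) z - hor (up x) z - ver x z) = 2 * pi * \<i> * h z" if "z \<in> S" for z
  proof -
    define i0 j0 where "i0 = \<lfloor>Re z / \<delta>\<rfloor>" and "j0 = \<lfloor>Im z / \<delta>\<rfloor>"
    have off: "Re z \<noteq> \<delta> * of_int i" "Im z \<noteq> \<delta> * of_int i" for i :: int
      using that by (auto simp: S_def)
    have fl: "\<delta> * of_int \<lfloor>x / \<delta>\<rfloor> \<le> x" "x < \<delta> * of_int \<lfloor>x / \<delta>\<rfloor> + \<delta>" for x
      using \<open>0 < \<delta>\<close> floor_divide_lower[of \<delta> x] floor_divide_upper[of \<delta> x] by (simp_all add: algebra_simps)
    \<comment> \<open>Off the grid lines \<open>z\<close> is interior to exactly one cell, the only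
      one to contribute in Cauchy's formula.\<close>
    have box: "z \<in> box (c i j) (c (i + 1) (j + 1)) \<longleftrightarrow> i = i0 \<and> j = j0" for i j
    proof
      assume "z \<in> box (c i j) (c (i + 1) (j + 1))"
      then have "of_int i \<le> Re z / \<delta> \<and> Re z / \<delta> < of_int i + 1 \<and> of_int j \<le> Im z / \<delta> \<and> Im z / \<delta> < of_int j + 1"
        using \<open>0 < \<delta>\<close> by (auto simp: c_def in_box_complex_iff field_simps)
      then show "i = i0 \<and> j = j0" unfolding i0_def j0_def by (metis floor_unique)
    next
      assume "i = i0 \<and> j = j0"
      then show "z \<in> box (c i j) (c (i + 1) (j + 1))"
        using fl[of "Re z"] fl[of "Im z"] off[of i0] off[of j0]
        by (simp add: c_def in_box_complex_iff algebra_simps i0_def j0_def less_le)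
    qed
    have "z \<in> Q i0 j0" using box[of i0 j0] box_subset_cbox unfolding Q_def by blast
    moreover have "z \<in> L" using that K(2) by (auto simp: S_def)
    ultimately have "(i0, j0) \<in> G" by (auto simp: G_def)
    have "hor x z + ver (right x) z - hor (up x) z - ver x z = (if x = (i0, j0) then 2 * pi * \<i> * h z else 0)"
      if "x \<in> G" for x
    proof -
      obtain i j where x: "x = (i, j)" by force
      have re: "Complex (Re (c (i + 1) (j + 1))) (Im (c i j)) = c (i + 1) j"
        "Complex (Re (c i j)) (Im (c (i + 1) (j + 1))) = c i (j + 1)" by (simp_all add: c_def)
      have lt: "Re (c i j) < Re (c (i + 1) (j + 1))" "Im (c i j) < Im (c (i + 1) (j + 1))"
        using \<open>0 < \<delta>\<close> by (simp_all add: c_def)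
      have notin: "z \<notin> path_image (rectpath (c i j) (c (i + 1) (j + 1)))"
        using lt off[of i] off[of "i + 1"] off[of j] off[of "j + 1"]
        by (auto simp: path_image_rectpath c_def)
      show ?thesis
        using rectangle_integral[OF V QV[unfolded Q_def] lt notin, unfolded re box] that
        unfolding x hor_def ver_def right_def up_def by simp
    qed
    then have "(\<Sum>x\<in>G. hor x z + ver (right x) z - hor (up x) z - ver x z) =
        (\<Sum>x\<in>G. if x = (i0, j0) then 2 * pi * \<i> * h z else 0)"
      by (rule sum.cong[OF refl])
    then show ?thesis using \<open>finite G\<close> \<open>(i0, j0) \<in> G\<close> by simp
  qed
  \<comment> \<open>Reindexing turns the sum over cells into sums over edges; edges of two cells of
    \<open>G\<close> drop out, and the set differences collect the edges of just one.\<close>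
  have split: "(\<Sum>x\<in>G. hor x z + ver (right x) z - hor (up x) z - ver x z) =
      ((\<Sum>x\<in>G - up ` G. hor x z) + (-1) * (\<Sum>x\<in>up ` G - G. hor x z)) +
      ((\<Sum>x\<in>right ` G - G. ver x z) + (-1) * (\<Sum>x\<in>G - right ` G. ver x z))" for z
  proof -
    have "(\<Sum>x\<in>G. hor x z + ver (right x) z - hor (up x) z - ver x z) =
        ((\<Sum>x\<in>G. hor x z) - (\<Sum>x\<in>up ` G. hor x z)) + ((\<Sum>x\<in>right ` G. ver x z) - (\<Sum>x\<in>G. ver x z))"
      by (simp add: sum.reindex[OF inj(1)] sum.reindex[OF inj(2)] sum.distrib sum_subtractf)
    then show ?thesis
      using sum_diff_sum[of G "up ` G" "\<lambda>x. hor x z"] sum_diff_sum[of "right ` G" G "\<lambda>x. ver x z"] \<open>finite G\<close>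
      by simp
  qed
  \<comment> \<open>A surviving edge lies in a cell of \<open>G\<close>, hence in \<open>V\<close>,
    and also in a cell outside \<open>G\<close>, hence off \<open>L\<close>. On such edges the
    kernels are approximable by assumption.\<close>
  have edge: "unif_approx R K (\<lambda>z. contour_integral (linepath a b) (\<lambda>w. h w / (w - z)))"
    if "a \<in> Q i j" "b \<in> Q i j" "a \<in> Q k l" "b \<in> Q k l" "(i, j) \<in> G" "(k, l) \<notin> G" for a b i j k l
  proof -
    have "closed_segment a b \<subseteq> Q i j" "closed_segment a b \<subseteq> Q k l"
      unfolding Q_def by (rule closed_segment_subset[OF that(1,2)[unfolded Q_def] convex_box(1)],
        rule closed_segment_subset[OF that(3,4)[unfolded Q_def] convex_box(1)])
    then have sub: "closed_segment a b \<subseteq> V" "closed_segment a b \<inter> L = {}"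
      using QV[OF that(5)] that(6) by (auto simp: G_def)
    show ?thesis
    proof (rule unif_approx_linepath[OF R K(1)])
      show "continuous_on (closed_segment a b) h"
        using holomorphic_on_imp_continuous_on[OF V(2)] sub(1) by (rule continuous_on_subset)
    qed (use sub K(2) w in auto)
  qed
  have corner: "c i j \<in> Q i j" "c (i + 1) j \<in> Q i j" "c i (j + 1) \<in> Q i j" "c (i + 1) (j + 1) \<in> Q i j" for i j
    using \<open>0 < \<delta>\<close> by (auto simp: Q c_def algebra_simps)
  have hor1: "unif_approx R K (hor x)" if "x \<in> G - up ` G" for x
  proof -
    obtain i j where x: "x = (i, j)" by force
    have "(i, j - 1) \<notin> G" using that by (force simp: x up_def)
    then show ?thesis
      using edge[of "c i j" i j "c (i + 1) j" i "j - 1"] corner[of i j] corner[of i "j - 1"] that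
      by (simp add: x hor_def[abs_def])
  qed
  have hor2: "unif_approx R K (hor x)" if "x \<in> up ` G - G" for x
  proof -
    from that obtain i j where x: "x = (i, j + 1)" "(i, j) \<in> G" "(i, j + 1) \<notin> G" by (auto simp: up_def)
    then show ?thesis
      using edge[of "c i (j + 1)" i j "c (i + 1) (j + 1)" i "j + 1"] corner[of i j] corner[of i "j + 1"]
      by (simp add: hor_def[abs_def])
  qed
  have ver1: "unif_approx R K (ver x)" if "x \<in> G - right ` G" for x
  proof -
    obtain i j where x: "x = (i, j)" by force
    have "(i - 1, j) \<notin> G" using that by (force simp: x right_def)
    then show ?thesis
      using edge[of "c i j" i j "c i (j + 1)" "i - 1" j] corner[of i j] corner[of "i - 1" j] that
      by (simp add: x ver_def[abs_def])
  qed
  have ver2: "unif_approx R K (ver x)" if "x \<in> right ` G - G" for x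
  proof -
    from that obtain i j where x: "x = (i + 1, j)" "(i, j) \<in> G" "(i + 1, j) \<notin> G" by (auto simp: right_def)
    then show ?thesis
      using edge[of "c (i + 1) j" i j "c (i + 1) (j + 1)" "i + 1" j] corner[of i j] corner[of "i + 1" j]
      by (simp add: ver_def[abs_def])
  qed
  have "unif_approx R K (\<lambda>z. 1 / (2 * pi * \<i>) *
      (((\<Sum>x\<in>G - up ` G. hor x z) + (-1) * (\<Sum>x\<in>up ` G - G. hor x z)) +
      ((\<Sum>x\<in>right ` G - G. ver x z) + (-1) * (\<Sum>x\<in>G - right ` G. ver x z))))"
    by (intro unif_approx_cmult[OF R] unif_approx_add[OF R] unif_approx_sum[OF R] hor1 hor2 ver1 ver2)
  then have "unif_approx R K (\<lambda>z. 1 / (2 * pi * \<i>) * (\<Sum>x\<in>G. hor x z + ver (right x) z - hor (up x) z - ver x z))"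
    by (simp only: split)
  moreover have "1 / (2 * pi * \<i>) * (\<Sum>x\<in>G. hor x z + ver (right x) z - hor (up x) z - ver x z) = h z"
    if "z \<in> S" for z
    by (simp add: square[OF that])
  ultimately have "unif_approx R S h"
    unfolding unif_approx_def S_def by (metis (no_types, lifting) mem_Collect_eq)
  then show ?thesis using that[of \<delta>] \<open>0 < \<delta>\<close> unfolding S_def by blast
qed

section \<open>Stability of the approximation error\<close>

text \<open>Since numerator and denominator have no common zero, every zero of the denominator is a
  pole and makes the error infinite. The equivalence removes \<open>remove_sings\<close> and
  \<open>is_pole\<close> from the stability argument.\<close>

lemma pade_error_lt_iff:
  assumes f: "f \<in> pade_D \<Omega> p q \<zeta>" and "0 < e"
  defines "a \<equiv> taylor_coeff \<Omega> f \<zeta>"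
  shows "pade_error \<Omega> f \<zeta> p q l z < ennreal e \<longleftrightarrow> poly (pade_den a p q) (z - \<zeta>) \<noteq> 0 \<and>
    norm ((deriv ^^ l) (\<lambda>z. poly (pade_num a p q) (z - \<zeta>) / poly (pade_den a p q) (z - \<zeta>)) z -
      ext_deriv \<Omega> l f z) < e"
proof -
  have hankel: "hankel_det a p q \<noteq> 0" using f by (simp add: pade_D_def a_def)
  show ?thesis
  proof (cases "poly (pade_den a p q) (z - \<zeta>) = 0")
    case True
    have "pade_den a p q \<noteq> 0" by (metis coeff_pade_den_0 coeff_0 zero_neq_one)
    then have "is_pole (pade \<Omega> f \<zeta> p q) z"
      using is_pole_remove_sings_rational[OF _ True] pade_num_den_no_common_zero[OF hankel True]
      by (simp add: pade_eq[OF f] a_def)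
    then show ?thesis using True by (simp add: pade_error_def)
  next
    case False
    then show ?thesis
      using remove_sings_rational[OF False] \<open>0 < e\<close>
      by (simp add: pade_error_def pade_eq[OF f] ennreal_less_iff flip: a_def)
  qed
qed

text \<open>On a compact neighbourhood of \<open>K\<close> the limiting denominator is still bounded
  away from 0. So the nearby denominators have no zeros there and the quotients converge uniformly,
  and Cauchy's estimates pass this on to the derivatives on \<open>K\<close>.\<close>

lemma uniform_limit_pade:
  assumes a: "\<And>v. (\<lambda>n. A n v) \<longlonglongrightarrow> a v" and hankel: "hankel_det a p q \<noteq> 0"
    and K: "compact K" "\<And>z. z \<in> K \<Longrightarrow> poly (pade_den a p q) (z - \<zeta>) \<noteq> 0"
  defines "R \<equiv> \<lambda>b z. poly (pade_num b p q) (z - \<zeta>) / poly (pade_den b p q) (z - \<zeta>)"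
  shows "\<forall>\<^sub>F n in sequentially. \<forall>z\<in>K. poly (pade_den (A n) p q) (z - \<zeta>) \<noteq> 0"
    and "uniform_limit K (\<lambda>n. (deriv ^^ l) (R (A n))) ((deriv ^^ l) (R a)) sequentially"
proof -
  let ?S = "{z. poly (pade_den a p q) (z - \<zeta>) \<noteq> 0}"
  have "open ?S" by (intro open_Collect_neq continuous_intros)
  then obtain r where r: "0 < r" "(\<Union>x\<in>K. cball x r) \<subseteq> ?S"
    using compact_subset_open_imp_cball_epsilon_subset[OF K(1), of ?S] K(2) by auto
  \<comment> \<open>The closed \<open>r\<close>-neighbourhood of \<open>K\<close>, as a sum of
    compact sets so that its compactness is immediate.\<close>
  define L where "L = {x + y |x y. x \<in> K \<and> y \<in> cball 0 r}"
  have "compact L" unfolding L_def using K(1) by (intro compact_sums) auto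
  have cball: "cball z r \<subseteq> L" if "z \<in> K" for z
  proof
    fix w assume "w \<in> cball z r"
    then have "w = z + (w - z) \<and> z \<in> K \<and> w - z \<in> cball 0 r"
      using that by (auto simp: dist_norm norm_minus_commute)
    then show "w \<in> L" unfolding L_def by blast
  qed
  have "L \<subseteq> ?S"
  proof
    fix w assume "w \<in> L"
    then obtain x y where "w = x + y" "x \<in> K" "y \<in> cball 0 r" unfolding L_def by blast
    then have "w \<in> (\<Union>x\<in>K. cball x r)" by (auto simp: dist_norm intro!: bexI[of _ x])
    then show "w \<in> ?S" using r(2) by blast
  qed
  have "\<exists>b>0. \<forall>z\<in>L. b \<le> norm (poly (pade_den a p q) (z - \<zeta>))"
  proof (cases "L = {}")
    case False
    have "continuous_on L (\<lambda>z. norm (poly (pade_den a p q) (z - \<zeta>)))"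
      by (intro continuous_intros)
    then obtain w where "w \<in> L" "\<forall>z\<in>L. norm (poly (pade_den a p q) (w - \<zeta>)) \<le> norm (poly (pade_den a p q) (z - \<zeta>))"
      using continuous_attains_inf[OF \<open>compact L\<close> False] by blast
    then show ?thesis using \<open>L \<subseteq> ?S\<close> by (intro exI[of _ "norm (poly (pade_den a p q) (w - \<zeta>))"]) auto
  qed (auto intro: exI[of _ 1])
  then obtain b where b: "0 < b" "\<And>z. z \<in> L \<Longrightarrow> b \<le> norm (poly (pade_den a p q) (z - \<zeta>))"
    by blast
  have bdd: "bounded L" using \<open>compact L\<close> by (rule compact_imp_bounded)
  have den: "uniform_limit L (\<lambda>n z. poly (pade_den (A n) p q) (z - \<zeta>)) (\<lambda>z. poly (pade_den a p q) (z - \<zeta>)) sequentially"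
    by (rule uniform_limit_poly[OF degree_pade_den degree_pade_den tendsto_pade_den[OF a hankel] bdd])
  have num: "uniform_limit L (\<lambda>n z. poly (pade_num (A n) p q) (z - \<zeta>)) (\<lambda>z. poly (pade_num a p q) (z - \<zeta>)) sequentially"
    by (rule uniform_limit_poly[OF degree_pade_num degree_pade_num tendsto_pade_num[OF a hankel] bdd])
  have nz: "\<forall>\<^sub>F n in sequentially. \<forall>z\<in>L. poly (pade_den (A n) p q) (z - \<zeta>) \<noteq> 0"
    using uniform_limitD[OF den b(1)]
  proof eventually_elim
    case (elim n)
    show ?case
    proof (intro ballI notI)
      fix z assume z: "z \<in> L" "poly (pade_den (A n) p q) (z - \<zeta>) = 0"
      show False using elim z b(2)[OF z(1)] by (auto simp: dist_norm)
    qed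
  qed
  have "z \<in> L" if "z \<in> K" for z using cball[OF that] r(1) by auto
  then show "\<forall>\<^sub>F n in sequentially. \<forall>z\<in>K. poly (pade_den (A n) p q) (z - \<zeta>) \<noteq> 0"
    using nz by (auto elim: eventually_mono)
  show "uniform_limit K (\<lambda>n. (deriv ^^ l) (R (A n))) ((deriv ^^ l) (R a)) sequentially"
  proof (rule uniform_limit_higher_deriv[OF r(1) cball])
    have "bounded ((\<lambda>z. poly (pade_num a p q) (z - \<zeta>)) ` L)"
      by (intro compact_imp_bounded compact_continuous_image continuous_intros \<open>compact L\<close>)
    then show "uniform_limit L (\<lambda>n. R (A n)) (R a) sequentially"
      unfolding R_def by (rule uniform_lim_divide[OF num den _ b(2,1)])
    show "R a analytic_on L" unfolding R_def using \<open>L \<subseteq> ?S\<close> by (intro rational_analytic) auto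
    show "\<forall>\<^sub>F n in sequentially. R (A n) analytic_on L"
      using nz by eventually_elim (auto simp: R_def intro!: rational_analytic)
  qed
qed

text \<open>By compactness the maximum of \<open>norm (g z)\<close> leaves a positive gap below
  \<open>e\<close>, and uniform convergence eventually stays within it.\<close>

lemma uniform_limit_eventually_less:
  fixes h :: "'a \<Rightarrow> 'b :: topological_space \<Rightarrow> complex"
  assumes lim: "uniform_limit K h g F" and "compact K" "continuous_on K g" "\<And>z. z \<in> K \<Longrightarrow> norm (g z) < e"
  shows "\<forall>\<^sub>F n in F. \<forall>z\<in>K. norm (h n z) < e"
proof (cases "K = {}")
  case False
  have "continuous_on K (\<lambda>z. norm (g z))" using assms(3) by (intro continuous_intros)
  then obtain w where w: "w \<in> K" "\<forall>z\<in>K. norm (g z) \<le> norm (g w)"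
    using continuous_attains_sup[OF assms(2) False] by blast
  then have "0 < e - norm (g w)" using assms(4) by simp
  from uniform_limitD[OF lim this] show ?thesis
  proof eventually_elim
    case (elim n)
    show ?case
    proof
      fix z assume z: "z \<in> K"
      have "norm (h n z) \<le> norm (h n z - g z) + norm (g z)" by norm
      also have "\<dots> < e" using elim z w(2) by (force simp: dist_norm)
      finally show "norm (h n z) < e" .
    qed
  qed
qed simp

text \<open>Openness of the approximation condition in sequential form. The Taylor coefficients at
  \<zeta> converge because \<open>{\<zeta>}\<close> is itself a compact subset of
  \<open>closure \<Omega>\<close>, also when \<zeta> is a boundary point.\<close>

lemma pade_error_eventually_less:
  assumes "open \<Omega>" and \<zeta>: "\<zeta> \<in> closure \<Omega>" and K: "compact K" "K \<subseteq> closure \<Omega>" and "0 < e"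
    and f: "f \<in> pade_D \<Omega> p q \<zeta>" and g: "\<And>n. g n \<in> A_inf \<Omega>"
    and lim: "\<And>l K. compact K \<Longrightarrow> K \<subseteq> closure \<Omega> \<Longrightarrow>
      uniform_limit K (\<lambda>n. ext_deriv \<Omega> l (g n)) (ext_deriv \<Omega> l f) sequentially"
    and err: "\<And>l z. l \<le> m \<Longrightarrow> z \<in> K \<Longrightarrow> pade_error \<Omega> f \<zeta> p q l z < ennreal e"
  shows "\<forall>\<^sub>F n in sequentially. g n \<in> pade_D \<Omega> p q \<zeta> \<and>
    (\<forall>l\<le>m. \<forall>z\<in>K. pade_error \<Omega> (g n) \<zeta> p q l z < ennreal e)"
proof -
  let ?a = "taylor_coeff \<Omega> f \<zeta>" and ?A = "\<lambda>n. taylor_coeff \<Omega> (g n) \<zeta>"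
  let ?R = "\<lambda>b z. poly (pade_num b p q) (z - \<zeta>) / poly (pade_den b p q) (z - \<zeta>)"
  have fA: "f \<in> A_inf \<Omega>" and hankel: "hankel_det ?a p q \<noteq> 0" using f by (simp_all add: pade_D_def)
  have a: "(\<lambda>n. ?A n v) \<longlonglongrightarrow> ?a v" for v
  proof -
    have "(\<lambda>n. ext_deriv \<Omega> v (g n) \<zeta>) \<longlonglongrightarrow> ext_deriv \<Omega> v f \<zeta>"
      using tendsto_uniform_limitI[OF lim[of "{\<zeta>}" v]] \<zeta> by simp
    then show ?thesis unfolding taylor_coeff_def by (intro tendsto_intros) auto
  qed
  have ev: "\<forall>\<^sub>F n in sequentially. hankel_det (?A n) p q \<noteq> 0"
    using tendsto_hankel_det[OF a] hankel by (rule tendsto_imp_eventually_ne)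
  have den: "poly (pade_den ?a p q) (z - \<zeta>) \<noteq> 0" if "z \<in> K" for z
    using err[OF _ that, of 0] pade_error_lt_iff[OF f \<open>0 < e\<close>] by simp
  have "\<forall>\<^sub>F n in sequentially. \<forall>z\<in>K. norm ((deriv ^^ l) (?R (?A n)) z - ext_deriv \<Omega> l (g n) z) < e"
    if "l \<le> m" for l
  proof (rule uniform_limit_eventually_less[OF _ K(1)])
    show "uniform_limit K (\<lambda>n z. (deriv ^^ l) (?R (?A n)) z - ext_deriv \<Omega> l (g n) z)
        (\<lambda>z. (deriv ^^ l) (?R ?a) z - ext_deriv \<Omega> l f z) sequentially"
      by (intro uniform_limit_minus uniform_limit_pade(2) a hankel K den lim)
    have "(deriv ^^ l) (?R ?a) analytic_on K"
      using den by (intro analytic_higher_deriv rational_analytic) auto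
    then show "continuous_on K (\<lambda>z. (deriv ^^ l) (?R ?a) z - ext_deriv \<Omega> l f z)"
      using continuous_on_subset[OF continuous_on_ext_deriv[OF \<open>open \<Omega>\<close> fA] K(2)]
      by (intro continuous_on_diff) (auto intro: analytic_imp_holomorphic holomorphic_on_imp_continuous_on)
    show "norm ((deriv ^^ l) (?R ?a) z - ext_deriv \<Omega> l f z) < e" if "z \<in> K" for z
      using err[OF \<open>l \<le> m\<close> that] pade_error_lt_iff[OF f \<open>0 < e\<close>] by simp
  qed
  then have "\<forall>\<^sub>F n in sequentially. \<forall>l\<in>{..m}. \<forall>z\<in>K.
      norm ((deriv ^^ l) (?R (?A n)) z - ext_deriv \<Omega> l (g n) z) < e"
    by (intro eventually_ball_finite) auto
  moreover have "\<forall>\<^sub>F n in sequentially. \<forall>z\<in>K. poly (pade_den (?A n) p q) (z - \<zeta>) \<noteq> 0"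
    by (rule uniform_limit_pade(1)[OF a hankel K(1) den])
  ultimately show ?thesis using ev
  proof eventually_elim
    case (elim n)
    then have D: "g n \<in> pade_D \<Omega> p q \<zeta>" using g by (simp add: pade_D_def)
    with elim show ?case by (auto simp: pade_error_lt_iff[OF D \<open>0 < e\<close>])
  qed
qed

section \<open>Runge approximation\<close>

text \<open>Only the values on \<open>T\<close> are prescribed. The variable
  \<open>z - \<zeta>\<close> matches the form of the Pade approximants.\<close>

definition rational_on :: "complex \<Rightarrow> complex set \<Rightarrow> (complex \<Rightarrow> complex) set" where
  "rational_on \<zeta> T = {g. \<exists>A B. \<forall>z\<in>T. poly B (z - \<zeta>) \<noteq> 0 \<and> g z = poly A (z - \<zeta>) / poly B (z - \<zeta>)}"

lemma rational_onI:
  assumes "\<And>z. z \<in> T \<Longrightarrow> poly B (z - \<zeta>) \<noteq> 0" "\<And>z. z \<in> T \<Longrightarrow> g z = poly A (z - \<zeta>) / poly B (z - \<zeta>)"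
  shows "g \<in> rational_on \<zeta> T"
  using assms unfolding rational_on_def by blast

lemma fun_subspace_rational_on: "fun_subspace (rational_on \<zeta> T)"
  unfolding fun_subspace_def
proof (intro conjI ballI allI)
  show "(\<lambda>_. 0) \<in> rational_on \<zeta> T"
    by (rule rational_onI[of T 1 _ _ 0]) auto
  fix r assume "r \<in> rational_on \<zeta> T"
  then obtain A B where r: "\<And>z. z \<in> T \<Longrightarrow> poly B (z - \<zeta>) \<noteq> 0"
    "\<And>z. z \<in> T \<Longrightarrow> r z = poly A (z - \<zeta>) / poly B (z - \<zeta>)"
    unfolding rational_on_def by blast
  show "(\<lambda>z. c * r z) \<in> rational_on \<zeta> T" for c
    by (rule rational_onI[of T B _ _ "Polynomial.smult c A"]) (auto simp: r)
  fix s assume "s \<in> rational_on \<zeta> T"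
  then obtain C D where s: "\<And>z. z \<in> T \<Longrightarrow> poly D (z - \<zeta>) \<noteq> 0"
    "\<And>z. z \<in> T \<Longrightarrow> s z = poly C (z - \<zeta>) / poly D (z - \<zeta>)"
    unfolding rational_on_def by blast
  show "(\<lambda>z. r z + s z) \<in> rational_on \<zeta> T"
    by (rule rational_onI[of T "B * D" _ _ "A * D + C * B"]) (auto simp: r s add_frac_eq)
qed

lemma unif_approx_kernel_pole:
  assumes "w \<notin> T"
  shows "unif_approx (rational_on \<zeta> T) K (\<lambda>z. 1 / (w - z))"
proof -
  have "(\<lambda>z. 1 / (w - z)) \<in> rational_on \<zeta> T"
    by (rule rational_onI[of T "[:w - \<zeta>, - 1:]" _ _ 1]) (use assms in auto)
  then show ?thesis unfolding unif_approx_def by (auto intro!: bexI)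
qed

text \<open>Partial sums of the geometric series are polynomials, so the approximants have no poles
  at all, even if \<open>w\<close> belongs to \<open>T\<close>.\<close>

lemma unif_approx_kernel_far:
  assumes "0 \<le> \<rho>" "\<rho> < norm w" "K \<subseteq> cball 0 \<rho>"
  shows "unif_approx (rational_on \<zeta> T) K (\<lambda>z. 1 / (w - z))"
  unfolding unif_approx_def
proof (intro allI impI)
  fix e :: real assume "0 < e"
  have "w \<noteq> 0" using assms(1,2) by auto
  have "(\<lambda>n. (\<rho> / norm w) ^ n) \<longlonglongrightarrow> 0"
    using assms(1,2) by (intro LIMSEQ_realpow_zero) (auto simp: divide_simps)
  moreover have "0 < e * (norm w - \<rho>)" using \<open>0 < e\<close> assms(2) by simp
  ultimately have "\<forall>\<^sub>F n in sequentially. (\<rho> / norm w) ^ n < e * (norm w - \<rho>)"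
    by (rule order_tendstoD)
  \<comment> \<open>The remainder of the geometric series after \<open>n\<close> terms is at most
    \<open>(\<rho> / norm w) ^ n / (norm w - \<rho>)\<close>.\<close>
  then obtain n where n: "(\<rho> / norm w) ^ n < e * (norm w - \<rho>)"
    by (auto simp: eventually_sequentially)
  define A where "A = pcompose (\<Sum>k<n. Polynomial.monom (1 / w ^ Suc k) k) [:\<zeta>, 1:]"
  have A: "poly A (z - \<zeta>) = (\<Sum>k<n. z ^ k / w ^ Suc k)" for z
    by (simp add: A_def poly_pcompose poly_sum poly_monom)
  show "\<exists>r\<in>rational_on \<zeta> T. \<forall>z\<in>K. norm (1 / (w - z) - r z) \<le> e"
  proof (intro bexI[of _ "\<lambda>z. poly A (z - \<zeta>)"] ballI)
    show "(\<lambda>z. poly A (z - \<zeta>)) \<in> rational_on \<zeta> T"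
      by (rule rational_onI[of T 1 _ _ A]) auto
    fix z assume "z \<in> K"
    then have z: "norm z \<le> \<rho>" using assms(3) by auto
    have "w - z \<noteq> 0" using z assms(2) by auto
    define G where "G = (\<Sum>k<n. (z / w) ^ k)"
    have "poly A (z - \<zeta>) = G / w"
      by (simp add: A G_def sum_divide_distrib power_divide mult.commute)
    then have "(w - z) * poly A (z - \<zeta>) = (1 - z / w) * G"
      using \<open>w \<noteq> 0\<close> by (simp add: field_simps)
    also have "\<dots> = 1 - (z / w) ^ n"
      unfolding G_def by (rule one_diff_power_eq[symmetric])
    finally have "1 / (w - z) - poly A (z - \<zeta>) = (z / w) ^ n / (w - z)"
      using \<open>w - z \<noteq> 0\<close> by (simp add: divide_simps mult.commute)
    then have "norm (1 / (w - z) - poly A (z - \<zeta>)) = (norm z / norm w) ^ n / norm (w - z)"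
      by (simp add: norm_divide norm_power)
    also have "\<dots> \<le> (\<rho> / norm w) ^ n / (norm w - \<rho>)"
    proof (rule frac_le)
      show "(norm z / norm w) ^ n \<le> (\<rho> / norm w) ^ n"
        using z by (intro power_mono divide_right_mono) auto
      show "norm w - \<rho> \<le> norm (w - z)" using z norm_triangle_ineq2[of w z] by linarith
    qed (use assms in auto)
    also have "\<dots> \<le> e" using n assms(2) by (simp add: pos_divide_le_eq)
    finally show "norm (1 / (w - z) - poly A (z - \<zeta>)) \<le> e" .
  qed
qed

text \<open>A short move along the diagonal leaves the horizontal and the vertical grid lines at
  once: each coordinate ends strictly between its lower grid value and the next one.\<close>

lemma off_grid_tendsto:
  fixes z :: complex
  assumes "0 < \<delta>"
  defines "f \<equiv> \<lambda>t. z + of_real t * Complex 1 1"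
  shows "(f \<longlongrightarrow> z) (at_right 0)"
    and "\<forall>\<^sub>F t in at_right 0. \<forall>i::int. Re (f t) \<noteq> \<delta> * i \<and> Im (f t) \<noteq> \<delta> * i"
proof -
  have "(f \<longlongrightarrow> z + of_real 0 * Complex 1 1) (at_right 0)"
    unfolding f_def by (intro tendsto_intros)
  then show "(f \<longlongrightarrow> z) (at_right 0)" by simp
  have *: "\<forall>\<^sub>F t in at_right 0. \<forall>i::int. x + t \<noteq> \<delta> * i" for x
  proof -
    define j where "j = \<lfloor>x / \<delta>\<rfloor>"
    have j: "\<delta> * j \<le> x" "x < \<delta> * j + \<delta>"
      using floor_divide_lower[OF assms(1), of x] floor_divide_upper[OF assms(1), of x]
      by (simp_all add: j_def algebra_simps)
    have "\<forall>\<^sub>F t in at_right 0. t \<in> {0<..<\<delta> * j + \<delta> - x}"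
      by (rule eventually_at_right_real) (use j in simp)
    then show ?thesis
    proof eventually_elim
      case (elim t)
      show ?case
      proof (intro allI notI)
        fix i :: int assume "x + t = \<delta> * i"
        moreover have "0 < t" "t < \<delta> * j + \<delta> - x" using elim by auto
        ultimately have "\<delta> * j < \<delta> * i" "\<delta> * i < \<delta> * j + \<delta>" using j(1) by linarith+
        then have "\<delta> * of_int j < \<delta> * of_int i" "\<delta> * of_int i < \<delta> * of_int (j + 1)"
          by (simp_all add: algebra_simps)
        then show False using assms(1) by (simp only: mult_less_cancel_left_pos of_int_less_iff)
      qed
    qed
  qed
  from *[of "Re z"] *[of "Im z"]
  show "\<forall>\<^sub>F t in at_right 0. \<forall>i::int. Re (f t) \<noteq> \<delta> * i \<and> Im (f t) \<noteq> \<delta> * i"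
    by eventually_elim (auto simp: f_def)
qed

text \<open>
  Runge's theorem on \<open>S \<inter> cball 0 N\<close>, with no poles on all of \<open>S\<close>: the grid is taken around
  \<open>S \<inter> cball 0 (N + 2)\<close>, so that every kernel \<open>1 / (w - z)\<close> of the Cauchy integral has its pole
  outside \<open>S\<close> or so far away that it can be expanded into a power series.
\<close>

lemma runge:
  fixes S V :: "complex set" and N :: nat
  assumes "closed S" "open V" "S \<subseteq> V" "h holomorphic_on V" "0 < e"
  shows "\<exists>A B. (\<forall>z\<in>S. poly B (z - \<zeta>) \<noteq> 0) \<and> (\<forall>l\<le>m. \<forall>z\<in>S \<inter> cball 0 N.
    dist ((deriv ^^ l) (\<lambda>z. poly A (z - \<zeta>) / poly B (z - \<zeta>)) z) ((deriv ^^ l) h z) < e)"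
proof -
  define C where "C = S \<inter> cball 0 (real N + 2)"
  have "compact C" unfolding C_def using assms(1) by (rule closed_Int_compact) simp
  obtain r0 where r0: "0 < r0" "(\<Union>x\<in>C. cball x r0) \<subseteq> V"
    using compact_subset_open_imp_cball_epsilon_subset[OF \<open>compact C\<close> assms(2)] assms(3)
    by (auto simp: C_def)
  \<comment> \<open>\<open>r \<le> r0\<close> keeps \<open>L\<close> inside \<open>V\<close>;
    \<open>r \<le> 1\<close> keeps the discs around points of norm at most \<open>N\<close> inside
    \<open>cball 0 (N + 1)\<close>.\<close>
  define r where "r = min r0 1"
  have r: "0 < r" "r \<le> 1" "r \<le> r0" using r0(1) by (auto simp: r_def)
  define L where "L = {x + y |x y. x \<in> C \<and> y \<in> cball 0 r}"
  have "compact L" unfolding L_def by (intro compact_sums \<open>compact C\<close> compact_cball)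
  have L: "L = (\<Union>x\<in>C. cball x r)"
  proof (intro equalityI subsetI)
    fix w assume "w \<in> L"
    then obtain x y where "w = x + y" "x \<in> C" "y \<in> cball 0 r" unfolding L_def by blast
    then show "w \<in> (\<Union>x\<in>C. cball x r)" by (auto simp: dist_norm intro!: bexI[of _ x])
  next
    fix w assume "w \<in> (\<Union>x\<in>C. cball x r)"
    then obtain x where "x \<in> C" "w \<in> cball x r" by blast
    then have "w = x + (w - x) \<and> x \<in> C \<and> w - x \<in> cball 0 r"
      by (auto simp: dist_norm norm_minus_commute)
    then show "w \<in> L" unfolding L_def by blast
  qed
  have "L \<subseteq> V" using L r(3) r0(2) by force
  define K where "K = L \<inter> cball 0 (real N + 1)"
  have "compact K" "K \<subseteq> L" unfolding K_def using \<open>compact L\<close> by auto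
  \<comment> \<open>Poles are kept off \<open>L\<close> as well as off \<open>S\<close>, so that the
    approximants are analytic on \<open>interior K\<close>, where their derivatives are
    estimated.\<close>
  define R where "R = rational_on \<zeta> (S \<union> L)"
  have R: "fun_subspace R" unfolding R_def by (rule fun_subspace_rational_on)
  have w: "unif_approx R K (\<lambda>z. 1 / (w - z))" if "w \<in> V - L" for w
  proof (cases "w \<in> S")
    case True
    \<comment> \<open>As \<open>C \<subseteq> L\<close>, a point of \<open>S\<close> off
      \<open>L\<close> has norm above \<open>N + 2\<close>, whereas \<open>K\<close> lies in
      \<open>cball 0 (N + 1)\<close>.\<close>
    have "w \<notin> C" using that r(1) by (auto simp: L)
    with True have "real N + 2 < norm w" by (simp add: C_def)
    then show ?thesis
      unfolding R_def K_def by (intro unif_approx_kernel_far[of "real N + 1"]) auto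
  next
    case False
    then show ?thesis unfolding R_def using that by (intro unif_approx_kernel_pole) auto
  qed
  obtain \<delta> where \<delta>: "0 < \<delta>" "unif_approx R {z \<in> K. \<forall>i::int. Re z \<noteq> \<delta> * i \<and> Im z \<noteq> \<delta> * i} h"
    using unif_approx_off_grid[OF R \<open>compact L\<close> \<open>L \<subseteq> V\<close> assms(2,4) \<open>compact K\<close> \<open>K \<subseteq> L\<close> w] by blast
  \<comment> \<open>An interior point is a limit of points of \<open>K\<close> off the grid lines,
    and \<open>h\<close> and the rational functions are continuous there, so the bound extends
    without loss.\<close>
  have "unif_approx R (interior K) h"
    unfolding unif_approx_def
  proof (intro allI impI)
    fix d :: real assume "0 < d"
    obtain g where g: "g \<in> R"
      "\<And>z. z \<in> {z \<in> K. \<forall>i::int. Re z \<noteq> \<delta> * i \<and> Im z \<noteq> \<delta> * i} \<Longrightarrow> norm (h z - g z) \<le> d"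
      using unif_approxD[OF \<delta>(2) \<open>0 < d\<close>] by blast
    obtain A B where AB: "\<And>z. z \<in> S \<union> L \<Longrightarrow> poly B (z - \<zeta>) \<noteq> 0"
      "\<And>z. z \<in> S \<union> L \<Longrightarrow> g z = poly A (z - \<zeta>) / poly B (z - \<zeta>)"
      using g(1) unfolding R_def rational_on_def by blast
    show "\<exists>g\<in>R. \<forall>z\<in>interior K. norm (h z - g z) \<le> d"
    proof (intro bexI[OF _ g(1)] ballI)
      fix z assume z: "z \<in> interior K"
      define f where "f = (\<lambda>t. z + of_real t * Complex 1 1)"
      have f: "(f \<longlongrightarrow> z) (at_right 0)"
        unfolding f_def by (rule off_grid_tendsto(1)[OF \<delta>(1)])
      have "continuous_on (interior K) (\<lambda>z. h z - poly A (z - \<zeta>) / poly B (z - \<zeta>))"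
      proof (intro continuous_intros)
        show "continuous_on (interior K) h"
          using holomorphic_on_imp_continuous_on[OF assms(4)] interior_subset \<open>K \<subseteq> L\<close> \<open>L \<subseteq> V\<close>
          by (meson continuous_on_subset subset_trans)
      qed (use AB(1) interior_subset \<open>K \<subseteq> L\<close> in blast)
      then have cont: "isCont (\<lambda>z. h z - poly A (z - \<zeta>) / poly B (z - \<zeta>)) z"
        using z by (simp add: continuous_on_eq_continuous_at)
      have "((\<lambda>t. norm (h (f t) - poly A (f t - \<zeta>) / poly B (f t - \<zeta>))) \<longlongrightarrow>
          norm (h z - poly A (z - \<zeta>) / poly B (z - \<zeta>))) (at_right 0)"
        using isCont_tendsto_compose[OF cont f] by (rule tendsto_norm)
      moreover have "\<forall>\<^sub>F t in at_right 0. norm (h (f t) - poly A (f t - \<zeta>) / poly B (f t - \<zeta>)) \<le> d"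
        using topological_tendstoD[OF f open_interior z] off_grid_tendsto(2)[OF \<delta>(1), of z]
      proof eventually_elim
        case (elim t)
        then have "f t \<in> K" using interior_subset by blast
        then show ?case
          using g(2)[of "f t"] AB(2)[of "f t"] elim(2) \<open>K \<subseteq> L\<close> by (auto simp: f_def)
      qed
      ultimately have "norm (h z - poly A (z - \<zeta>) / poly B (z - \<zeta>)) \<le> d"
        by (rule tendsto_upperbound) simp
      moreover have "z \<in> L" using z interior_subset \<open>K \<subseteq> L\<close> by blast
      ultimately show "norm (h z - g z) \<le> d" using AB(2) by simp
    qed
  qed
  then have "\<exists>g\<in>R. \<forall>z\<in>interior K. norm (h z - g z) \<le> 1 / Suc n" for n
    unfolding unif_approx_def by simp
  then obtain g where g: "\<And>n. g n \<in> R" "\<And>n z. z \<in> interior K \<Longrightarrow> norm (h z - g n z) \<le> 1 / Suc n"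
    by metis
  from g(1) have "\<exists>A B. \<forall>z\<in>S \<union> L. poly B (z - \<zeta>) \<noteq> 0 \<and> g n z = poly A (z - \<zeta>) / poly B (z - \<zeta>)" for n
    unfolding R_def rational_on_def by blast
  then obtain A B where AB: "\<And>n z. z \<in> S \<union> L \<Longrightarrow> poly (B n) (z - \<zeta>) \<noteq> 0"
    "\<And>n z. z \<in> S \<union> L \<Longrightarrow> g n z = poly (A n) (z - \<zeta>) / poly (B n) (z - \<zeta>)"
    by metis
  have KL: "interior K \<subseteq> L" using interior_subset \<open>K \<subseteq> L\<close> by blast
  let ?g = "\<lambda>n z. poly (A n) (z - \<zeta>) / poly (B n) (z - \<zeta>)"
  have lim: "uniform_limit (interior K) ?g h sequentially"
  proof (rule uniform_limitI)
    fix d :: real assume "0 < d"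
    then have "\<forall>\<^sub>F n in sequentially. 1 / Suc n < d"
      using order_tendstoD(2)[OF LIMSEQ_Suc[OF lim_1_over_n]] by simp
    then show "\<forall>\<^sub>F n in sequentially. \<forall>z\<in>interior K. dist (?g n z) (h z) < d"
    proof eventually_elim
      case (elim n)
      show ?case
      proof
        fix z assume "z \<in> interior K"
        with g(2)[OF this, of n] AB(2)[of z n] KL elim show "dist (?g n z) (h z) < d"
          by (auto simp: dist_norm norm_minus_commute)
      qed
    qed
  qed
  have cb: "cball z (r / 2) \<subseteq> interior K" if "z \<in> S \<inter> cball 0 (real N)" for z
  proof -
    have "ball z r \<subseteq> K"
    proof
      fix w assume w: "w \<in> ball z r"
      have "z \<in> C" using that by (auto simp: C_def)
      then have "w \<in> L" using w by (auto simp: L intro!: bexI[of _ z])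
      moreover have "norm w \<le> norm z + norm (w - z)" by norm
      then have "norm w \<le> real N + 1" using w that r(2) by (auto simp: dist_norm norm_minus_commute)
      ultimately show "w \<in> K" by (simp add: K_def)
    qed
    then have "ball z r \<subseteq> interior K" by (rule interior_maximal) simp
    then show ?thesis using r(1) by force
  qed
  have "uniform_limit (S \<inter> cball 0 (real N)) (\<lambda>n. (deriv ^^ l) (?g n)) ((deriv ^^ l) h) sequentially" for l
  proof (rule uniform_limit_higher_deriv[OF _ cb lim])
    show "0 < r / 2" using r(1) by simp
    show "h analytic_on interior K"
      using assms(2,4) KL \<open>L \<subseteq> V\<close> analytic_on_open analytic_on_subset by blast
    show "\<forall>\<^sub>F n in sequentially. ?g n analytic_on interior K"
      using AB(1) KL by (intro always_eventually allI rational_analytic) auto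
  qed
  then have "\<forall>\<^sub>F n in sequentially. \<forall>l\<in>{..m}. \<forall>z\<in>S \<inter> cball 0 (real N).
      dist ((deriv ^^ l) (?g n) z) ((deriv ^^ l) h z) < e"
    using \<open>0 < e\<close> by (intro eventually_ball_finite) (auto dest: uniform_limitD)
  then obtain n where "\<forall>l\<in>{..m}. \<forall>z\<in>S \<inter> cball 0 (real N). dist ((deriv ^^ l) (?g n) z) ((deriv ^^ l) h z) < e"
    by (auto simp: eventually_sequentially)
  then show ?thesis using AB(1) by (intro exI[of _ "A n"] exI[of _ "B n"]) auto
qed

section \<open>Rational functions as their own Pade approximants\<close>

text \<open>The coefficient \<eta> of the added monomial has to avoid 0, for the degree, and the
  values \<open>- poly A w / w ^ p\<close> at the zeros \<open>w \<noteq> 0\<close> of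
  \<open>B\<close>, which would create common zeros. These are finitely many, so arbitrarily small
  \<eta> remain.\<close>

lemma rational_perturb:
  fixes A B :: "complex poly"
  assumes "compact K" and B: "\<And>z. z \<in> K \<Longrightarrow> poly B (z - \<zeta>) \<noteq> 0" "poly B 0 \<noteq> 0"
    and "degree A < p" "0 < e"
  shows "\<exists>A'. degree A' = p \<and> (\<forall>w. poly B w = 0 \<longrightarrow> poly A' w \<noteq> 0) \<and>
    (\<forall>l\<le>m. \<forall>z\<in>K. dist ((deriv ^^ l) (\<lambda>z. poly A' (z - \<zeta>) / poly B (z - \<zeta>)) z)
       ((deriv ^^ l) (\<lambda>z. poly A (z - \<zeta>) / poly B (z - \<zeta>)) z) < e)"
proof -
  let ?M = "Polynomial.monom 1 p :: complex poly"
  let ?g = "\<lambda>C z. poly C (z - \<zeta>) / poly B (z - \<zeta>)"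
  have an: "?g C analytic_on K" for C using B(1) by (rule rational_analytic)
  have "\<forall>\<^sub>F \<eta> in at 0. \<forall>z\<in>K. norm (\<eta> * (deriv ^^ l) (?g ?M) z) < e" for l
  proof -
    have "continuous_on K ((deriv ^^ l) (?g ?M))"
      by (intro holomorphic_on_imp_continuous_on analytic_imp_holomorphic analytic_higher_deriv an)
    then have "bounded ((deriv ^^ l) (?g ?M) ` K)"
      using assms(1) by (intro compact_imp_bounded compact_continuous_image)
    then obtain c where c: "0 < c" "\<And>z. z \<in> K \<Longrightarrow> norm ((deriv ^^ l) (?g ?M) z) \<le> c"
      by (auto simp: bounded_pos)
    have "((\<lambda>\<eta>::complex. norm \<eta> * c) \<longlongrightarrow> norm (0::complex) * c) (at 0)"
      by (intro tendsto_intros)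
    then have "\<forall>\<^sub>F \<eta> in at 0. norm (\<eta>::complex) * c < e"
      using \<open>0 < e\<close> by (intro order_tendstoD(2)) auto
    then show ?thesis
    proof eventually_elim
      case (elim \<eta>)
      show ?case
      proof
        fix z assume "z \<in> K"
        have "norm (\<eta> * (deriv ^^ l) (?g ?M) z) \<le> norm \<eta> * c"
          unfolding norm_mult using c(2)[OF \<open>z \<in> K\<close>] by (intro mult_left_mono) auto
        then show "norm (\<eta> * (deriv ^^ l) (?g ?M) z) < e" using elim by simp
      qed
    qed
  qed
  then have "\<forall>\<^sub>F \<eta> in at 0. \<forall>l\<in>{..m}. \<forall>z\<in>K. norm (\<eta> * (deriv ^^ l) (?g ?M) z) < e"
    by (intro eventually_ball_finite) auto
  moreover have "finite (insert 0 ((\<lambda>w. - poly A w / w ^ p) ` {w. poly B w = 0}))"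
    using B(2) by (intro finite.insertI finite_imageI poly_roots_finite) auto
  then have "\<forall>\<^sub>F \<eta> in at 0. \<eta> \<notin> insert 0 ((\<lambda>w. - poly A w / w ^ p) ` {w. poly B w = 0})"
    by (rule eventually_at_notin_finite)
  ultimately have "\<forall>\<^sub>F \<eta> in at 0. (\<forall>l\<in>{..m}. \<forall>z\<in>K. norm (\<eta> * (deriv ^^ l) (?g ?M) z) < e) \<and>
      \<eta> \<notin> insert 0 ((\<lambda>w. - poly A w / w ^ p) ` {w. poly B w = 0})"
    by (rule eventually_conj)
  then obtain \<eta> where \<eta>: "\<And>l z. l \<le> m \<Longrightarrow> z \<in> K \<Longrightarrow> norm (\<eta> * (deriv ^^ l) (?g ?M) z) < e"
    "\<eta> \<noteq> 0" "\<And>w. poly B w = 0 \<Longrightarrow> \<eta> \<noteq> - poly A w / w ^ p"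
    using eventually_happens'[of "at (0::complex)"] by fastforce
  define A' where "A' = A + Polynomial.smult \<eta> ?M"
  show ?thesis
  proof (intro exI[of _ A'] conjI allI impI ballI)
    have "degree (Polynomial.smult \<eta> ?M) = p" using \<eta>(2) by (simp add: degree_monom_eq)
    then show "degree A' = p" unfolding A'_def using assms(4) by (subst degree_add_eq_right) auto
    show "poly A' w \<noteq> 0" if w: "poly B w = 0" for w
    proof
      assume "poly A' w = 0"
      then have "\<eta> * w ^ p = - poly A w"
        by (simp add: A'_def poly_monom eq_neg_iff_add_eq_0 add.commute)
      moreover have "w \<noteq> 0" using w B(2) by auto
      ultimately have "\<eta> = - poly A w / w ^ p" by (simp add: field_simps)
      then show False using \<eta>(3)[OF w] by blast
    qed
    fix l z assume l: "l \<le> m" and z: "z \<in> K"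
    have anz: "?g C analytic_on {z}" for C using an z by (auto intro: analytic_on_subset)
    have "?g A' = (\<lambda>z. ?g A z + \<eta> * ?g ?M z)"
      by (auto simp: A'_def add_divide_distrib)
    then have "(deriv ^^ l) (?g A') z = (deriv ^^ l) (?g A) z + (deriv ^^ l) (\<lambda>z. \<eta> * ?g ?M z) z"
      by (simp only:) (intro higher_deriv_add_at anz analytic_on_mult analytic_on_const)
    also have "(deriv ^^ l) (\<lambda>z. \<eta> * ?g ?M z) z = \<eta> * (deriv ^^ l) (?g ?M) z"
      by (rule higher_deriv_cmult'[OF anz])
    finally show "dist ((deriv ^^ l) (?g A') z) ((deriv ^^ l) (?g A) z) < e"
      using \<eta>(1)[OF l z] by (simp add: dist_norm)
  qed
qed

lemma ext_deriv_restrict: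
  assumes "open \<Omega>" "open U" "closure \<Omega> \<subseteq> U" "h holomorphic_on U" "z \<in> closure \<Omega>"
  shows "ext_deriv \<Omega> l (restrict h \<Omega>) z = (deriv ^^ l) h z"
proof (rule ext_deriv_eqI[OF assms(1,5)])
  show "continuous_on (closure \<Omega>) ((deriv ^^ l) h)"
    using holomorphic_higher_deriv[OF assms(4,2)] assms(3)
    by (meson holomorphic_on_imp_continuous_on continuous_on_subset)
  fix w assume w: "w \<in> \<Omega>"
  have "\<forall>\<^sub>F u in nhds w. h u = restrict h \<Omega> u"
    using eventually_nhds_in_open[OF assms(1) w] by eventually_elim simp
  then show "(deriv ^^ l) h w = (deriv ^^ l) (restrict h \<Omega>) w"
    by (rule higher_deriv_cong_ev) simp
qed

text \<open>The identity \<open>B f = A\<close> holds to all orders, so it solves the Pade equations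
  for these degrees; by uniqueness the approximant is \<open>f\<close> itself and the error
  vanishes.\<close>

lemma rational_pade_exact:
  fixes A B :: "complex poly"
  assumes "open \<Omega>" "\<zeta> \<in> closure \<Omega>" and B: "\<And>z. z \<in> closure \<Omega> \<Longrightarrow> poly B (z - \<zeta>) \<noteq> 0"
    and "degree A = p" "0 < p" "degree B \<le> q" "\<And>w. poly B w = 0 \<Longrightarrow> poly A w \<noteq> 0"
  defines "f \<equiv> restrict (\<lambda>z. poly A (z - \<zeta>) / poly B (z - \<zeta>)) \<Omega>"
  shows "f \<in> hol_closure \<Omega>" "f \<in> pade_D \<Omega> p q \<zeta>"
    "\<And>l z. z \<in> closure \<Omega> \<Longrightarrow> ext_deriv \<Omega> l f z = (deriv ^^ l) (\<lambda>z. poly A (z - \<zeta>) / poly B (z - \<zeta>)) z"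
    "\<And>l z e. z \<in> closure \<Omega> \<Longrightarrow> 0 < e \<Longrightarrow> pade_error \<Omega> f \<zeta> p q l z < ennreal e"
proof -
  let ?g = "\<lambda>z. poly A (z - \<zeta>) / poly B (z - \<zeta>)"
  let ?U = "{z. poly B (z - \<zeta>) \<noteq> 0}"
  let ?a = "taylor_coeff \<Omega> f \<zeta>"
  have U: "open ?U" "closure \<Omega> \<subseteq> ?U" "?g holomorphic_on ?U"
    using B by (auto intro!: open_Collect_neq continuous_intros holomorphic_intros)
  show hc: "f \<in> hol_closure \<Omega>"
    unfolding f_def hol_closure_def using U by blast
  show ext: "ext_deriv \<Omega> l f z = (deriv ^^ l) ?g z" if "z \<in> closure \<Omega>" for l z
    unfolding f_def by (rule ext_deriv_restrict[OF assms(1) U that])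
  have B0: "poly.coeff B 0 \<noteq> 0" using B[OF assms(2)] by (simp add: poly_0_coeff_0)
  have "?a v = fps_nth (fps_of_poly A / fps_of_poly B) v" for v
    using taylor_rational[OF B0] by (simp add: taylor_coeff_def ext[OF assms(2)])
  then have a: "Abs_fps ?a = fps_of_poly A / fps_of_poly B" by (simp add: fps_eq_iff)
  have B0': "fps_nth (fps_of_poly B) 0 \<noteq> 0" using B0 by simp
  have Ba: "fps_of_poly B * Abs_fps ?a = fps_of_poly A"
  proof -
    have "fps_of_poly B * Abs_fps ?a = fps_of_poly A * (inverse (fps_of_poly B) * fps_of_poly B)"
      by (simp only: a fps_divide_unit[OF B0'] mult_ac)
    then show ?thesis by (simp only: inverse_mult_eq_1[OF B0'] mult_1_right)
  qed
  have hankel: "hankel_det ?a p q \<noteq> 0"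
  proof (rule hankel_det_rational[OF assms(4) _ assms(6) B0 assms(7)])
    show "A \<noteq> 0" using assms(4,5) by auto
    show "fps_nth (fps_of_poly B * Abs_fps ?a - fps_of_poly A) v = 0" for v by (simp add: Ba)
  qed
  then show D: "f \<in> pade_D \<Omega> p q \<zeta>"
    using hc hol_closure_subset_A_inf[OF assms(1)] by (auto simp: pade_D_def)
  \<comment> \<open>Rescaling by \<open>c\<close> gives the denominator the required constant
    coefficient 1.\<close>
  define c where "c = 1 / poly.coeff B 0"
  have "c \<noteq> 0" using B0 by (simp add: c_def)
  have "fps_of_poly (Polynomial.smult c A) - fps_of_poly (Polynomial.smult c B) * Abs_fps ?a = 0"
    by (simp only: fps_of_poly_smult mult.assoc Ba diff_self)
  then have "pade_form ?a p q (Polynomial.smult c A) (Polynomial.smult c B)"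
    using assms(4,6) \<open>c \<noteq> 0\<close> by (simp add: pade_form_fps_iff)
  moreover have "poly.coeff (Polynomial.smult c B) 0 = 1" using B0 by (simp add: c_def)
  ultimately have eq: "pade_num ?a p q = Polynomial.smult c A" "pade_den ?a p q = Polynomial.smult c B"
    using pade_form_eq_iff[OF hankel] by auto
  have "(\<lambda>z. poly (pade_num ?a p q) (z - \<zeta>) / poly (pade_den ?a p q) (z - \<zeta>)) = ?g"
    using \<open>c \<noteq> 0\<close> by (simp add: eq)
  then show "pade_error \<Omega> f \<zeta> p q l z < ennreal e" if "z \<in> closure \<Omega>" "0 < e" for l z e
    unfolding pade_error_lt_iff[OF D that(2)] using that B \<open>c \<noteq> 0\<close> by (simp add: ext) (simp add: eq)
qed

section \<open>The approximation conditions and their density\<close>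

text \<open>A compact exhaustion: each compact subset of \<open>closure \<Omega>\<close> lies in one
  of these sets, so countably many conditions suffice.\<close>

definition compact_part :: "complex set \<Rightarrow> nat \<Rightarrow> complex set" where
  "compact_part \<Omega> k = closure \<Omega> \<inter> cball 0 (real k)"

text \<open>Strict pointwise bounds, instead of a bound on the supremum, are what compactness shows
  to be stable.\<close>

definition pade_close :: "complex set \<Rightarrow> complex \<Rightarrow> nat \<Rightarrow> nat \<times> nat \<Rightarrow> (complex \<Rightarrow> complex) set" where
  "pade_close \<Omega> \<zeta> k = (\<lambda>(p, q). {f \<in> X_inf \<Omega> \<inter> pade_D \<Omega> p q \<zeta>.
     \<forall>l\<le>k. \<forall>z\<in>compact_part \<Omega> k. pade_error \<Omega> f \<zeta> p q l z < ennreal (1 / Suc k)})"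

lemma X_inf_subset_A_inf: "X_inf \<Omega> \<subseteq> A_inf \<Omega>"
  using closure_of_subset_topspace[of "A_inf_topology \<Omega>"] by (simp add: X_inf_def)

lemma hol_closure_subset_X_inf: "open \<Omega> \<Longrightarrow> hol_closure \<Omega> \<subseteq> X_inf \<Omega>"
  unfolding X_inf_def by (rule closure_of_subset) (simp add: hol_closure_subset_A_inf)

text \<open>\<open>runge\<close> yields \<open>A\<close> and \<open>B\<close> of uncontrolled
  degrees; only then is \<open>n\<close> chosen, large enough for both. The Pade error of the
  perturbed function vanishes on all of \<open>closure \<Omega>\<close>, so \<open>k\<close> is
  independent of \<open>K\<close>, \<open>m\<close> and \<open>e\<close>.\<close>

lemma pade_close_nhd:
  assumes "open \<Omega>" "\<zeta> \<in> closure \<Omega>" "\<And>n. (p n, q n) \<in> F"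
    "filterlim p at_top sequentially" "filterlim q at_top sequentially"
    and h: "h \<in> hol_closure \<Omega>" and K: "compact K" "K \<subseteq> closure \<Omega>" and "0 < e"
  shows "\<exists>x\<in>F. \<exists>f\<in>hol_closure \<Omega>. f \<in> A_inf_nhd \<Omega> h K m e \<inter> pade_close \<Omega> \<zeta> k x"
proof -
  obtain h0 V where V: "h = restrict h0 \<Omega>" "open V" "closure \<Omega> \<subseteq> V" "h0 holomorphic_on V"
    using h unfolding hol_closure_def by blast
  obtain c where c: "\<And>z. z \<in> K \<Longrightarrow> norm z \<le> c"
    using compact_imp_bounded[OF K(1)] by (auto simp: bounded_iff)
  define N where "N = nat \<lceil>c\<rceil>"
  have N: "K \<subseteq> closure \<Omega> \<inter> cball 0 N"
  proof
    fix z assume "z \<in> K"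
    moreover have "c \<le> real N" unfolding N_def by (rule real_nat_ceiling_ge)
    ultimately show "z \<in> closure \<Omega> \<inter> cball 0 N" using c[of z] K(2) by auto
  qed
  let ?g = "\<lambda>A B z. poly A (z - \<zeta>) / poly B (z - \<zeta>)"
  have e2: "0 < e / 2" using \<open>0 < e\<close> by simp
  obtain A B where AB: "\<forall>z\<in>closure \<Omega>. poly B (z - \<zeta>) \<noteq> 0"
    "\<forall>l\<le>m. \<forall>z\<in>closure \<Omega> \<inter> cball 0 N. dist ((deriv ^^ l) (?g A B) z) ((deriv ^^ l) h0 z) < e / 2"
    using runge[OF closed_closure V(2-4) e2, of \<zeta> m N] by (elim exE conjE)
  have "\<forall>\<^sub>F n in sequentially. Suc (degree A) \<le> p n" "\<forall>\<^sub>F n in sequentially. degree B \<le> q n"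
    using assms(4,5) unfolding filterlim_at_top by blast+
  then have "\<forall>\<^sub>F n in sequentially. Suc (degree A) \<le> p n \<and> degree B \<le> q n"
    by (rule eventually_conj)
  then obtain n where n: "degree A < p n" "degree B \<le> q n"
    using eventually_happens'[OF sequentially_bot] by (metis (no_types, lifting) Suc_le_lessD)
  have B0: "poly B 0 \<noteq> 0" using bspec[OF AB(1) assms(2)] by simp
  have BC: "poly B (z - \<zeta>) \<noteq> 0" if "z \<in> closure \<Omega>" for z using AB(1) that by (rule bspec)
  have BK: "poly B (z - \<zeta>) \<noteq> 0" if "z \<in> K" for z using BC K(2) that by blast
  have "\<exists>A'. degree A' = p n \<and> (\<forall>w. poly B w = 0 \<longrightarrow> poly A' w \<noteq> 0) \<and>
      (\<forall>l\<le>m. \<forall>z\<in>K. dist ((deriv ^^ l) (?g A' B) z) ((deriv ^^ l) (?g A B) z) < e / 2)"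
    by (rule rational_perturb[OF K(1) BK B0 n(1) e2])
  then obtain A' where A': "degree A' = p n" "\<forall>w. poly B w = 0 \<longrightarrow> poly A' w \<noteq> 0"
    "\<forall>l\<le>m. \<forall>z\<in>K. dist ((deriv ^^ l) (?g A' B) z) ((deriv ^^ l) (?g A B) z) < e / 2"
    by (elim exE conjE)
  define f where "f = restrict (?g A' B) \<Omega>"
  have "0 < p n" "degree B \<le> q n" using n by auto
  note exact = rational_pade_exact[OF assms(1,2) _ A'(1) this, folded f_def]
  have f1: "f \<in> hol_closure \<Omega>" and f2: "f \<in> pade_D \<Omega> (p n) (q n) \<zeta>"
    by (rule exact(1,2); use BC A'(2) in blast)+
  have ext: "ext_deriv \<Omega> l f z = (deriv ^^ l) (?g A' B) z" if "z \<in> closure \<Omega>" for l z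
    by (rule exact(3)[OF _ _ that]) (use BC A'(2) in blast)+
  have err: "pade_error \<Omega> f \<zeta> (p n) (q n) l z < ennreal d" if "z \<in> closure \<Omega>" "0 < d" for l z d
    by (rule exact(4)[OF _ _ that]) (use BC A'(2) in blast)+
  have f: "f \<in> hol_closure \<Omega>" "f \<in> X_inf \<Omega>" "f \<in> A_inf \<Omega>"
    using f1 hol_closure_subset_X_inf[OF assms(1)] hol_closure_subset_A_inf[OF assms(1)] by auto
  have "dist (ext_deriv \<Omega> l f z) (ext_deriv \<Omega> l h z) < e" if "l \<le> m" "z \<in> K" for l z
  proof -
    have z: "z \<in> closure \<Omega>" "z \<in> closure \<Omega> \<inter> cball 0 N" using K(2) N that(2) by auto
    have "dist ((deriv ^^ l) (?g A' B) z) ((deriv ^^ l) h0 z) < e / 2 + e / 2"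
      using A'(3)[rule_format, OF that] AB(2)[rule_format, OF that(1) z(2)]
        dist_triangle[of "(deriv ^^ l) (?g A' B) z" "(deriv ^^ l) h0 z" "(deriv ^^ l) (?g A B) z"]
      by linarith
    then show ?thesis
      unfolding ext[OF z(1)] V(1) ext_deriv_restrict[OF assms(1) V(2-4) z(1)] by simp
  qed
  then have "f \<in> A_inf_nhd \<Omega> h K m e" using f(3) by (simp add: A_inf_nhd_def)
  moreover have "f \<in> pade_close \<Omega> \<zeta> k (p n, q n)"
    using f(2) f2 err by (auto simp: pade_close_def compact_part_def)
  ultimately show ?thesis using f(1) assms(3) by blast
qed

section \<open>Baire category in the closure of the holomorphic functions\<close>

lemma compact_part_subset: "compact_part \<Omega> k \<subseteq> closure \<Omega>"
  by (auto simp: compact_part_def)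

lemma compact_part_mono: "k \<le> n \<Longrightarrow> compact_part \<Omega> k \<subseteq> compact_part \<Omega> n"
  by (auto simp: compact_part_def)

lemma compact_compact_part: "compact (compact_part \<Omega> k)"
  unfolding compact_part_def by (rule closed_Int_compact) auto

lemma compact_subset_compact_part:
  assumes "compact K" "K \<subseteq> closure \<Omega>"
  shows "\<exists>k. K \<subseteq> compact_part \<Omega> k"
proof -
  obtain c where c: "\<And>z. z \<in> K \<Longrightarrow> norm z \<le> c"
    using compact_imp_bounded[OF assms(1)] by (auto simp: bounded_iff)
  have "c \<le> real (nat \<lceil>c\<rceil>)" by (rule real_nat_ceiling_ge)
  then have "K \<subseteq> compact_part \<Omega> (nat \<lceil>c\<rceil>)" using c assms(2) by (force simp: compact_part_def)
  then show ?thesis by blast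
qed

section \<open>Countable neighbourhood bases and completeness\<close>

abbreviation basic_nhd :: "complex set \<Rightarrow> (complex \<Rightarrow> complex) \<Rightarrow> nat \<Rightarrow> real \<Rightarrow> (complex \<Rightarrow> complex) set" where
  "basic_nhd \<Omega> f k e \<equiv> A_inf_nhd \<Omega> f (compact_part \<Omega> k) k e"

lemma openin_X_inf_basic_nhd:
  assumes "open \<Omega>" "f \<in> X_inf \<Omega>" "0 < e"
  shows "openin (X_inf_topology \<Omega>) (basic_nhd \<Omega> f k e \<inter> X_inf \<Omega>)"
proof -
  have "f \<in> A_inf \<Omega>" using assms(2) X_inf_subset_A_inf by blast
  then have "openin (A_inf_topology \<Omega>) (basic_nhd \<Omega> f k e)"
    using assms(1,3) by (intro openin_A_inf_nhd compact_compact_part compact_part_subset) auto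
  then show ?thesis unfolding X_inf_topology_def openin_subtopology by blast
qed

lemma centre_in_A_inf_nhd: "f \<in> A_inf \<Omega> \<Longrightarrow> 0 < e \<Longrightarrow> f \<in> A_inf_nhd \<Omega> f K m e"
  by (simp add: A_inf_nhd_def)

lemma openin_X_inf_contains_basic_nhd:
  assumes "openin (X_inf_topology \<Omega>) U" "f \<in> U"
  shows "\<exists>k0 e0. 0 < e0 \<and> (\<forall>k\<ge>k0. \<forall>e\<le>e0. basic_nhd \<Omega> f k e \<inter> X_inf \<Omega> \<subseteq> U)"
proof -
  obtain T where T: "openin (A_inf_topology \<Omega>) T" "U = T \<inter> X_inf \<Omega>"
    using assms(1) unfolding X_inf_topology_def openin_subtopology by blast
  then obtain K m e0 where K: "compact K" "K \<subseteq> closure \<Omega>" "0 < e0" "A_inf_nhd \<Omega> f K m e0 \<subseteq> T"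
    using assms(2) unfolding openin_A_inf by blast
  obtain k1 where k1: "K \<subseteq> compact_part \<Omega> k1"
    using compact_subset_compact_part[OF K(1,2)] by blast
  have "basic_nhd \<Omega> f k e \<inter> X_inf \<Omega> \<subseteq> U" if "max k1 m \<le> k" "e \<le> e0" for k e
  proof -
    have "compact_part \<Omega> k1 \<subseteq> compact_part \<Omega> k" using that(1) by (intro compact_part_mono) simp
    then have "K \<subseteq> compact_part \<Omega> k" using k1 by (rule subset_trans[rotated])
    then have "basic_nhd \<Omega> f k e \<subseteq> T"
      using that by (intro subset_trans[OF A_inf_nhd_mono K(4)]) auto
    then show ?thesis using T(2) by blast
  qed
  then show ?thesis using K(3) by blast
qed

text \<open>The neighbourhoods with index \<open>n\<close> and radius \<open>1 / Suc n\<close> form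
  a countable base at \<open>f\<close>. If none of them lies in \<open>U\<close>, one point outside
  \<open>U\<close> from each gives a sequence converging to \<open>f\<close>.\<close>

lemma openin_X_inf_sequentially:
  assumes "open \<Omega>" "U \<subseteq> X_inf \<Omega>"
    and "\<And>f g. f \<in> U \<Longrightarrow> (\<And>n. g n \<in> X_inf \<Omega>) \<Longrightarrow>
      (\<And>l K. compact K \<Longrightarrow> K \<subseteq> closure \<Omega> \<Longrightarrow>
        uniform_limit K (\<lambda>n. ext_deriv \<Omega> l (g n)) (ext_deriv \<Omega> l f) sequentially) \<Longrightarrow>
      \<forall>\<^sub>F n in sequentially. g n \<in> U"
  shows "openin (X_inf_topology \<Omega>) U"
proof (subst openin_subopen, intro ballI)
  fix f assume f: "f \<in> U"
  have "\<exists>n. basic_nhd \<Omega> f n (1 / Suc n) \<inter> X_inf \<Omega> \<subseteq> U"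
  proof (rule ccontr)
    assume "\<nexists>n. basic_nhd \<Omega> f n (1 / Suc n) \<inter> X_inf \<Omega> \<subseteq> U"
    then have "\<forall>n. \<exists>g. g \<in> basic_nhd \<Omega> f n (1 / Suc n) \<and> g \<in> X_inf \<Omega> \<and> g \<notin> U" by blast
    then obtain g where g: "\<And>n. g n \<in> basic_nhd \<Omega> f n (1 / Suc n)" "\<And>n. g n \<in> X_inf \<Omega>" "\<And>n. g n \<notin> U"
      by metis
    have "\<forall>\<^sub>F n in sequentially. g n \<in> U"
    proof (rule assms(3)[OF f g(2)])
      fix l K assume K: "compact K" "K \<subseteq> closure \<Omega>"
      obtain k where k: "K \<subseteq> compact_part \<Omega> k"
        using compact_subset_compact_part[OF K] by blast
      show "uniform_limit K (\<lambda>n. ext_deriv \<Omega> l (g n)) (ext_deriv \<Omega> l f) sequentially"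
      proof (rule uniform_limitI)
        fix e :: real assume "0 < e"
        then have "\<forall>\<^sub>F n in sequentially. 1 / Suc n < e"
          using order_tendstoD(2)[OF LIMSEQ_Suc[OF lim_1_over_n]] by simp
        then show "\<forall>\<^sub>F n in sequentially. \<forall>z\<in>K. dist (ext_deriv \<Omega> l (g n) z) (ext_deriv \<Omega> l f z) < e"
          using eventually_ge_at_top[of "max k l"]
        proof eventually_elim
          case (elim n)
          have "compact_part \<Omega> k \<subseteq> compact_part \<Omega> n" using elim(2) by (intro compact_part_mono) simp
          then have "z \<in> compact_part \<Omega> n" if "z \<in> K" for z using k that by blast
          then show ?case using g(1)[of n] elim by (fastforce simp: A_inf_nhd_def)
        qed
      qed
    qed
    then show False using g(3) by simp
  qed
  then obtain n where n: "basic_nhd \<Omega> f n (1 / Suc n) \<inter> X_inf \<Omega> \<subseteq> U" by blast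
  have "f \<in> X_inf \<Omega>" using f assms(2) by blast
  then have "openin (X_inf_topology \<Omega>) (basic_nhd \<Omega> f n (1 / Suc n) \<inter> X_inf \<Omega>)"
    by (intro openin_X_inf_basic_nhd assms(1)) auto
  moreover have "f \<in> basic_nhd \<Omega> f n (1 / Suc n) \<inter> X_inf \<Omega>"
    using \<open>f \<in> X_inf \<Omega>\<close> X_inf_subset_A_inf by (auto intro!: centre_in_A_inf_nhd)
  ultimately show "\<exists>T. openin (X_inf_topology \<Omega>) T \<and> f \<in> T \<and> T \<subseteq> U" using n by blast
qed

lemma openin_pade_close:
  assumes "open \<Omega>" "\<zeta> \<in> closure \<Omega>"
  shows "openin (X_inf_topology \<Omega>) (pade_close \<Omega> \<zeta> k x)"
proof -
  obtain p q where x: "x = (p, q)" by force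
  show ?thesis
  proof (rule openin_X_inf_sequentially[OF assms(1)])
    show "pade_close \<Omega> \<zeta> k x \<subseteq> X_inf \<Omega>" by (auto simp: pade_close_def x)
    fix f and g :: "nat \<Rightarrow> complex \<Rightarrow> complex"
    assume f: "f \<in> pade_close \<Omega> \<zeta> k x" and g: "\<And>n. g n \<in> X_inf \<Omega>"
      and lim: "\<And>l K. compact K \<Longrightarrow> K \<subseteq> closure \<Omega> \<Longrightarrow>
        uniform_limit K (\<lambda>n. ext_deriv \<Omega> l (g n)) (ext_deriv \<Omega> l f) sequentially"
    have gA: "g n \<in> A_inf \<Omega>" for n using g X_inf_subset_A_inf by blast
    have "\<forall>\<^sub>F n in sequentially. g n \<in> pade_D \<Omega> p q \<zeta> \<and>
        (\<forall>l\<le>k. \<forall>z\<in>compact_part \<Omega> k. pade_error \<Omega> (g n) \<zeta> p q l z < ennreal (1 / Suc k))"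
      using f by (intro pade_error_eventually_less[OF assms compact_compact_part compact_part_subset _ _ gA lim])
        (auto simp: pade_close_def x)
    then show "\<forall>\<^sub>F n in sequentially. g n \<in> pade_close \<Omega> \<zeta> k x"
      by eventually_elim (use g in \<open>simp add: pade_close_def x\<close>)
  qed
qed

text \<open>Each order \<open>l\<close> has a continuous limit \<open>G l\<close> on
  \<open>closure \<Omega>\<close>. By Weierstrass' theorem \<open>G 0\<close> is holomorphic on
  \<Omega> with derivatives \<open>G l\<close>, so the \<open>G l\<close> are the required
  extensions.\<close>

lemma A_inf_complete:
  assumes "open \<Omega>" and g: "\<And>n. g n \<in> A_inf \<Omega>"
    and "\<And>l K. compact K \<Longrightarrow> K \<subseteq> closure \<Omega> \<Longrightarrow> uniformly_Cauchy_on K (\<lambda>n. ext_deriv \<Omega> l (g n))"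
  obtains f where "f \<in> A_inf \<Omega>" "\<And>l K. compact K \<Longrightarrow> K \<subseteq> closure \<Omega> \<Longrightarrow>
    uniform_limit K (\<lambda>n. ext_deriv \<Omega> l (g n)) (ext_deriv \<Omega> l f) sequentially"
proof -
  define G where "G l z = lim (\<lambda>n. ext_deriv \<Omega> l (g n) z)" for l z
  have lim: "uniform_limit K (\<lambda>n. ext_deriv \<Omega> l (g n)) (G l) sequentially"
    if "compact K" "K \<subseteq> closure \<Omega>" for l K
    using Cauchy_uniformly_convergent[OF assms(3)[OF that]]
    unfolding uniformly_convergent_uniform_limit_iff G_def[abs_def] .
  have cont: "continuous_on (closure \<Omega>) (G l)" for l
    unfolding continuous_on_eq_continuous_within
  proof
    fix z assume z: "z \<in> closure \<Omega>"
    \<comment> \<open>Convergence is uniform on compact sets only; continuity is local, so a compact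
      neighbourhood of \<open>z\<close> in \<open>closure \<Omega>\<close> is enough.\<close>
    let ?K = "closure \<Omega> \<inter> cball z 1"
    have K: "compact ?K" by (rule closed_Int_compact) auto
    have "continuous_on ?K (G l)"
    proof (rule uniform_limit_theorem[OF _ lim[OF K]])
      show "\<forall>\<^sub>F n in sequentially. continuous_on ?K (ext_deriv \<Omega> l (g n))"
        using continuous_on_ext_deriv[OF assms(1) g]
        by (intro always_eventually allI) (auto intro: continuous_on_subset)
    qed auto
    then have "continuous (at z within ?K) (G l)"
      using z by (simp add: continuous_on_eq_continuous_within)
    moreover have "at z within ?K = at z within closure \<Omega>"
      by (rule at_within_nhd[of z "ball z 1"]) auto
    ultimately show "continuous (at z within closure \<Omega>) (G l)"
      by (simp add: continuous_within)
  qed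
  have sub: "\<Omega> \<subseteq> closure \<Omega>" by (rule closure_subset)
  have hol: "g n holomorphic_on \<Omega>" for n using g[of n] by (simp add: A_inf_def)
  have ext0: "ext_deriv \<Omega> l (g n) z = (deriv ^^ l) (g n) z" if "z \<in> \<Omega>" for l n z
    using ext_deriv_eq[OF assms(1) g that] .
  have lim0: "uniform_limit K g (G 0) sequentially" if "compact K" "K \<subseteq> \<Omega>" for K
  proof -
    have "uniform_limit K g (G 0) sequentially \<longleftrightarrow> uniform_limit K (\<lambda>n. ext_deriv \<Omega> 0 (g n)) (G 0) sequentially"
      by (rule uniform_limit_cong') (use ext0[of _ 0] that(2) in auto)
    then show ?thesis using lim[OF that(1), of 0] that(2) sub by simp
  qed
  have holG: "G 0 holomorphic_on \<Omega>"
  proof (rule holomorphic_uniform_sequence[OF assms(1) hol])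
    fix x assume "x \<in> \<Omega>"
    then obtain d where "0 < d" "cball x d \<subseteq> \<Omega>" using assms(1) by (meson open_contains_cball)
    then show "\<exists>d. 0 < d \<and> cball x d \<subseteq> \<Omega> \<and> uniform_limit (cball x d) g (G 0) sequentially"
      using lim0[of "cball x d"] by auto
  qed
  have G: "(deriv ^^ l) (G 0) z = G l z" if "z \<in> \<Omega>" for l z
  proof -
    obtain d where d: "0 < d" "cball z d \<subseteq> \<Omega>" using \<open>z \<in> \<Omega>\<close> assms(1) by (meson open_contains_cball)
    have "(\<lambda>n. (deriv ^^ l) (g n) z) \<longlonglongrightarrow> (deriv ^^ l) (G 0) z"
    proof (rule higher_deriv_complex_uniform_limit)
      show "uniform_limit (ball z d) g (G 0) sequentially"
        by (rule uniform_limit_on_subset[OF lim0[of "cball z d"]]) (use d in auto)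
      show "\<forall>\<^sub>F n in sequentially. g n holomorphic_on ball z d"
        using hol d(2) by (intro always_eventually allI) (meson ball_subset_cball holomorphic_on_subset order_trans)
    qed (use d(1) in auto)
    moreover have "(\<lambda>n. ext_deriv \<Omega> l (g n) z) \<longlonglongrightarrow> G l z"
      using tendsto_uniform_limitI[OF lim[of "{z}" l]] that sub by auto
    then have "(\<lambda>n. (deriv ^^ l) (g n) z) \<longlonglongrightarrow> G l z" by (simp add: ext0[OF that])
    ultimately show ?thesis by (rule LIMSEQ_unique)
  qed
  define f where "f = restrict (G 0) \<Omega>"
  have f: "(deriv ^^ l) f z = G l z" if "z \<in> \<Omega>" for l z
  proof -
    have "\<forall>\<^sub>F w in nhds z. f w = G 0 w"
      using eventually_nhds_in_open[OF assms(1) that] by eventually_elim (simp add: f_def)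
    then have "(deriv ^^ l) f z = (deriv ^^ l) (G 0) z" by (rule higher_deriv_cong_ev) simp
    then show ?thesis using G[OF that] by simp
  qed
  have "f holomorphic_on \<Omega>" using holG by (simp add: f_def cong: holomorphic_cong)
  then have fA: "f \<in> A_inf \<Omega>"
    unfolding A_inf_def using cont f by (auto simp: f_def intro!: exI[of _ "G _"])
  have "ext_deriv \<Omega> l f z = G l z" if "z \<in> closure \<Omega>" for l z
    by (rule ext_deriv_eqI[OF assms(1) that cont]) (simp add: f)
  then have "uniform_limit K (\<lambda>n. ext_deriv \<Omega> l (g n)) (ext_deriv \<Omega> l f) sequentially \<longleftrightarrow>
      uniform_limit K (\<lambda>n. ext_deriv \<Omega> l (g n)) (G l) sequentially" if "K \<subseteq> closure \<Omega>" for l K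
    using that by (intro uniform_limit_cong') auto
  with lim show ?thesis by (intro that[OF fA]) simp
qed

lemma X_inf_closed:
  assumes "open \<Omega>" "f \<in> A_inf \<Omega>" "\<And>n. g n \<in> X_inf \<Omega>"
    and "\<And>l K. compact K \<Longrightarrow> K \<subseteq> closure \<Omega> \<Longrightarrow>
      uniform_limit K (\<lambda>n. ext_deriv \<Omega> l (g n)) (ext_deriv \<Omega> l f) sequentially"
  shows "f \<in> X_inf \<Omega>"
proof -
  have "limitin (A_inf_topology \<Omega>) g f sequentially"
    using assms(4) assms(3)[THEN subsetD[OF X_inf_subset_A_inf]]
    by (subst limitin_A_inf[OF assms(1,2)]) auto
  then show ?thesis
    by (rule limitin_closedin[where S = "X_inf \<Omega>"])
      (use assms(3) in \<open>auto simp: X_inf_def\<close>)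
qed

text \<open>Non-strict bounds pass to the limit of the nested sequence in Baire's argument.\<close>

definition closed_nhd :: "complex set \<Rightarrow> (complex \<Rightarrow> complex) \<Rightarrow> nat \<Rightarrow> real \<Rightarrow> (complex \<Rightarrow> complex) set" where
  "closed_nhd \<Omega> f k e = {g \<in> X_inf \<Omega>. \<forall>l\<le>k. \<forall>z\<in>compact_part \<Omega> k.
     dist (ext_deriv \<Omega> l g z) (ext_deriv \<Omega> l f z) \<le> e}"

lemma closed_nhd_subset: "0 < e \<Longrightarrow> closed_nhd \<Omega> f k e \<subseteq> basic_nhd \<Omega> f k (2 * e) \<inter> X_inf \<Omega>"
proof
  fix g assume "0 < e" and g: "g \<in> closed_nhd \<Omega> f k e"
  have "dist (ext_deriv \<Omega> l g z) (ext_deriv \<Omega> l f z) < 2 * e" if "l \<le> k" "z \<in> compact_part \<Omega> k" for l z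
  proof -
    have "dist (ext_deriv \<Omega> l g z) (ext_deriv \<Omega> l f z) \<le> e" using g that by (simp add: closed_nhd_def)
    then show ?thesis using \<open>0 < e\<close> by simp
  qed
  then show "g \<in> basic_nhd \<Omega> f k (2 * e) \<inter> X_inf \<Omega>"
    using g X_inf_subset_A_inf by (auto simp: closed_nhd_def A_inf_nhd_def)
qed

lemma basic_nhd_subset_closed_nhd: "basic_nhd \<Omega> f k e \<inter> X_inf \<Omega> \<subseteq> closed_nhd \<Omega> f k e"
  unfolding closed_nhd_def A_inf_nhd_def by (auto intro: less_imp_le)

text \<open>Nested closed neighbourhoods, without a metric. At stage \<open>n\<close> the order and
  the compact part have index at least \<open>n\<close> and the radius is at most
  \<open>1 / Suc n\<close>, so the centres are Cauchy in every seminorm and converge in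
  \<open>X_inf \<Omega>\<close>.\<close>

lemma X_inf_Baire:
  assumes "open \<Omega>" and W: "\<And>n::nat. openin (X_inf_topology \<Omega>) (W n)"
    and dense: "\<And>n U. openin (X_inf_topology \<Omega>) U \<Longrightarrow> U \<noteq> {} \<Longrightarrow> U \<inter> W n \<noteq> {}"
    and U: "openin (X_inf_topology \<Omega>) U" "U \<noteq> {}"
  shows "U \<inter> (\<Inter>n. W n) \<noteq> {}"
proof -
  let ?C = "\<lambda>x. closed_nhd \<Omega> (fst x) (fst (snd x)) (snd (snd x))"
  let ?P = "\<lambda>n x. fst x \<in> X_inf \<Omega> \<and> n \<le> fst (snd x) \<and> 0 < snd (snd x) \<and> snd (snd x) \<le> 1 / Suc n \<and>
    ?C x \<subseteq> U \<inter> W n"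
  have step: "\<exists>x. fst x \<in> X_inf \<Omega> \<and> n \<le> fst (snd x) \<and> 0 < snd (snd x) \<and> snd (snd x) \<le> 1 / Suc n \<and>
      ?C x \<subseteq> T \<inter> W n" if T: "openin (X_inf_topology \<Omega>) T" "T \<noteq> {}" for T n
  proof -
    obtain f where f: "f \<in> T \<inter> W n" using dense[OF T, of n] by blast
    have TW: "openin (X_inf_topology \<Omega>) (T \<inter> W n)" using T(1) W by (rule openin_Int)
    then have fX: "f \<in> X_inf \<Omega>" using f openin_subset by fastforce
    obtain k0 e0 where e0: "0 < e0" "\<And>k e. k0 \<le> k \<Longrightarrow> e \<le> e0 \<Longrightarrow> basic_nhd \<Omega> f k e \<inter> X_inf \<Omega> \<subseteq> T \<inter> W n"
      using openin_X_inf_contains_basic_nhd[OF TW f] by blast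
    \<comment> \<open>Half of \<open>e0\<close>, because a closed neighbourhood of radius
      \<open>e\<close> is placed inside the open one of radius \<open>2 * e\<close>.\<close>
    define e where "e = min (e0 / 2) (1 / Suc n)"
    have e: "0 < e" "2 * e \<le> e0" "e \<le> 1 / Suc n" using e0(1) by (auto simp: e_def)
    have "closed_nhd \<Omega> f (max k0 n) e \<subseteq> T \<inter> W n"
      using closed_nhd_subset[OF e(1), of \<Omega> f "max k0 n"] e0(2)[OF _ e(2), of "max k0 n"] by auto
    then show ?thesis using fX e by (intro exI[of _ "(f, max k0 n, e)"]) auto
  qed
  have "\<exists>s. \<forall>n. ?P n (s n) \<and> ?C (s (Suc n)) \<subseteq> ?C (s n)"
  proof (rule dependent_nat_choice)
    show "\<exists>x. ?P 0 x" using step[OF U, of 0] by simp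
  next
    fix x n assume x: "?P n x"
    \<comment> \<open>The next stage is chosen inside the open neighbourhood with the same centre
      and radius, hence inside the closed one.\<close>
    let ?T = "basic_nhd \<Omega> (fst x) (fst (snd x)) (snd (snd x)) \<inter> X_inf \<Omega>"
    have "openin (X_inf_topology \<Omega>) ?T" using x by (intro openin_X_inf_basic_nhd assms(1)) auto
    moreover have "fst x \<in> ?T" using x X_inf_subset_A_inf by (auto intro!: centre_in_A_inf_nhd)
    ultimately obtain y where y: "fst y \<in> X_inf \<Omega>" "Suc n \<le> fst (snd y)" "0 < snd (snd y)"
      "snd (snd y) \<le> 1 / Suc (Suc n)" "?C y \<subseteq> ?T \<inter> W (Suc n)"
      using step[of ?T "Suc n"] by blast
    have "?T \<subseteq> ?C x" by (rule basic_nhd_subset_closed_nhd)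
    then show "\<exists>y. ?P (Suc n) y \<and> ?C y \<subseteq> ?C x" using x y by (intro exI[of _ y]) blast
  qed
  then obtain s where s: "\<And>n. ?P n (s n)" "\<And>n. ?C (s (Suc n)) \<subseteq> ?C (s n)" by blast
  define g where "g n = fst (s n)" for n
  have gX: "g n \<in> X_inf \<Omega>" for n using s(1) by (simp add: g_def)
  then have gA: "g n \<in> A_inf \<Omega>" for n using X_inf_subset_A_inf by blast
  have self: "g n \<in> ?C (s n)" for n
    using s(1)[of n] by (simp add: g_def closed_nhd_def)
  have nested: "?C (s n) \<subseteq> ?C (s m)" if "m \<le> n" for m n
    using that s(2) by (rule lift_Suc_antimono_le[of "\<lambda>n. ?C (s n)", rotated])
  then have mem: "g n \<in> ?C (s m)" if "m \<le> n" for m n using that self by blast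
  have Cauchy: "uniformly_Cauchy_on K (\<lambda>n. ext_deriv \<Omega> l (g n))"
    if K: "compact K" "K \<subseteq> closure \<Omega>" for l K
    unfolding uniformly_Cauchy_on_def
  proof (intro allI impI)
    fix e :: real assume "0 < e"
    obtain k where k: "K \<subseteq> compact_part \<Omega> k"
      using compact_subset_compact_part[OF K] by blast
    have "\<forall>\<^sub>F n in sequentially. 1 / Suc n < e / 2"
      using order_tendstoD(2)[OF LIMSEQ_Suc[OF lim_1_over_n], of "e / 2"] \<open>0 < e\<close> by simp
    then obtain N0 where N0: "\<And>n. N0 \<le> n \<Longrightarrow> 1 / Suc n < e / 2"
      unfolding eventually_sequentially by blast
    \<comment> \<open>The index at stage \<open>N\<close> is at least \<open>N\<close>, so
      \<open>N \<ge> k\<close> and \<open>N \<ge> l\<close> bring the derivative of order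
      \<open>l\<close> on \<open>K\<close> under its bound.\<close>
    define N where "N = max N0 (max k l)"
    have near: "dist (ext_deriv \<Omega> l (g n) z) (ext_deriv \<Omega> l (g N) z) < e / 2" if "z \<in> K" "N \<le> n" for z n
    proof -
      have le: "N \<le> fst (snd (s N))" "snd (snd (s N)) \<le> 1 / Suc N" using s(1)[of N] by auto
      have "1 / Suc N < e / 2" by (rule N0) (simp add: N_def)
      moreover have "compact_part \<Omega> k \<subseteq> compact_part \<Omega> (fst (snd (s N)))"
        using le(1) by (intro compact_part_mono) (simp add: N_def)
      then have "z \<in> compact_part \<Omega> (fst (snd (s N)))" using k that(1) by blast
      moreover have "l \<le> fst (snd (s N))" using le(1) by (simp add: N_def)
      ultimately show ?thesis
        using mem[OF that(2)] le(2) by (auto simp: closed_nhd_def g_def dest!: spec[of _ l] bspec[of _ _ z])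
    qed
    have "dist (ext_deriv \<Omega> l (g m) z) (ext_deriv \<Omega> l (g n) z) < e" if "z \<in> K" "N \<le> m" "N \<le> n" for z m n
      using near[OF that(1,2)] near[OF that(1,3)] by (rule dist_triangle_half_l)
    then show "\<exists>M. \<forall>z\<in>K. \<forall>m\<ge>M. \<forall>n\<ge>M. dist (ext_deriv \<Omega> l (g m) z) (ext_deriv \<Omega> l (g n) z) < e"
      by blast
  qed
  obtain f where f: "f \<in> A_inf \<Omega>" "\<And>l K. compact K \<Longrightarrow> K \<subseteq> closure \<Omega> \<Longrightarrow>
      uniform_limit K (\<lambda>n. ext_deriv \<Omega> l (g n)) (ext_deriv \<Omega> l f) sequentially"
    using A_inf_complete[OF assms(1) gA Cauchy] by blast
  have fX: "f \<in> X_inf \<Omega>" by (rule X_inf_closed[OF assms(1) f(1) gX f(2)])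
  have "f \<in> ?C (s m)" for m
    unfolding closed_nhd_def
  proof (intro CollectI conjI allI impI ballI)
    fix l z assume l: "l \<le> fst (snd (s m))" and z: "z \<in> compact_part \<Omega> (fst (snd (s m)))"
    have "(\<lambda>n. ext_deriv \<Omega> l (g n) z) \<longlonglongrightarrow> ext_deriv \<Omega> l f z"
      using tendsto_uniform_limitI[OF f(2)[of "{z}" l]] z compact_part_subset by auto
    then have "(\<lambda>n. dist (ext_deriv \<Omega> l (g n) z) (ext_deriv \<Omega> l (fst (s m)) z)) \<longlonglongrightarrow>
        dist (ext_deriv \<Omega> l f z) (ext_deriv \<Omega> l (fst (s m)) z)"
      by (intro tendsto_intros)
    moreover have "\<forall>\<^sub>F n in sequentially.
        dist (ext_deriv \<Omega> l (g n) z) (ext_deriv \<Omega> l (fst (s m)) z) \<le> snd (snd (s m))"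
      using eventually_ge_at_top[of m]
      by eventually_elim (use mem l z in \<open>auto simp: closed_nhd_def\<close>)
    ultimately show "dist (ext_deriv \<Omega> l f z) (ext_deriv \<Omega> l (fst (s m)) z) \<le> snd (snd (s m))"
      by (rule tendsto_upperbound) simp
  qed (rule fX)
  then have "f \<in> U \<inter> W m" for m using s(1)[of m] by blast
  then show ?thesis by blast
qed

text \<open>The sequence of degrees may depend on \<open>f\<close>: its \<open>k\<close>-th term is
  a choice for condition \<open>k\<close>. Conditions with index at least \<open>max k l\<close> all
  control order \<open>l\<close> on \<open>K \<subseteq> compact_part \<Omega> k\<close>, with
  bounds tending to 0.\<close>

lemma pade_approximable_iff:
  assumes "f \<in> X_inf \<Omega>"
  shows "pade_approximable \<Omega> \<zeta> F f \<longleftrightarrow> (\<forall>k. \<exists>x\<in>F. f \<in> pade_close \<Omega> \<zeta> k x)"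
proof (intro iffI allI)
  fix k assume "pade_approximable \<Omega> \<zeta> F f"
  then obtain p q where pq: "\<And>n. (p n, q n) \<in> F"
    "\<And>K. compact K \<and> K \<subseteq> closure \<Omega> \<Longrightarrow> (\<forall>n. f \<in> pade_D \<Omega> (p n) (q n) \<zeta>) \<and>
      (\<forall>l. (\<lambda>n. SUP z\<in>K. pade_error \<Omega> f \<zeta> (p n) (q n) l z) \<longlonglongrightarrow> 0)"
    unfolding pade_approximable_def by blast
  let ?K = "compact_part \<Omega> k"
  have K: "compact ?K \<and> ?K \<subseteq> closure \<Omega>" using compact_compact_part compact_part_subset by blast
  have "\<forall>\<^sub>F n in sequentially. (SUP z\<in>?K. pade_error \<Omega> f \<zeta> (p n) (q n) l z) < ennreal (1 / Suc k)" for l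
    using pq(2)[OF K] by (intro order_tendstoD(2)[where y = 0]) (auto simp: ennreal_zero_less_divide)
  then have "\<forall>\<^sub>F n in sequentially. \<forall>l\<in>{..k}. (SUP z\<in>?K. pade_error \<Omega> f \<zeta> (p n) (q n) l z) < ennreal (1 / Suc k)"
    by (intro eventually_ball_finite) auto
  then obtain n where n: "\<And>l. l \<le> k \<Longrightarrow> (SUP z\<in>?K. pade_error \<Omega> f \<zeta> (p n) (q n) l z) < ennreal (1 / Suc k)"
    by (auto simp: eventually_sequentially)
  have "pade_error \<Omega> f \<zeta> (p n) (q n) l z < ennreal (1 / Suc k)" if "l \<le> k" "z \<in> ?K" for l z
    using SUP_upper[OF that(2)] n[OF that(1)] by (rule le_less_trans)
  then have "f \<in> pade_close \<Omega> \<zeta> k (p n, q n)"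
    using assms pq(2)[OF K] by (simp add: pade_close_def)
  then show "\<exists>x\<in>F. f \<in> pade_close \<Omega> \<zeta> k x" using pq(1) by blast
next
  assume "\<forall>k. \<exists>x\<in>F. f \<in> pade_close \<Omega> \<zeta> k x"
  then obtain x where x: "\<And>k. x k \<in> F" "\<And>k. f \<in> pade_close \<Omega> \<zeta> k (x k)" by metis
  let ?p = "\<lambda>k. fst (x k)" and ?q = "\<lambda>k. snd (x k)"
  have D: "f \<in> pade_D \<Omega> (?p k) (?q k) \<zeta>" for k
    using x(2)[of k] by (simp add: pade_close_def case_prod_unfold)
  have err: "pade_error \<Omega> f \<zeta> (?p k) (?q k) l z < ennreal (1 / Suc k)"
    if "l \<le> k" "z \<in> compact_part \<Omega> k" for k l z
    using x(2)[of k] that by (simp add: pade_close_def case_prod_unfold)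
  have "(\<lambda>n. SUP z\<in>K. pade_error \<Omega> f \<zeta> (?p n) (?q n) l z) \<longlonglongrightarrow> 0"
    if K: "compact K" "K \<subseteq> closure \<Omega>" for K l
  proof (rule tendsto_sandwich[where f = "\<lambda>_. 0" and h = "\<lambda>n. ennreal (1 / Suc n)"])
    obtain k where k: "K \<subseteq> compact_part \<Omega> k"
      using compact_subset_compact_part[OF K] by blast
    show "\<forall>\<^sub>F n in sequentially. (SUP z\<in>K. pade_error \<Omega> f \<zeta> (?p n) (?q n) l z) \<le> ennreal (1 / Suc n)"
      using eventually_ge_at_top[of "max k l"]
    proof eventually_elim
      case (elim n)
      have "compact_part \<Omega> k \<subseteq> compact_part \<Omega> n" using elim by (intro compact_part_mono) simp
      then show ?case using k elim by (intro SUP_least less_imp_le[OF err]) auto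
    qed
    have "(\<lambda>n. 1 / real (Suc n)) \<longlonglongrightarrow> 0" by (rule LIMSEQ_Suc[OF lim_1_over_n])
    then show "(\<lambda>n. ennreal (1 / Suc n)) \<longlonglongrightarrow> 0" using tendsto_ennrealI by fastforce
  qed auto
  then show "pade_approximable \<Omega> \<zeta> F f"
    unfolding pade_approximable_def using x(1) D by (intro exI[of _ ?p] exI[of _ ?q]) auto
qed

theorem theorem6p5:
  fixes \<Omega> :: "complex set" and \<zeta>\<^sub>0 :: complex and F :: "(nat \<times> nat) set"
  assumes "open \<Omega>" and "\<zeta>\<^sub>0 \<in> closure \<Omega>"
    and "\<exists>p' q'. (\<forall>n. (p' n, q' n) \<in> F) \<and>
      filterlim p' at_top sequentially \<and> filterlim q' at_top sequentially"
  shows "(\<exists>f\<in>A_inf \<Omega>. pade_approximable \<Omega> \<zeta>\<^sub>0 F f) \<and>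
    gdelta_in (X_inf_topology \<Omega>) {f \<in> X_inf \<Omega>. pade_approximable \<Omega> \<zeta>\<^sub>0 F f} \<and>
    Abstract_Topology.closure_of (X_inf_topology \<Omega>) {f \<in> X_inf \<Omega>. pade_approximable \<Omega> \<zeta>\<^sub>0 F f} = X_inf \<Omega>"
proof -
  obtain p q where F: "\<And>n. (p n, q n) \<in> F" and
    pq: "filterlim p at_top sequentially" "filterlim q at_top sequentially"
    using assms(3) by blast
  define W where "W k = (\<Union>x\<in>F. pade_close \<Omega> \<zeta>\<^sub>0 k x)" for k
  let ?S = "{f \<in> X_inf \<Omega>. pade_approximable \<Omega> \<zeta>\<^sub>0 F f}"
  have W: "openin (X_inf_topology \<Omega>) (W k)" for k
    unfolding W_def by (intro openin_Union) (auto intro: openin_pade_close assms(1,2))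
  have "f \<in> ?S \<longleftrightarrow> f \<in> (\<Inter>k. W k)" for f
  proof (cases "f \<in> X_inf \<Omega>")
    case False
    then have "f \<notin> W 0" using openin_subset[OF W] by auto
    with False show ?thesis by blast
  qed (simp add: pade_approximable_iff W_def)
  then have S: "?S = (\<Inter>k. W k)" by blast
  have dense: "U \<inter> W k \<noteq> {}" if U: "openin (X_inf_topology \<Omega>) U" "U \<noteq> {}" for U k
  proof -
    obtain T where T: "openin (A_inf_topology \<Omega>) T" "U = T \<inter> X_inf \<Omega>"
      using U(1) unfolding X_inf_topology_def openin_subtopology by blast
    obtain f where "f \<in> T" "f \<in> X_inf \<Omega>" using U(2) T(2) by blast
    \<comment> \<open>\<open>X_inf \<Omega>\<close> is by definition the closure of
      \<open>hol_closure \<Omega>\<close>, so only functions holomorphic near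
      \<open>closure \<Omega>\<close> have to be approximated.\<close>
    then obtain h where h: "h \<in> hol_closure \<Omega>" "h \<in> T"
      using T(1) unfolding X_inf_def in_closure_of by blast
    then obtain K m e where K: "compact K" "K \<subseteq> closure \<Omega>" "0 < e" "A_inf_nhd \<Omega> h K m e \<subseteq> T"
      using T(1) unfolding openin_A_inf by blast
    obtain x f where "x \<in> F" "f \<in> hol_closure \<Omega>" "f \<in> A_inf_nhd \<Omega> h K m e" "f \<in> pade_close \<Omega> \<zeta>\<^sub>0 k x"
      using pade_close_nhd[OF assms(1,2) F pq h(1) K(1-3), of m k] by blast
    then show ?thesis
      using K(4) T(2) hol_closure_subset_X_inf[OF assms(1)] by (auto simp: W_def)
  qed
  have meets: "U \<inter> ?S \<noteq> {}" if "openin (X_inf_topology \<Omega>) U" "U \<noteq> {}" for U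
    unfolding S by (rule X_inf_Baire[OF assms(1) W dense that])
  \<comment> \<open>Existence follows from density once \<open>X_inf \<Omega>\<close> is nonempty,
    and the zero function shows that it is.\<close>
  have "restrict (\<lambda>_. 0) \<Omega> \<in> hol_closure \<Omega>"
    unfolding hol_closure_def by (auto intro!: exI[of _ "\<lambda>_. 0"] exI[of _ UNIV])
  then have "X_inf \<Omega> \<noteq> {}" using hol_closure_subset_X_inf[OF assms(1)] by blast
  then have "\<exists>f\<in>A_inf \<Omega>. pade_approximable \<Omega> \<zeta>\<^sub>0 F f"
    using meets[of "X_inf \<Omega>"] openin_topspace[of "X_inf_topology \<Omega>"] X_inf_subset_A_inf by fastforce
  moreover have "gdelta_in (X_inf_topology \<Omega>) ?S"
    unfolding S by (rule gdelta_in_Inter) (auto intro: open_imp_gdelta_in W)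
  moreover have "Abstract_Topology.closure_of (X_inf_topology \<Omega>) ?S = X_inf \<Omega>"
    using meets dense_intersects_open[of "X_inf_topology \<Omega>" ?S] by (auto simp: Int_commute)
  ultimately show ?thesis by blast
qed

end
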